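(* Let $Z,X,\Omega,\Theta$ be locally compact Hausdorff spaces, $\phi\in C_0(Z\times\Omega)$, $\psi\in C_0(X\times\Theta)$, and let $(\mathcal{V},\mathcal{V}^\diamond)$ be a continuous dual pair of Banach spaces such that $\mathcal{V}$ has $\mathcal{V}^\diamond$ as predual (i.e. $(\mathcal{V}^\diamond)^*=\mathcal{V}$ with the canonical pairing). Let $\mathcal{B}$ be the integral vv-RKBS of functions $X\to\mathcal{V}$ with weight space $\Theta$ and integrand $\psi$, and let the measurement operator $M\colon\mathcal{B}\to\mathbb{R}^d$ be given by $(Mf)_j=\langle v_j^\diamond,f(x_j)\rangle_{\mathcal{V}}$ with $\{(v_j^\diamond,x_j)\}_{j=1}^d\subseteq\mathcal{V}^\diamond\times X$. Assume we are given data $\{(z_n,y_n)\}_{n=1}^N\subseteq Z\times\mathbb{R}^d$, and let $L\colon\mathbb{R}^d\times\mathbb{R}^d\to\mathbb{R}$ be such that for every $y\in\mathbb{R}^d$, the map $L(\cdot,y)$ is convex, coercive, and lower semicontinuous. For $\lambda\ge0$ consider either the weight-space problem $$\min_{\mu\in\mathcal{M}(\Omega;\mathcal{M}(\Theta;\mathcal{V}))}\ \frac1N\sum_{n=1}^N L\big(M(A_{\Theta\to X}((A_{\Omega\to Z}\mu)(z_n))),y_n\big)+\lambda|\mu|_{\mathcal{M}(\Theta;\mathcal{V})}(\Omega)$$ or the function-space problem $$\min_{\mu\in\mathcal{M}(\Omega;\mathcal{B})}\ \frac1N\sum_{n=1}^N L\big(M((A_{\Omega\to Z}\mu)(z_n)),y_n\big)+\lambda|\mu|_{\mathcal{B}}(\Omega).$$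 Then there exist solutions $\mu^\dagger_{\mathcal{M}}$ of the weight-space problem and $\mu^\dagger_{\mathcal{B}}$ of the function-space problem, respectively, that have the form $$\mu^\dagger_{\mathcal{M}}=\sum_{m=1}^{Nd}\delta_{w_m}\delta_{\theta_m}v_m,\qquad\mu^\dagger_{\mathcal{B}}=\sum_{m=1}^{Nd}\delta_{w_m}A_{\Theta\to X}(\delta_{\theta_m}v_m)$$ with $w_m\in\Omega$, $\theta_m\in\Theta$ and $v_m\in\mathcal{V}$ (scalar coefficients being absorbed into $v_m$; the same $w_m,\theta_m,v_m$ in both). Both measures yield the same function $$f^\dagger(z)(x)=\sum_{m=1}^{Nd}\phi(z,w_m)\,\psi(x,\theta_m)\,v_m,$$ that is, $f^\dagger(z)=A_{\Theta\to X}((A_{\Omega\to Z}\mu^\dagger_{\mathcal{M}})(z))=(A_{\Omega\to Z}\mu^\dagger_{\mathcal{B}})(z)$.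
   Context: All vector spaces are real. Dual pair: a continuous dual pair of Banach spaces $(E,E^\diamond)$ consists of two Banach spaces and a continuous bilinear map $\langle\cdot,\cdot\rangle_E\colon E^\diamond\times E\to\mathbb{R}$ such that $\langle g,f\rangle_E=0$ for all $g\in E^\diamond$ implies $f=0$, and $\langle g,f\rangle_E=0$ for all $f\in E$ implies $g=0$. For a Banach space $V$ and a locally compact Hausdorff space $\Omega$, $\mathcal{M}(\Omega;V)$ is the space of regular countably additive $V$-valued Borel vector measures of finite total variation, itself a Banach space with norm $|\mu|_V(\Omega)$, where $|\mu|_V$ is the total variation measure. $C_0(\cdot)$ denotes continuous real functions vanishing at infinity. For $v\in V$, $\delta_w v$ is the $V$-valued measure $E\mapsto v$ if $w\in E$ and $0$ otherwise; thus $\delta_{w}\delta_{\theta}v\in\mathcal{M}(\Omega;\mathcal{M}(\Theta;\mathcal{V}))$ is the point mass at $w$ with value $\delta_\theta v\in\mathcal{M}(\Theta;\mathcal{V})$. Operators: for a measure $\mu$ on $\Omega$ with values in any Banach space, $(A_{\Omega\to Z}\mu)(z):=\int_\Omega\phi(z,w)\,d\mu(w)$; for a measure $\nu$ on $\Theta$ with values in any Banach space, $A_{\Theta\to X}\nu:=\int_\Theta\psi(\cdot,\theta)\,d\nu(\theta)$. Integral vv-RKBS $\mathcal{B}$ with integrand $\psi$: $\mathcal{B}:=\{u=A_{\Theta\to X}\nu\colon X\to\mathcal{V}\mid\nu\in\mathcal{M}(\Theta;\mathcal{V})\}$ with $\|u\|_{\mathcal{B}}:=\inf_{u=A_{\Theta\to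 X}\nu}|\nu|_{\mathcal{V}}(\Theta)$. *)

theory Defs
  imports "HOL-Analysis.Analysis" "HOL-Library.Function_Algebras"
begin

text \<open>Pointwise real vector space structure on functions, so that set functions
  and functions \<open>X \<rightarrow> \<V>\<close> can themselves be values of vector measures.\<close>

instantiation "fun" :: (type, real_vector) real_vector
begin

definition "scaleR c f = (\<lambda>x. c *\<^sub>R f x)"

instance
  by standard (auto simp: scaleR_fun_def plus_fun_def algebra_simps)

end

text \<open>The space \<open>\<B>\<close> depends on the integrand \<open>\<psi>\<close> and hence is not a type. Spaces
  in which vector measures take their values are therefore given by a carrier and a norm
  function inside a real vector space; the norm is only meaningful on the carrier.\<close>

record 'b nspace =
  carr :: "'b set"
  nrm :: "'b \<Rightarrow> real"

definition banach_nspace :: "('v::banach) nspace" where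
  "banach_nspace = \<lparr>carr = UNIV, nrm = norm\<rparr>"

subsection \<open>Dual pairs\<close>

definition dual_pair :: "('g::banach \<Rightarrow> 'f::banach \<Rightarrow> real) \<Rightarrow> bool" where
  "dual_pair p \<longleftrightarrow> bounded_bilinear p
     \<and> (\<forall>f. (\<forall>g. p g f = 0) \<longrightarrow> f = 0)
     \<and> (\<forall>g. (\<forall>f. p g f = 0) \<longrightarrow> g = 0)"

text \<open>\<open>(\<V>\<^sup>\<diamond>)\<^sup>* = \<V>\<close> as Banach spaces: \<open>v \<mapsto> \<langle>\<cdot>, v\<rangle>\<close> is an isometry onto the dual.\<close>

definition canonical_predual :: "('g::banach \<Rightarrow> 'f::banach \<Rightarrow> real) \<Rightarrow> bool" where
  "canonical_predual p \<longleftrightarrow>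
     (\<forall>v. norm (Blinfun (\<lambda>g. p g v)) = norm v) \<and>
     surj (\<lambda>v. Blinfun (\<lambda>g. p g v))"

subsection \<open>Scalar functions\<close>

definition C0 :: "('a::topological_space \<Rightarrow> real) set" where
  "C0 = {f. continuous_on UNIV f \<and>
            (\<forall>e>0. \<exists>K. compact K \<and> (\<forall>x. x \<notin> K \<longrightarrow> \<bar>f x\<bar> < e))}"

definition lower_semicontinuous :: "('a::topological_space \<Rightarrow> real) \<Rightarrow> bool" where
  "lower_semicontinuous f \<longleftrightarrow> (\<forall>x c. c < f x \<longrightarrow> (\<forall>\<^sub>F y in nhds x. c < f y))"

definition coercive :: "('a::real_normed_vector \<Rightarrow> real) \<Rightarrow> bool" where
  "coercive f \<longleftrightarrow> filterlim f at_top at_infinity"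

subsection \<open>Vector measures\<close>

definition variation ::
  "'b nspace \<Rightarrow> ('w::topological_space set \<Rightarrow> 'b) \<Rightarrow> 'w set \<Rightarrow> ennreal" where
  "variation E \<mu> A =
     (SUP P \<in> {P. finite P \<and> P \<subseteq> sets borel \<and> disjoint P \<and> \<Union>P = A}.
        \<Sum>B\<in>P. ennreal (nrm E (\<mu> B)))"

definition countably_additive_in ::
  "('b::real_vector) nspace \<Rightarrow> ('w::topological_space set \<Rightarrow> 'b) \<Rightarrow> bool" where
  "countably_additive_in E \<mu> \<longleftrightarrow>
     (\<forall>A :: nat \<Rightarrow> 'w set. range A \<subseteq> sets borel \<longrightarrow> disjoint_family A \<longrightarrow>
        (\<lambda>n. nrm E (\<mu> (\<Union>i. A i) - (\<Sum>i<n. \<mu> (A i)))) \<longlonglongrightarrow> 0)"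

definition regular_in ::
  "'b nspace \<Rightarrow> ('w::topological_space set \<Rightarrow> 'b) \<Rightarrow> bool" where
  "regular_in E \<mu> \<longleftrightarrow>
     (\<forall>A \<in> sets borel. \<forall>e>0. \<exists>K U. compact K \<and> open U \<and> K \<subseteq> A \<and> A \<subseteq> U \<and>
        variation E \<mu> (U - K) < ennreal e)"

text \<open>\<open>\<M>(\<Omega>; E)\<close> with the total variation norm. Set functions are fixed to be \<open>0\<close> on
  non-Borel sets, so that equality of measures is equality of functions.\<close>

definition vmeas ::
  "('b::real_vector) nspace \<Rightarrow> ('w::topological_space set \<Rightarrow> 'b) nspace" where
  "vmeas E =
     \<lparr>carr = {\<mu>. (\<forall>A \<in> sets borel. \<mu> A \<in> carr E) \<and> (\<forall>A. A \<notin> sets borel \<longrightarrow> \<mu> A = 0) \<and>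
               countably_additive_in E \<mu> \<and> variation E \<mu> UNIV < \<infinity> \<and> regular_in E \<mu>},
      nrm = (\<lambda>\<mu>. enn2real (variation E \<mu> UNIV))\<rparr>"

definition point_mass :: "'w::topological_space \<Rightarrow> 'b::real_vector \<Rightarrow> 'w set \<Rightarrow> 'b" where
  "point_mass w v = (\<lambda>A. if A \<in> sets borel \<and> w \<in> A then v else 0)"

subsection \<open>Integration of scalar functions\<close>

definition simple_vint ::
  "('w::topological_space set \<Rightarrow> 'b::real_vector) \<Rightarrow> ('w \<Rightarrow> real) \<Rightarrow> 'b" where
  "simple_vint \<mu> s = (\<Sum>y\<in>range s. y *\<^sub>R \<mu> (s -` {y}))"

text \<open>The integral of a bounded Borel function \<open>f\<close>, by uniform approximation with simple
  functions. As \<open>\<mu>\<close> has finite variation, the limit in \<open>E\<close> does not depend on the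
  approximating sequence, and it exists whenever \<open>E\<close> is complete.\<close>

definition has_vint ::
  "('b::real_vector) nspace \<Rightarrow> ('w::topological_space set \<Rightarrow> 'b) \<Rightarrow> ('w \<Rightarrow> real) \<Rightarrow> 'b \<Rightarrow> bool"
  where
  "has_vint E \<mu> f I \<longleftrightarrow> I \<in> carr E \<and>
     (\<exists>s :: nat \<Rightarrow> 'w \<Rightarrow> real. (\<forall>n. simple_function borel (s n)) \<and>
          uniform_limit UNIV s f sequentially \<and>
          (\<lambda>n. nrm E (simple_vint \<mu> (s n) - I)) \<longlonglongrightarrow> 0)"

definition vint ::
  "('b::real_vector) nspace \<Rightarrow> ('w::topological_space set \<Rightarrow> 'b) \<Rightarrow> ('w \<Rightarrow> real) \<Rightarrow> 'b" where
  "vint E \<mu> f = (THE I. has_vint E \<mu> f I)"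

definition int_op ::
  "('b::real_vector) nspace \<Rightarrow> ('z \<times> 'w::topological_space \<Rightarrow> real) \<Rightarrow>
   ('w set \<Rightarrow> 'b) \<Rightarrow> 'z \<Rightarrow> 'b" where
  "int_op E k \<mu> = (\<lambda>z. vint E \<mu> (\<lambda>w. k (z, w)))"

subsection \<open>Integral vector-valued RKBS and the measurement operator\<close>

definition rkbs ::
  "('x \<times> 't::topological_space \<Rightarrow> real) \<Rightarrow> ('x \<Rightarrow> 'v::banach) nspace" where
  "rkbs \<psi> =
     \<lparr>carr = {int_op banach_nspace \<psi> \<nu> | \<nu>. \<nu> \<in> carr (vmeas banach_nspace)},
      nrm = (\<lambda>u. Inf {nrm (vmeas banach_nspace) \<nu> | \<nu>.
                  \<nu> \<in> carr (vmeas banach_nspace) \<and> u = int_op banach_nspace \<psi> \<nu>})\<rparr>"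

definition measurement ::
  "('g \<Rightarrow> 'v \<Rightarrow> real) \<Rightarrow> ('d \<Rightarrow> 'g) \<Rightarrow> ('d \<Rightarrow> 'x) \<Rightarrow> ('x \<Rightarrow> 'v) \<Rightarrow> real ^ 'd::finite" where
  "measurement p g x f = (\<chi> j. p (g j) (f (x j)))"

end

theory Submission
  imports Defs
begin

text \<open>Only the \<open>Nd\<close> numbers \<open>\<langle>v\<^sub>j, f(z\<^sub>n)(x\<^sub>j)\<rangle>\<close> enter the loss. Let \<open>D\<close> be the set of such data vectors
  produced by the point masses \<open>\<delta>\<^sub>w \<delta>\<^sub>\<theta> v\<close> with \<open>\<parallel>v\<parallel> \<le> 1\<close>. It is compact: the kernels vanish at infinity
  and the unit ball is weak-* compact because \<open>\<V>\<close> is a dual space. Approximating the integrals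
  by Riemann sums, in \<open>\<Omega>\<close> and in \<open>\<Theta>\<close>, shows that any measure of norm \<open>t\<close>, in either of the two problems,
  has its data vector in \<open>t\<close> times the convex hull of \<open>D\<close>. Hence both problems are bounded below by the
  minimum of loss plus \<open>\<lambda> t\<close> over these multiples of the hull, a finite-dimensional problem whose
  minimum is attained. Caratheodory's argument for cones writes the minimizer as a
  nonnegative combination of at most \<open>Nd\<close> elements of \<open>D\<close> of total weight at most \<open>t\<close>, and the
  corresponding sums of point masses attain the bound in both problems.\<close>

section \<open>Spaces of vector measures\<close>

text \<open>Measure spaces are used with their norm only; compactness enters through data vectors in
  a product topology. Membership in \<open>t\<close> times the hull is the one relation carried
  through both integrations, so a single Riemann sum lemma serves three times. The obstacles lie
  elsewhere. An integral is a \<open>THE\<close>, so every space of values must first be shown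
  complete; for \<B> this means a quotient of a complete space of measures by a closed kernel. The
  norm of \<B> is an infimum that need not be attained, so its elements are reached only through
  measures of slightly larger norm, and the excess is removed by a limit in the compact hull. For
  \<open>lam = 0\<close> the bound on \<open>t\<close> has to come from coercivity of the loss and
  the symmetry of \<open>D\<close>. Finally, Caratheodory's argument removes linear instead of
  affine dependencies: this yields \<open>Nd\<close> terms instead of \<open>Nd + 1\<close>,
  provided that the total weight does not grow on the way.\<close>

locale normed_nspace =
  fixes E :: "'b::real_vector nspace"
  assumes zero_mem: "0 \<in> carr E"
    and add_mem: "x \<in> carr E \<Longrightarrow> y \<in> carr E \<Longrightarrow> x + y \<in> carr E"
    and scaleR_mem: "x \<in> carr E \<Longrightarrow> c *\<^sub>R x \<in> carr E"
    and nrm_triangle: "x \<in> carr E \<Longrightarrow> y \<in> carr E \<Longrightarrow> nrm E (x + y) \<le> nrm E x + nrm E y"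
    and nrm_scaleR: "x \<in> carr E \<Longrightarrow> nrm E (c *\<^sub>R x) = \<bar>c\<bar> * nrm E x"
    and nrm_definite: "x \<in> carr E \<Longrightarrow> nrm E x = 0 \<Longrightarrow> x = 0"
begin

lemma minus_mem: "x \<in> carr E \<Longrightarrow> - x \<in> carr E"
  using scaleR_mem[of x "-1"] by simp

lemma diff_mem: "x \<in> carr E \<Longrightarrow> y \<in> carr E \<Longrightarrow> x - y \<in> carr E"
  using add_mem[of x "- y"] minus_mem[of y] by simp

lemma sum_mem: "(\<And>i. i \<in> I \<Longrightarrow> f i \<in> carr E) \<Longrightarrow> (\<Sum>i\<in>I. f i) \<in> carr E"
  by (induction I rule: infinite_finite_induct) (auto intro: zero_mem add_mem)

lemma nrm_zero [simp]: "nrm E 0 = 0"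
  using nrm_scaleR[OF zero_mem, of 0] by simp

lemma nrm_minus: "x \<in> carr E \<Longrightarrow> nrm E (- x) = nrm E x"
  using nrm_scaleR[of x "-1"] by simp

lemma nrm_nonneg: "x \<in> carr E \<Longrightarrow> 0 \<le> nrm E x"
  using nrm_triangle[of x "- x"] minus_mem[of x] nrm_minus[of x] by simp

lemma nrm_diff_commute: "x \<in> carr E \<Longrightarrow> y \<in> carr E \<Longrightarrow> nrm E (x - y) = nrm E (y - x)"
  using nrm_minus[OF diff_mem, of x y] by simp

lemma nrm_diff_triangle:
  "x \<in> carr E \<Longrightarrow> y \<in> carr E \<Longrightarrow> z \<in> carr E \<Longrightarrow> nrm E (x - z) \<le> nrm E (x - y) + nrm E (y - z)"
  using nrm_triangle[OF diff_mem diff_mem, of x y y z] by simp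

lemma nrm_diff_le:
  "x \<in> carr E \<Longrightarrow> y \<in> carr E \<Longrightarrow> nrm E (x - y) \<le> nrm E x + nrm E y"
  using nrm_triangle[of x "- y"] minus_mem[of y] nrm_minus[of y] by simp

lemma nrm_sum: "(\<And>i. i \<in> I \<Longrightarrow> f i \<in> carr E) \<Longrightarrow> nrm E (\<Sum>i\<in>I. f i) \<le> (\<Sum>i\<in>I. nrm E (f i))"
proof (induction I rule: infinite_finite_induct)
  case (insert i I)
  then show ?case
    using nrm_triangle[of "f i" "\<Sum>i\<in>I. f i"] sum_mem[of I f] by force
qed auto

text \<open>The bound is the exact geometric sum of the increments from \<open>n\<close> to
  \<open>n + k\<close>; keeping the subtracted term lets the induction close.\<close>

lemma fast_Cauchy_dist:
  assumes "\<And>n. X n \<in> carr E" "\<And>n. nrm E (X (Suc n) - X n) \<le> (1/2) ^ n"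
  shows "nrm E (X (n + k) - X n) \<le> 2 * (1/2) ^ n - 2 * (1/2) ^ (n + k)"
proof (induction k)
  case (Suc k)
  have "nrm E (X (n + Suc k) - X n) \<le> nrm E (X (Suc (n + k)) - X (n + k)) + nrm E (X (n + k) - X n)"
    using nrm_diff_triangle[of "X (n + Suc k)" "X (n + k)" "X n"] assms(1) by simp
  also have "\<dots> \<le> (1/2) ^ (n + k) + (2 * (1/2) ^ n - 2 * (1/2) ^ (n + k))"
    using Suc assms(2) by (intro add_mono) auto
  finally show ?case by simp
qed simp

lemma fast_Cauchy_dist':
  assumes "\<And>n. X n \<in> carr E" "\<And>n. nrm E (X (Suc n) - X n) \<le> (1/2) ^ n" "n \<le> m"
  shows "nrm E (X n - X m) \<le> 2 * (1/2) ^ n"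
proof -
  obtain k where k: "m = n + k" using assms(3) le_Suc_ex by blast
  have "nrm E (X n - X m) \<le> 2 * (1/2) ^ n - 2 * (1/2) ^ m"
    using fast_Cauchy_dist[OF assms(1,2), of n k] nrm_diff_commute[OF assms(1,1)] by (simp add: k)
  moreover have "(0::real) \<le> 2 * (1/2) ^ m" by simp
  ultimately show ?thesis by linarith
qed

lemma nrm_limit_unique:
  assumes "x \<in> carr E" "y \<in> carr E" "\<And>n. X n \<in> carr E"
    and "(\<lambda>n. nrm E (X n - x)) \<longlonglongrightarrow> 0" "(\<lambda>n. nrm E (X n - y)) \<longlonglongrightarrow> 0"
  shows "x = y"
proof -
  have "nrm E (x - y) \<le> 0"
  proof (rule tendsto_le[OF sequentially_bot])
    show "(\<lambda>n. nrm E (X n - x) + nrm E (X n - y)) \<longlonglongrightarrow> 0"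
      using tendsto_add[OF assms(4,5)] by simp
    show "(\<lambda>n. nrm E (x - y)) \<longlonglongrightarrow> nrm E (x - y)" by simp
    show "\<forall>\<^sub>F n in sequentially. nrm E (x - y) \<le> nrm E (X n - x) + nrm E (X n - y)"
      using nrm_diff_triangle[of x "X _" y] nrm_diff_commute[of x "X _"] assms(1-3) by auto
  qed
  then show ?thesis
    using nrm_definite[of "x - y"] nrm_nonneg[of "x - y"] diff_mem[of x y] assms(1,2) by force
qed

end

text \<open>Completeness is only asked for sequences with geometrically decreasing increments; this
  suffices, and such sequences lift along quotient maps.\<close>

locale complete_nspace = normed_nspace E for E :: "'b::real_vector nspace" +
  assumes fast_Cauchy: "(\<And>n. X n \<in> carr E) \<Longrightarrow> (\<And>n. nrm E (X (Suc n) - X n) \<le> (1/2) ^ n) \<Longrightarrow>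
          \<exists>l\<in>carr E. (\<lambda>n. nrm E (X n - l)) \<longlonglongrightarrow> 0"
begin

text \<open>The rate depends on \<open>n\<close> alone; this makes setwise limits of measures
  uniform over all Borel sets in \<open>complete_nspace_vmeas\<close>.\<close>

lemma fast_Cauchy_rate:
  assumes X: "\<And>n. X n \<in> carr E" "\<And>n. nrm E (X (Suc n) - X n) \<le> (1/2) ^ n"
  obtains l where "l \<in> carr E" "\<And>n. nrm E (X n - l) \<le> 2 * (1/2) ^ n"
proof -
  obtain l where l: "l \<in> carr E" "(\<lambda>n. nrm E (X n - l)) \<longlonglongrightarrow> 0"
    using fast_Cauchy[OF X] by blast
  have "nrm E (X n - l) \<le> 2 * (1/2) ^ n" for n
  proof (rule tendsto_le[OF sequentially_bot])
    show "(\<lambda>m. 2 * (1/2) ^ n + nrm E (X m - l)) \<longlonglongrightarrow> 2 * (1/2) ^ n"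
      using tendsto_add[OF tendsto_const[of "2 * (1/2) ^ n"] l(2)] by simp
    show "(\<lambda>m. nrm E (X n - l)) \<longlonglongrightarrow> nrm E (X n - l)" by simp
    have "nrm E (X n - l) \<le> 2 * (1/2) ^ n + nrm E (X m - l)" if "m \<ge> n" for m
      using nrm_diff_triangle[of "X n" "X m" l] fast_Cauchy_dist'[OF X that] X(1) l(1) by fastforce
    then show "\<forall>\<^sub>F m in sequentially. nrm E (X n - l) \<le> 2 * (1/2) ^ n + nrm E (X m - l)"
      unfolding eventually_sequentially by blast
  qed
  then show thesis using l(1) that by blast
qed

end

lemma complete_nspace_banach: "complete_nspace (banach_nspace :: 'v::banach nspace)"
proof
  fix X :: "nat \<Rightarrow> 'v"
  assume X: "\<And>n. nrm banach_nspace (X (Suc n) - X n) \<le> (1/2) ^ n"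
  have "summable (\<lambda>n. X (Suc n) - X n)"
    using X by (intro summable_comparison_test'[OF summable_geometric[of "1/2"], of 0])
      (auto simp: banach_nspace_def)
  then obtain l where "(\<lambda>n. \<Sum>i<n. X (Suc i) - X i) \<longlonglongrightarrow> l"
    by (auto simp: summable_def sums_def)
  then have "(\<lambda>n. X n - X 0 - l) \<longlonglongrightarrow> 0"
    by (simp add: sum_lessThan_telescope LIM_zero)
  then have "(\<lambda>n. norm (X n - (X 0 + l))) \<longlonglongrightarrow> 0"
    by (simp add: tendsto_norm_zero diff_diff_eq)
  then show "\<exists>l\<in>carr banach_nspace. (\<lambda>n. nrm banach_nspace (X n - l)) \<longlonglongrightarrow> 0"
    by (auto simp: banach_nspace_def)
qed (auto simp: banach_nspace_def norm_triangle_ineq)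

lemma banach_nspace_simps [simp]: "carr banach_nspace = UNIV" "nrm banach_nspace = norm"
  by (simp_all add: banach_nspace_def)

section \<open>Total variation and finite additivity\<close>

text \<open>The supremum in \<open>variation\<close> ranges over sets of cells with union exactly
  \<open>S\<close>, whereas applications supply indexed families that need not cover
  \<open>S\<close>. The remainder becomes a further cell, and distinct indices with the same cell
  can only carry the empty set, whose norm is 0.\<close>

lemma sum_le_variation:
  assumes I: "finite I" "\<And>i. i \<in> I \<Longrightarrow> A i \<in> sets borel" "disjoint_family_on A I"
    and S: "S \<in> sets borel" "(\<Union>i\<in>I. A i) \<subseteq> S" and "nrm E (\<mu> {}) = 0"
  shows "(\<Sum>i\<in>I. ennreal (nrm E (\<mu> (A i)))) \<le> variation E \<mu> S"
proof -
  let ?R = "S - (\<Union>i\<in>I. A i)"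
  let ?P = "insert ?R (A ` I)"
  have "?R \<in> sets borel" using I S by (intro sets.Diff sets.finite_UN) auto
  moreover have "disjoint ?P"
    using I(3) by (fastforce simp: pairwise_def disjnt_def disjoint_family_on_def)
  ultimately have P: "finite ?P" "?P \<subseteq> sets borel" "disjoint ?P" "\<Union>?P = S"
    using I S by auto
  have "(\<Sum>i\<in>I. ennreal (nrm E (\<mu> (A i)))) = (\<Sum>B\<in>A ` I. ennreal (nrm E (\<mu> B)))"
  proof (subst sum.reindex_nontrivial[OF I(1)])
    fix i j assume "i \<in> I" "j \<in> I" "i \<noteq> j" "A i = A j"
    then have "A i = {}" using I(3) by (auto simp: disjoint_family_on_def)
    then show "ennreal (nrm E (\<mu> (A i))) = 0" using assms(6) by simp
  qed simp
  also have "\<dots> \<le> (\<Sum>B\<in>?P. ennreal (nrm E (\<mu> B)))"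
    using I(1) by (intro sum_mono2) auto
  also have "\<dots> \<le> variation E \<mu> S"
    unfolding variation_def using P by (intro SUP_upper) auto
  finally show ?thesis .
qed

lemma variation_mono:
  assumes "A \<in> sets borel" "S \<in> sets borel" "A \<subseteq> S" "nrm E (\<mu> {}) = 0"
  shows "variation E \<mu> A \<le> variation E \<mu> S"
proof -
  have "(\<Sum>B\<in>P. ennreal (nrm E (\<mu> B))) \<le> variation E \<mu> S"
    if "finite P" "P \<subseteq> sets borel" "disjoint P" "\<Union>P = A" for P
    using that assms by (intro sum_le_variation[where A=id, simplified])
      (auto simp: disjoint_family_on_def pairwise_def disjnt_def)
  then show ?thesis unfolding variation_def[of E \<mu> A] by (intro SUP_least) auto
qed

lemma open_Diff_compact_borel:
  fixes U :: "'w::t2_space set"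
  shows "open U \<Longrightarrow> compact K \<Longrightarrow> U - K \<in> sets borel"
  by (intro borel_open open_Diff compact_imp_closed)

lemma countably_additive_inD:
  assumes "countably_additive_in E \<mu>" "range A \<subseteq> sets borel" "disjoint_family A"
  shows "(\<lambda>n. nrm E (\<mu> (\<Union>i. A i) - (\<Sum>i<n. \<mu> (A i)))) \<longlonglongrightarrow> 0"
  using assms(1)[unfolded countably_additive_in_def, rule_format, OF assms(2,3)] .

lemma regular_inE:
  assumes "regular_in E \<mu>" "A \<in> sets borel" "e > 0"
  obtains K U where "compact K" "open U" "K \<subseteq> A" "A \<subseteq> U" "variation E \<mu> (U - K) < ennreal e"
proof -
  have "\<exists>K U. compact K \<and> open U \<and> K \<subseteq> A \<and> A \<subseteq> U \<and> variation E \<mu> (U - K) < ennreal e"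
    using assms(1)[unfolded regular_in_def, rule_format, OF assms(2,3)] .
  then show thesis by (elim exE conjE) (rule that)
qed

context normed_nspace
begin

lemma variation_leI:
  assumes "\<And>B. B \<in> sets borel \<Longrightarrow> \<mu> B \<in> carr E"
    and "\<And>P. finite P \<Longrightarrow> P \<subseteq> sets borel \<Longrightarrow> disjoint P \<Longrightarrow> \<Union>P = A \<Longrightarrow>
          (\<Sum>B\<in>P. nrm E (\<mu> B)) \<le> c"
  shows "variation E \<mu> A \<le> ennreal c"
proof -
  have "(\<Sum>B\<in>P. ennreal (nrm E (\<mu> B))) \<le> ennreal c"
    if "finite P" "P \<subseteq> sets borel" "disjoint P" "\<Union>P = A" for P
    using that assms by (subst sum_ennreal) (auto intro!: nrm_nonneg ennreal_leI)
  then show ?thesis unfolding variation_def by (intro SUP_least) auto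
qed

lemma variation_add_le:
  assumes "\<And>B. B \<in> sets borel \<Longrightarrow> \<mu> B \<in> carr E" "\<And>B. B \<in> sets borel \<Longrightarrow> \<nu> B \<in> carr E"
  shows "variation E (\<mu> + \<nu>) A \<le> variation E \<mu> A + variation E \<nu> A"
proof -
  have "(\<Sum>B\<in>P. ennreal (nrm E ((\<mu> + \<nu>) B))) \<le> variation E \<mu> A + variation E \<nu> A"
    if P: "finite P" "P \<subseteq> sets borel" "disjoint P" "\<Union>P = A" for P
  proof -
    have "(\<Sum>B\<in>P. ennreal (nrm E ((\<mu> + \<nu>) B)))
        \<le> (\<Sum>B\<in>P. ennreal (nrm E (\<mu> B)) + ennreal (nrm E (\<nu> B)))"
    proof (rule sum_mono)
      fix B assume "B \<in> P"
      then have "\<mu> B \<in> carr E" "\<nu> B \<in> carr E" using P assms by auto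
      then show "ennreal (nrm E ((\<mu> + \<nu>) B)) \<le> ennreal (nrm E (\<mu> B)) + ennreal (nrm E (\<nu> B))"
        using nrm_triangle nrm_nonneg by (simp flip: ennreal_plus add: ennreal_leI)
    qed
    also have "\<dots> \<le> variation E \<mu> A + variation E \<nu> A"
      unfolding sum.distrib variation_def using P by (intro add_mono SUP_upper) auto
    finally show ?thesis .
  qed
  then show ?thesis unfolding variation_def[of E "\<mu> + \<nu>" A] by (intro SUP_least) auto
qed

lemma variation_scaleR:
  assumes "\<And>B. B \<in> sets borel \<Longrightarrow> \<mu> B \<in> carr E"
  shows "variation E (c *\<^sub>R \<mu>) A = ennreal \<bar>c\<bar> * variation E \<mu> A"
proof -
  have "variation E (c *\<^sub>R \<mu>) A =
    (SUP P \<in> {P. finite P \<and> P \<subseteq> sets borel \<and> disjoint P \<and> \<Union>P = A}.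
        ennreal \<bar>c\<bar> * (\<Sum>B\<in>P. ennreal (nrm E (\<mu> B))))"
    unfolding variation_def
  proof (rule SUP_cong[OF refl])
    fix P assume "P \<in> {P. finite P \<and> P \<subseteq> sets borel \<and> disjoint P \<and> \<Union>P = A}"
    then have "\<mu> B \<in> carr E" if "B \<in> P" for B using that assms by auto
    then show "(\<Sum>B\<in>P. ennreal (nrm E ((c *\<^sub>R \<mu>) B))) = ennreal \<bar>c\<bar> * (\<Sum>B\<in>P. ennreal (nrm E (\<mu> B)))"
      unfolding sum_distrib_left
      by (intro sum.cong) (auto simp: scaleR_fun_def nrm_scaleR ennreal_mult' nrm_nonneg)
  qed
  then show ?thesis by (simp add: variation_def SUP_mult_left_ennreal)
qed

lemma vmeas_memD:
  assumes "\<mu> \<in> carr (vmeas E)"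
  shows "B \<in> sets borel \<Longrightarrow> \<mu> B \<in> carr E" "B \<notin> sets borel \<Longrightarrow> \<mu> B = 0"
    "countably_additive_in E \<mu>" "variation E \<mu> UNIV < \<infinity>" "regular_in E \<mu>"
  using assms by (auto simp: vmeas_def)

lemma vmeas_memI:
  assumes "\<And>B. B \<in> sets borel \<Longrightarrow> \<mu> B \<in> carr E" "\<And>B. B \<notin> sets borel \<Longrightarrow> \<mu> B = 0"
    "countably_additive_in E \<mu>" "variation E \<mu> UNIV < \<infinity>" "regular_in E \<mu>"
  shows "\<mu> \<in> carr (vmeas E)"
  using assms by (auto simp: vmeas_def)

lemma variation_eq_nrm:
  assumes "\<mu> \<in> carr (vmeas E)"
  shows "variation E \<mu> UNIV = ennreal (nrm (vmeas E) \<mu>)"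
  using vmeas_memD(4)[OF assms] by (simp add: vmeas_def)

lemma nrm_vmeas_nonneg: "0 \<le> nrm (vmeas E) \<mu>"
  by (simp add: vmeas_def)

lemma nrm_vmeas_leI: "variation E \<mu> UNIV \<le> ennreal c \<Longrightarrow> 0 \<le> c \<Longrightarrow> nrm (vmeas E) \<mu> \<le> c"
  by (simp add: vmeas_def enn2real_leI)

text \<open>For the constant sequence \<open>{}\<close>, the error in countable additivity after
  \<open>n\<close> terms has norm \<open>\<bar>1 - real n\<bar> * nrm E (\<mu> {})\<close>, which
  tends to 0 only if \<open>\<mu> {}\<close> has norm 0.\<close>

lemma vmeas_empty:
  assumes "\<mu> \<in> carr (vmeas E)"
  shows "\<mu> {} = 0"
proof -
  have mem: "\<mu> {} \<in> carr E" using vmeas_memD(1)[OF assms] by simp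
  have lim: "(\<lambda>n. nrm E (\<mu> {} - (\<Sum>i<n. \<mu> {}))) \<longlonglongrightarrow> 0"
    using vmeas_memD(3)[OF assms] unfolding countably_additive_in_def
    by (auto dest!: spec[of _ "\<lambda>_. {}"] simp: disjoint_family_on_def)
  have "\<mu> {} - (\<Sum>i<n. \<mu> {}) = (1 - real n) *\<^sub>R \<mu> {}" for n :: nat
    by (simp add: scaleR_left_diff_distrib sum_constant_scaleR del: sum_constant)
  then have eq: "nrm E (\<mu> {} - (\<Sum>i<n. \<mu> {})) = \<bar>1 - real n\<bar> * nrm E (\<mu> {})" for n :: nat
    using nrm_scaleR[OF mem] by simp
  have "nrm E (\<mu> {}) \<le> 0"
  proof (rule tendsto_le[OF sequentially_bot lim tendsto_const])
    have "nrm E (\<mu> {}) \<le> nrm E (\<mu> {} - (\<Sum>i<n. \<mu> {}))" if "n \<ge> 2" for n :: nat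
      unfolding eq using that nrm_nonneg[OF mem] mult_right_mono[of 1 "\<bar>1 - real n\<bar>" "nrm E (\<mu> {})"] by simp
    then show "\<forall>\<^sub>F n in sequentially. nrm E (\<mu> {}) \<le> nrm E (\<mu> {} - (\<Sum>i<n. \<mu> {}))"
      unfolding eventually_sequentially by blast
  qed
  then show ?thesis using nrm_nonneg[OF mem] nrm_definite[OF mem] by simp
qed

lemma sum_nrm_le:
  assumes "\<mu> \<in> carr (vmeas E)" "finite I" "\<And>i. i \<in> I \<Longrightarrow> A i \<in> sets borel" "disjoint_family_on A I"
  shows "(\<Sum>i\<in>I. nrm E (\<mu> (A i))) \<le> nrm (vmeas E) \<mu>"
proof -
  have "ennreal (\<Sum>i\<in>I. nrm E (\<mu> (A i))) = (\<Sum>i\<in>I. ennreal (nrm E (\<mu> (A i))))"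
    using assms by (subst sum_ennreal) (auto intro: nrm_nonneg vmeas_memD)
  also have "\<dots> \<le> variation E \<mu> UNIV"
    using assms by (intro sum_le_variation) (auto simp: vmeas_empty)
  finally show ?thesis
    using variation_eq_nrm[OF assms(1)] nrm_vmeas_nonneg[of \<mu>] by (simp add: ennreal_le_iff)
qed

lemma nrm_vmeas_apply_le:
  assumes "\<mu> \<in> carr (vmeas E)" "A \<in> sets borel"
  shows "nrm E (\<mu> A) \<le> nrm (vmeas E) \<mu>"
  using sum_nrm_le[OF assms(1), of "{()}" "\<lambda>_. A"] assms(2) by (simp add: disjoint_family_on_def)

text \<open>An enumeration of \<open>I\<close> padded with empty sets reduces this to countable
  additivity. The error there is constant from \<open>card I\<close> on, so its limit 0 makes it
  exactly 0.\<close>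

lemma vmeas_finite_additive:
  assumes \<mu>: "\<mu> \<in> carr (vmeas E)" and I: "finite I" "\<And>i. i \<in> I \<Longrightarrow> A i \<in> sets borel" "disjoint_family_on A I"
  shows "\<mu> (\<Union>i\<in>I. A i) = (\<Sum>i\<in>I. \<mu> (A i))"
proof -
  obtain e where e: "bij_betw e {..<card I} I"
    using ex_bij_betw_nat_finite[OF I(1)] by (auto simp: atLeast0LessThan)
  define A' where "A' n = (if n < card I then A (e n) else {})" for n
  have eI: "e n \<in> I" if "n < card I" for n using e that by (auto simp: bij_betw_def)
  have "range A' \<subseteq> sets borel" using I(2) eI by (auto simp: A'_def)
  moreover have "disjoint_family A'"
  proof -
    have "e m \<noteq> e n" if "m < card I" "n < card I" "m \<noteq> n" for m n
      using e that by (auto simp: bij_betw_def inj_on_def)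
    then show ?thesis using I(3) eI by (auto simp: disjoint_family_on_def A'_def)
  qed
  ultimately have lim: "(\<lambda>n. nrm E (\<mu> (\<Union>i. A' i) - (\<Sum>i<n. \<mu> (A' i)))) \<longlonglongrightarrow> 0"
    by (rule countably_additive_inD[OF vmeas_memD(3)[OF \<mu>]])
  have "(\<Union>i. A' i) = (\<Union>n<card I. A (e n))" by (auto simp: A'_def split: if_splits)
  also have "\<dots> = \<Union>(A ` e ` {..<card I})" by (simp add: image_image)
  also have "\<dots> = (\<Union>i\<in>I. A i)" using e by (simp add: bij_betw_def)
  finally have U: "(\<Union>i. A' i) = (\<Union>i\<in>I. A i)" .
  have s: "(\<Sum>i<n. \<mu> (A' i)) = (\<Sum>i\<in>I. \<mu> (A i))" if "n \<ge> card I" for n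
  proof -
    have "(\<Sum>i<n. \<mu> (A' i)) = (\<Sum>i<card I. \<mu> (A' i))"
      using that vmeas_empty[OF \<mu>] by (intro sum.mono_neutral_right) (auto simp: A'_def)
    also have "\<dots> = (\<Sum>i<card I. \<mu> (A (e i)))" by (simp add: A'_def)
    also have "\<dots> = (\<Sum>i\<in>I. \<mu> (A i))" by (rule sum.reindex_bij_betw[OF e])
    finally show ?thesis .
  qed
  let ?d = "\<mu> (\<Union>i\<in>I. A i) - (\<Sum>i\<in>I. \<mu> (A i))"
  have "(\<lambda>n. nrm E ?d) \<longlonglongrightarrow> 0"
  proof (rule Lim_transform_eventually[OF lim])
    show "\<forall>\<^sub>F n in sequentially. nrm E (\<mu> (\<Union>i. A' i) - (\<Sum>i<n. \<mu> (A' i))) = nrm E ?d"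
      using eventually_ge_at_top[of "card I"] by eventually_elim (simp add: s U)
  qed
  then have "nrm E ?d = 0" by (simp add: LIMSEQ_const_iff)
  moreover have "?d \<in> carr E"
    using I by (intro diff_mem sum_mem vmeas_memD(1)[OF \<mu>] sets.finite_UN) auto
  ultimately show ?thesis using nrm_definite[of ?d] by simp
qed

section \<open>Vector space operations and point masses\<close>

lemma vmeas_zero: "0 \<in> carr (vmeas E)"
proof (rule vmeas_memI)
  have v: "variation E 0 A = 0" for A
    using variation_scaleR[of 0 0 A] zero_mem by simp
  show "variation E 0 UNIV < \<infinity>" by (simp add: v)
  show "regular_in E 0" unfolding regular_in_def v using compact_empty open_UNIV by simp (meson compact_empty empty_subsetI open_UNIV top_greatest)
  show "countably_additive_in E 0" by (simp add: countably_additive_in_def)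
qed (auto simp: zero_mem)

lemma vmeas_scaleR:
  fixes \<mu> :: "'w::topological_space set \<Rightarrow> 'b"
  assumes \<mu>: "\<mu> \<in> carr (vmeas E)"
  shows "c *\<^sub>R \<mu> \<in> carr (vmeas E)"
proof (rule vmeas_memI)
  have v: "variation E (c *\<^sub>R \<mu>) A = ennreal \<bar>c\<bar> * variation E \<mu> A" for A
    using variation_scaleR vmeas_memD(1)[OF \<mu>] by blast
  show "(c *\<^sub>R \<mu>) B \<in> carr E" if "B \<in> sets borel" for B
    using that vmeas_memD(1)[OF \<mu>] scaleR_mem by (simp add: scaleR_fun_def)
  show "(c *\<^sub>R \<mu>) B = 0" if "B \<notin> sets borel" for B
    using that vmeas_memD(2)[OF \<mu>] by (simp add: scaleR_fun_def)
  show "variation E (c *\<^sub>R \<mu>) UNIV < \<infinity>"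
    using vmeas_memD(4)[OF \<mu>] by (simp add: v ennreal_mult_less_top)
  show "countably_additive_in E (c *\<^sub>R \<mu>)"
    unfolding countably_additive_in_def
  proof (intro allI impI)
    fix A :: "nat \<Rightarrow> 'w set" assume A: "range A \<subseteq> sets borel" "disjoint_family A"
    then have "(\<lambda>n. nrm E (\<mu> (\<Union>i. A i) - (\<Sum>i<n. \<mu> (A i)))) \<longlonglongrightarrow> 0"
      by (rule countably_additive_inD[OF vmeas_memD(3)[OF \<mu>]])
    then have "(\<lambda>n. \<bar>c\<bar> * nrm E (\<mu> (\<Union>i. A i) - (\<Sum>i<n. \<mu> (A i)))) \<longlonglongrightarrow> 0"
      by (rule tendsto_mult_right_zero)
    moreover have "\<bar>c\<bar> * nrm E (\<mu> (\<Union>i. A i) - (\<Sum>i<n. \<mu> (A i)))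
       = nrm E ((c *\<^sub>R \<mu>) (\<Union>i. A i) - (\<Sum>i<n. (c *\<^sub>R \<mu>) (A i)))" for n
    proof -
      have "\<mu> (\<Union>i. A i) - (\<Sum>i<n. \<mu> (A i)) \<in> carr E"
        using A by (intro diff_mem sum_mem vmeas_memD(1)[OF \<mu>]) auto
      from nrm_scaleR[OF this, of c] show ?thesis
        by (simp add: scaleR_fun_def scaleR_right_diff_distrib scaleR_sum_right)
    qed
    ultimately show "(\<lambda>n. nrm E ((c *\<^sub>R \<mu>) (\<Union>i. A i) - (\<Sum>i<n. (c *\<^sub>R \<mu>) (A i)))) \<longlonglongrightarrow> 0"
      by simp
  qed
  show "regular_in E (c *\<^sub>R \<mu>)"
    unfolding regular_in_def
  proof (intro ballI allI impI)
    fix A :: "'w set" and e :: real assume A: "A \<in> sets borel" "e > 0"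
    \<comment> \<open>The denominator \<open>\<bar>c\<bar> + 1\<close> covers \<open>c = 0\<close>
      and leaves a positive factor for the strict estimate below.\<close>
    then have "e / (\<bar>c\<bar> + 1) > 0" by (simp add: field_simps add_pos_nonneg)
    then obtain K U where KU: "compact K" "open U" "K \<subseteq> A" "A \<subseteq> U"
      "variation E \<mu> (U - K) < ennreal (e / (\<bar>c\<bar> + 1))"
      by (rule regular_inE[OF vmeas_memD(5)[OF \<mu>] A(1)])
    have "variation E (c *\<^sub>R \<mu>) (U - K) \<le> ennreal (\<bar>c\<bar> + 1) * variation E \<mu> (U - K)"
      unfolding v by (intro mult_right_mono) (auto intro: ennreal_leI)
    also have "\<dots> < ennreal (\<bar>c\<bar> + 1) * ennreal (e / (\<bar>c\<bar> + 1))"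
      using KU(5) by (intro ennreal_mult_strict_left_mono)
        (auto simp: ennreal_less_zero_iff simp del: ennreal_plus)
    also have "\<dots> = ennreal e"
      using A(2) by (subst ennreal_mult[symmetric]) auto
    finally show "\<exists>K U. compact K \<and> open U \<and> K \<subseteq> A \<and> A \<subseteq> U \<and>
        variation E (c *\<^sub>R \<mu>) (U - K) < ennreal e"
      using KU by blast
  qed
qed

lemma vmeas_add:
  fixes \<mu> \<nu> :: "'w::t2_space set \<Rightarrow> 'b"
  assumes \<mu>: "\<mu> \<in> carr (vmeas E)" and \<nu>: "\<nu> \<in> carr (vmeas E)"
  shows "\<mu> + \<nu> \<in> carr (vmeas E)"
proof (rule vmeas_memI)
  note m = vmeas_memD(1)[OF \<mu>] vmeas_memD(1)[OF \<nu>]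
  have v: "variation E (\<mu> + \<nu>) A \<le> variation E \<mu> A + variation E \<nu> A" for A
    using m by (rule variation_add_le)
  show "(\<mu> + \<nu>) B \<in> carr E" if "B \<in> sets borel" for B
    using that m add_mem by simp
  show "(\<mu> + \<nu>) B = 0" if "B \<notin> sets borel" for B
    using that vmeas_memD(2)[OF \<mu>] vmeas_memD(2)[OF \<nu>] by simp
  have "variation E \<mu> UNIV + variation E \<nu> UNIV < \<infinity>"
    using vmeas_memD(4)[OF \<mu>] vmeas_memD(4)[OF \<nu>] by simp
  then show "variation E (\<mu> + \<nu>) UNIV < \<infinity>"
    by (rule le_less_trans[OF v])
  show "countably_additive_in E (\<mu> + \<nu>)"
    unfolding countably_additive_in_def
  proof (intro allI impI)
    fix A :: "nat \<Rightarrow> 'w set" assume A: "range A \<subseteq> sets borel" "disjoint_family A"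
    let ?d = "\<lambda>\<mu> n. \<mu> (\<Union>i. A i) - (\<Sum>i<n. \<mu> (A i))"
    have mem: "?d \<mu> n \<in> carr E" "?d \<nu> n \<in> carr E" for n
      using A by (auto intro!: diff_mem sum_mem m)
    have lim: "(\<lambda>n. nrm E (?d \<mu> n) + nrm E (?d \<nu> n)) \<longlonglongrightarrow> 0"
      by (intro tendsto_add_zero countably_additive_inD[OF vmeas_memD(3)[OF \<mu>]]
          countably_additive_inD[OF vmeas_memD(3)[OF \<nu>]] A)
    have eq: "?d (\<mu> + \<nu>) n = ?d \<mu> n + ?d \<nu> n" for n by (simp add: sum.distrib)
    show "(\<lambda>n. nrm E (?d (\<mu> + \<nu>) n)) \<longlonglongrightarrow> 0"
    proof (rule tendsto_sandwich[OF _ _ tendsto_const lim])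
      show "\<forall>\<^sub>F n in sequentially. 0 \<le> nrm E (?d (\<mu> + \<nu>) n)"
        unfolding eq using mem by (intro always_eventually allI nrm_nonneg add_mem)
      show "\<forall>\<^sub>F n in sequentially. nrm E (?d (\<mu> + \<nu>) n) \<le> nrm E (?d \<mu> n) + nrm E (?d \<nu> n)"
        unfolding eq using mem by (intro always_eventually allI nrm_triangle)
    qed
  qed
  show "regular_in E (\<mu> + \<nu>)"
    unfolding regular_in_def
  proof (intro ballI allI impI)
    fix A :: "'w set" and e :: real assume A: "A \<in> sets borel" and "e > 0"
    then have e: "e / 2 > 0" by simp
    obtain K U where KU: "compact K" "open U" "K \<subseteq> A" "A \<subseteq> U" "variation E \<mu> (U - K) < ennreal (e/2)"
      by (rule regular_inE[OF vmeas_memD(5)[OF \<mu>] A e])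
    obtain K' U' where KU': "compact K'" "open U'" "K' \<subseteq> A" "A \<subseteq> U'" "variation E \<nu> (U' - K') < ennreal (e/2)"
      by (rule regular_inE[OF vmeas_memD(5)[OF \<nu>] A e])
    \<comment> \<open>This set lies in both \<open>U - K\<close> and \<open>U' - K'\<close>; it is
      Borel because compact sets are closed in a Hausdorff space.\<close>
    let ?S = "(U \<inter> U') - (K \<union> K')"
    have b: "?S \<in> sets borel" "U - K \<in> sets borel" "U' - K' \<in> sets borel"
      by (intro open_Diff_compact_borel compact_Un open_Int KU KU')+
    have "variation E (\<mu> + \<nu>) ?S \<le> variation E \<mu> ?S + variation E \<nu> ?S" by (rule v)
    also have "\<dots> \<le> variation E \<mu> (U - K) + variation E \<nu> (U' - K')"
      using b vmeas_empty[OF \<mu>] vmeas_empty[OF \<nu>] by (intro add_mono variation_mono) auto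
    also have "\<dots> < ennreal (e/2) + ennreal (e/2)"
      using KU(5) KU'(5) by (rule add_strict_mono)
    also have "\<dots> = ennreal e" using e by (subst ennreal_plus[symmetric]) auto
    finally show "\<exists>K U. compact K \<and> open U \<and> K \<subseteq> A \<and> A \<subseteq> U \<and> variation E (\<mu> + \<nu>) (U - K) < ennreal e"
      using KU KU' by (intro exI[of _ "K \<union> K'"] exI[of _ "U \<inter> U'"]) (auto intro: compact_Un)
  qed
qed

lemma nrm_vmeas_triangle:
  assumes \<mu>: "\<mu> \<in> carr (vmeas E)" and \<nu>: "\<nu> \<in> carr (vmeas E)"
  shows "nrm (vmeas E) (\<mu> + \<nu>) \<le> nrm (vmeas E) \<mu> + nrm (vmeas E) \<nu>"
proof (rule nrm_vmeas_leI)
  have "variation E (\<mu> + \<nu>) UNIV \<le> variation E \<mu> UNIV + variation E \<nu> UNIV"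
    using vmeas_memD(1)[OF \<mu>] vmeas_memD(1)[OF \<nu>] by (rule variation_add_le)
  then show "variation E (\<mu> + \<nu>) UNIV \<le> ennreal (nrm (vmeas E) \<mu> + nrm (vmeas E) \<nu>)"
    by (simp add: variation_eq_nrm[OF \<mu>] variation_eq_nrm[OF \<nu>] nrm_vmeas_nonneg flip: ennreal_plus)
qed (simp add: nrm_vmeas_nonneg)

lemma nrm_vmeas_scaleR:
  assumes \<mu>: "\<mu> \<in> carr (vmeas E)"
  shows "nrm (vmeas E) (c *\<^sub>R \<mu>) = \<bar>c\<bar> * nrm (vmeas E) \<mu>"
  using variation_scaleR[of \<mu> c UNIV] vmeas_memD(1)[OF \<mu>]
  by (simp add: vmeas_def enn2real_mult)

text \<open>Definiteness rests on the convention that set functions are 0 off the Borel sets: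
  variation 0 controls the Borel sets only.\<close>

lemma normed_nspace_vmeas: "normed_nspace (vmeas E :: ('w::t2_space set \<Rightarrow> 'b) nspace)"
proof
  show "x = 0" if x: "x \<in> carr (vmeas E)" "nrm (vmeas E) x = 0" for x :: "'w set \<Rightarrow> 'b"
  proof
    fix A show "x A = 0 A"
    proof (cases "A \<in> sets borel")
      case True
      then have "x A \<in> carr E" "nrm E (x A) \<le> 0"
        using nrm_vmeas_apply_le[OF x(1)] vmeas_memD(1)[OF x(1)] x(2) by auto
      then show ?thesis using nrm_definite nrm_nonneg by fastforce
    qed (simp add: vmeas_memD(2)[OF x(1)])
  qed
qed (auto intro: vmeas_zero vmeas_add vmeas_scaleR nrm_vmeas_triangle nrm_vmeas_scaleR)

text \<open>At most one cell of a partition contains \<open>w\<close>, so the variation over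
  \<open>A\<close> is at most \<open>nrm E e\<close>, and it is 0 if \<open>w\<close> is not in
  \<open>A\<close>.\<close>

lemma point_mass_vmeas:
  fixes w :: "'w::t2_space"
  assumes e: "e \<in> carr E"
  shows "point_mass w e \<in> carr (vmeas E)" "nrm (vmeas E) (point_mass w e) \<le> nrm E e"
proof -
  have var: "variation E (point_mass w e) A \<le> ennreal (if w \<in> A then nrm E e else 0)"
    if "A \<in> sets borel" for A
  proof (rule variation_leI)
    fix P :: "'w set set" assume P: "finite P" "P \<subseteq> sets borel" "disjoint P" "\<Union>P = A"
    show "(\<Sum>B\<in>P. nrm E (point_mass w e B)) \<le> (if w \<in> A then nrm E e else 0)"
    proof (cases "w \<in> A")
      case True
      then obtain B where B: "B \<in> P" "w \<in> B" using P by auto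
      have "w \<notin> C" if "C \<in> P - {B}" for C
        using that B P(3) by (auto simp: pairwise_def disjnt_def)
      then have "(\<Sum>C\<in>P - {B}. nrm E (point_mass w e C)) = 0"
        by (intro sum.neutral) (simp add: point_mass_def)
      then show ?thesis using B P True by (subst sum.remove[OF P(1) B(1)]) (auto simp: point_mass_def)
    next
      case False
      then have "w \<notin> B" if "B \<in> P" for B using that P by auto
      then have "(\<Sum>B\<in>P. nrm E (point_mass w e B)) = 0"
        by (intro sum.neutral) (simp add: point_mass_def)
      then show ?thesis using False by simp
    qed
  qed (simp add: point_mass_def e zero_mem)
  show "nrm (vmeas E) (point_mass w e) \<le> nrm E e"
    using var[of UNIV] by (intro nrm_vmeas_leI) (auto simp: nrm_nonneg e)
  show "point_mass w e \<in> carr (vmeas E)"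
  proof (rule vmeas_memI)
    show "variation E (point_mass w e) UNIV < \<infinity>"
      using var[of UNIV] by (auto simp: less_top[symmetric] top_unique)
    show "countably_additive_in E (point_mass w e)"
      unfolding countably_additive_in_def
    proof (intro allI impI)
      fix A :: "nat \<Rightarrow> 'w set" assume A: "range A \<subseteq> sets borel" "disjoint_family A"
      let ?d = "\<lambda>n. point_mass w e (\<Union>i. A i) - (\<Sum>i<n. point_mass w e (A i))"
      have U: "(\<Union>i. A i) \<in> sets borel" "A i \<in> sets borel" for i using A by auto
      have "\<exists>m. \<forall>n\<ge>m. ?d n = 0"
      proof (cases "w \<in> (\<Union>i. A i)")
        case True
        then obtain j where j: "w \<in> A j" by blast
        have "w \<in> A i \<longleftrightarrow> i = j" for i using j A(2) by (auto simp: disjoint_family_on_def)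
        then have "(\<Sum>i<n. point_mass w e (A i)) = (\<Sum>i<n. if i = j then e else 0)" for n
          using U by (intro sum.cong) (auto simp: point_mass_def)
        then have "?d n = 0" if "n \<ge> Suc j" for n
          using that True U by (simp add: point_mass_def)
        then show ?thesis by blast
      qed (auto simp: point_mass_def)
      then obtain m where "\<And>n. n \<ge> m \<Longrightarrow> nrm E (?d n) = 0" using nrm_zero by metis
      then show "(\<lambda>n. nrm E (?d n)) \<longlonglongrightarrow> 0"
        by (intro tendsto_eventually) (auto simp: eventually_sequentially)
    qed
    show "regular_in E (point_mass w e)"
      unfolding regular_in_def
    proof (intro ballI allI impI)
      fix A :: "'w set" and r :: real assume A: "A \<in> sets borel" and "r > 0"
      \<comment> \<open>In both cases \<open>w\<close> lies outside \<open>U - K\<close>, so the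
        variation there is 0; singletons are compact and closed.\<close>
      define K U where "K = (if w \<in> A then {w} else {})" "U = (if w \<in> A then UNIV else - {w})"
      have KU: "compact K" "open U" "K \<subseteq> A" "A \<subseteq> U" "w \<notin> U - K" by (auto simp: K_U_def)
      have "U - K \<in> sets borel" by (intro open_Diff_compact_borel KU)
      from var[OF this] have "variation E (point_mass w e) (U - K) \<le> 0"
        unfolding if_not_P[OF KU(5)] by simp
      then have "variation E (point_mass w e) (U - K) < ennreal r"
        using \<open>r > 0\<close> by simp
      then show "\<exists>K U. compact K \<and> open U \<and> K \<subseteq> A \<and> A \<subseteq> U \<and> variation E (point_mass w e) (U - K) < ennreal r"
        using KU by blast
    qed
  qed (auto simp: point_mass_def e zero_mem)
qed

end

section \<open>Completeness of the space of measures\<close>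

context complete_nspace
begin

text \<open>Limits are taken set by set; the point is to bound the variation of
  \<open>X n - l\<close> and not merely its values. Countable additivity and regularity then pass
  from a close \<open>X k\<close> to \<open>l\<close> by splitting the error into halves.\<close>

lemma complete_nspace_vmeas: "complete_nspace (vmeas E :: ('w::t2_space set \<Rightarrow> 'b) nspace)"
proof -
  let ?M = "vmeas E :: ('w set \<Rightarrow> 'b) nspace"
  interpret M: normed_nspace ?M by (rule normed_nspace_vmeas)
  show ?thesis
  proof
  fix X assume X: "\<And>n. X n \<in> carr ?M" and fast: "\<And>n. nrm ?M (X (Suc n) - X n) \<le> (1/2) ^ n"
  note dmem = M.diff_mem
  have dist: "nrm ?M (X n - X m) \<le> 2 * (1/2) ^ n" if "n \<le> m" for n m
    by (rule M.fast_Cauchy_dist'[OF X fast that])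
  have "\<exists>l\<in>carr E. \<forall>n. nrm E (X n A - l) \<le> 2 * (1/2) ^ n" if A: "A \<in> sets borel" for A
  proof -
    have "nrm E (X (Suc n) A - X n A) \<le> (1/2) ^ n" for n
      using nrm_vmeas_apply_le[OF dmem[OF X X] A, of "Suc n" n] fast[of n] by simp
    then show ?thesis using fast_Cauchy_rate[of "\<lambda>n. X n A"] vmeas_memD(1)[OF X A] by metis
  qed
  then obtain l0 where l0: "\<And>A. A \<in> sets borel \<Longrightarrow> l0 A \<in> carr E"
    "\<And>A n. A \<in> sets borel \<Longrightarrow> nrm E (X n A - l0 A) \<le> 2 * (1/2) ^ n" by metis
  define l where "l A = (if A \<in> sets borel then l0 A else 0)" for A
  have lmem: "l A \<in> carr E" if "A \<in> sets borel" for A using that l0 by (simp add: l_def)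
  have lim: "nrm E (X n A - l A) \<le> 2 * (1/2) ^ n" if "A \<in> sets borel" for A n
    using that l0 by (simp add: l_def)
  have Xmem: "X n A \<in> carr E" if "A \<in> sets borel" for A n using vmeas_memD(1)[OF X that] .
  \<comment> \<open>Comparing with \<open>X m\<close> costs \<open>card I\<close> setwise errors,
    but these vanish as \<open>m\<close> grows, while \<open>X n - X m\<close> is controlled in
    total variation. The resulting bound no longer sees the number of cells.\<close>
  have tot: "(\<Sum>i\<in>I. nrm E (X n (A i) - l (A i))) \<le> 2 * (1/2) ^ n"
    if I: "finite I" "\<And>i. i \<in> I \<Longrightarrow> A i \<in> sets borel" "disjoint_family_on A I" for I :: "'i set" and A n
  proof (rule tendsto_le[OF sequentially_bot])
    show "(\<lambda>m. 2 * (1/2) ^ n + real (card I) * (2 * (1/2) ^ m)) \<longlonglongrightarrow> 2 * (1/2) ^ n"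
      by (auto intro!: tendsto_eq_intros LIMSEQ_realpow_zero)
    show "(\<lambda>m. \<Sum>i\<in>I. nrm E (X n (A i) - l (A i))) \<longlonglongrightarrow> (\<Sum>i\<in>I. nrm E (X n (A i) - l (A i)))"
      by simp
    have "(\<Sum>i\<in>I. nrm E (X n (A i) - l (A i))) \<le> 2 * (1/2) ^ n + real (card I) * (2 * (1/2) ^ m)"
      if "n \<le> m" for m
    proof -
      have "(\<Sum>i\<in>I. nrm E (X n (A i) - l (A i))) \<le> (\<Sum>i\<in>I. nrm E ((X n - X m) (A i)) + 2 * (1/2) ^ m)"
      proof (rule sum_mono)
        fix i assume "i \<in> I"
        then have b: "A i \<in> sets borel" using I by simp
        show "nrm E (X n (A i) - l (A i)) \<le> nrm E ((X n - X m) (A i)) + 2 * (1/2) ^ m"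
          using nrm_diff_triangle[OF Xmem[OF b] Xmem[OF b] lmem[OF b], of n m] lim[OF b, of m] by simp
      qed
      also have "\<dots> = (\<Sum>i\<in>I. nrm E ((X n - X m) (A i))) + real (card I) * (2 * (1/2) ^ m)"
        by (simp add: sum.distrib)
      also have "\<dots> \<le> 2 * (1/2) ^ n + real (card I) * (2 * (1/2) ^ m)"
        using sum_nrm_le[OF dmem[OF X X, of n m] I] dist[OF that] by simp
      finally show ?thesis .
    qed
    then show "\<forall>\<^sub>F m in sequentially. (\<Sum>i\<in>I. nrm E (X n (A i) - l (A i)))
        \<le> 2 * (1/2) ^ n + real (card I) * (2 * (1/2) ^ m)"
      unfolding eventually_sequentially by blast
  qed
  have var: "variation E (X n - l) A \<le> ennreal (2 * (1/2) ^ n)" if "A \<in> sets borel" for A n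
  proof (rule variation_leI)
    show "(X n - l) B \<in> carr E" if "B \<in> sets borel" for B
      using that by (auto intro!: diff_mem Xmem lmem)
    fix P :: "'w set set" assume "finite P" "P \<subseteq> sets borel" "disjoint P"
    then show "(\<Sum>B\<in>P. nrm E ((X n - l) B)) \<le> 2 * (1/2) ^ n"
      using tot[of P "\<lambda>B. B" n] by (auto simp: disjoint_family_on_def pairwise_def disjnt_def)
  qed
  have split: "variation E l A \<le> variation E (X n) A + variation E (X n - l) A" if "A \<in> sets borel" for A n
  proof -
    have "l = X n + (-1) *\<^sub>R (X n - l)" by simp
    moreover have "variation E (X n + (-1) *\<^sub>R (X n - l)) A
        \<le> variation E (X n) A + variation E ((-1) *\<^sub>R (X n - l)) A"
      by (rule variation_add_le) (auto intro!: minus_mem diff_mem Xmem lmem)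
    moreover have "variation E ((-1) *\<^sub>R (X n - l)) A = variation E (X n - l) A"
      by (subst variation_scaleR) (auto intro!: diff_mem Xmem lmem)
    ultimately show ?thesis by simp
  qed
  have "l \<in> carr ?M"
  proof (rule vmeas_memI)
    show "l B \<in> carr E" if "B \<in> sets borel" for B using lmem that .
    show "l B = 0" if "B \<notin> sets borel" for B using that by (simp add: l_def)
    have "variation E (X 0) UNIV + variation E (X 0 - l) UNIV < \<infinity>"
      using vmeas_memD(4)[OF X, of 0] var[of UNIV 0] by (auto simp: less_top[symmetric] top_unique)
    then show "variation E l UNIV < \<infinity>"
      by (rule le_less_trans[OF split[of UNIV 0], rotated]) simp
    show "countably_additive_in E l"
      unfolding countably_additive_in_def
    proof (intro allI impI)
      fix A :: "nat \<Rightarrow> 'w set" assume A: "range A \<subseteq> sets borel" "disjoint_family A"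
      then have Ab: "A i \<in> sets borel" "(\<Union>i. A i) \<in> sets borel" for i by auto
      let ?d = "\<lambda>\<mu> n. \<mu> (\<Union>i. A i) - (\<Sum>i<n. \<mu> (A i))"
      show "(\<lambda>n. nrm E (?d l n)) \<longlonglongrightarrow> 0"
      proof (rule LIMSEQ_I)
        fix e :: real assume "e > 0"
        \<comment> \<open>The factor 4 collects \<open>2 * (1/2) ^ k\<close> for the union and the
          same amount for all the pieces together, the latter by \<open>tot\<close>.\<close>
        have "(\<lambda>k. 4 * (1/2) ^ k :: real) \<longlonglongrightarrow> 0"
          by (auto intro!: tendsto_eq_intros LIMSEQ_realpow_zero)
        from order_tendstoD(2)[OF this, of "e/2"] \<open>e > 0\<close> obtain k where k: "4 * (1/2) ^ k < e/2"
          by (auto simp: eventually_sequentially)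
        have "(\<lambda>n. nrm E (?d (X k) n)) \<longlonglongrightarrow> 0"
          by (rule countably_additive_inD[OF vmeas_memD(3)[OF X] A])
        from order_tendstoD(2)[OF this, of "e/2"] \<open>e > 0\<close>
        obtain n0 where n0: "nrm E (?d (X k) n) < e/2" if "n \<ge> n0" for n
          by (auto simp: eventually_sequentially)
        have "norm (nrm E (?d l n) - 0) < e" if "n \<ge> n0" for n
        proof -
          have m: "?d (X k) n \<in> carr E" "?d l n \<in> carr E" "l (A i) - X k (A i) \<in> carr E"
            "X k (A i) - l (A i) \<in> carr E"
            "X k (\<Union>i. A i) - l (\<Union>i. A i) \<in> carr E" for i
            using Ab by (auto intro!: diff_mem sum_mem Xmem lmem)
          have eq: "?d (X k) n - ?d l n = (X k (\<Union>i. A i) - l (\<Union>i. A i)) - (\<Sum>i<n. X k (A i) - l (A i))"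
            by (simp add: sum_subtractf)
          have "nrm E (?d (X k) n - ?d l n)
              \<le> nrm E (X k (\<Union>i. A i) - l (\<Union>i. A i)) + nrm E (\<Sum>i<n. X k (A i) - l (A i))"
            unfolding eq by (intro nrm_diff_le sum_mem m)
          also have "\<dots> \<le> 2 * (1/2) ^ k + (\<Sum>i<n. nrm E (X k (A i) - l (A i)))"
            using m by (intro add_mono lim Ab nrm_sum)
          also have "\<dots> \<le> 2 * (1/2) ^ k + 2 * (1/2) ^ k"
            by (intro add_left_mono tot Ab disjoint_family_on_mono[OF subset_UNIV A(2)]) simp
          finally have "nrm E (?d l n) < e"
            using nrm_diff_triangle[OF m(2) m(1) zero_mem] n0[OF that] k
              nrm_diff_commute[OF m(2) m(1)] by simp
          then show ?thesis using nrm_nonneg[OF m(2)] by simp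
        qed
        then show "\<exists>n0. \<forall>n\<ge>n0. norm (nrm E (?d l n) - 0) < e" by blast
      qed
    qed
    show "regular_in E l"
      unfolding regular_in_def
    proof (intro ballI allI impI)
      fix A :: "'w set" and e :: real assume A: "A \<in> sets borel" and "e > 0"
      have "(\<lambda>k. 2 * (1/2) ^ k :: real) \<longlonglongrightarrow> 0"
        by (auto intro!: tendsto_eq_intros LIMSEQ_realpow_zero)
      from order_tendstoD(2)[OF this, of "e/2"] \<open>e > 0\<close> obtain k where k: "2 * (1/2) ^ k < e/2"
        by (auto simp: eventually_sequentially)
      have e: "e / 2 > 0" using \<open>e > 0\<close> by simp
      obtain K U where KU: "compact K" "open U" "K \<subseteq> A" "A \<subseteq> U" "variation E (X k) (U - K) < ennreal (e/2)"
        by (rule regular_inE[OF vmeas_memD(5)[OF X] A e])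
      have b: "U - K \<in> sets borel" by (intro open_Diff_compact_borel KU)
      have "variation E l (U - K) \<le> variation E (X k) (U - K) + variation E (X k - l) (U - K)"
        by (rule split[OF b])
      also have "\<dots> < ennreal (e/2) + ennreal (e/2)"
        using KU(5) le_less_trans[OF var[OF b, of k] ennreal_lessI[OF e k]] by (rule add_strict_mono)
      also have "\<dots> = ennreal e" using e by (subst ennreal_plus[symmetric]) auto
      finally show "\<exists>K U. compact K \<and> open U \<and> K \<subseteq> A \<and> A \<subseteq> U \<and> variation E l (U - K) < ennreal e"
        using KU(1-4) by (intro exI conjI)
    qed
  qed
  moreover have "(\<lambda>n. nrm ?M (X n - l)) \<longlonglongrightarrow> 0"
  proof (rule tendsto_sandwich[OF _ _ tendsto_const])
    show "(\<lambda>n. 2 * (1/2) ^ n :: real) \<longlonglongrightarrow> 0"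
      by (auto intro!: tendsto_eq_intros LIMSEQ_realpow_zero)
    show "\<forall>\<^sub>F n in sequentially. nrm ?M (X n - l) \<le> 2 * (1/2) ^ n"
      using nrm_vmeas_leI[OF var] by auto
  qed (simp add: nrm_vmeas_nonneg)
  ultimately show "\<exists>l\<in>carr ?M. (\<lambda>n. nrm ?M (X n - l)) \<longlonglongrightarrow> 0" by blast
  qed
qed

end

section \<open>Integration against vector measures\<close>

lemma scaleR_fun_apply [simp]: "(c *\<^sub>R f) x = c *\<^sub>R f x"
  by (simp add: scaleR_fun_def)

lemma sum_fun_apply: "(\<Sum>k\<in>S. f k) x = (\<Sum>k\<in>S. f k x)"
  by (induction S rule: infinite_finite_induct) auto

lemma simple_function_borel_iff:
  "simple_function (borel :: 'w::topological_space measure) h \<longleftrightarrow>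
     finite (range h) \<and> (\<forall>k. h -` {k} \<in> sets borel)"
proof -
  have "h -` {k} = {}" if "k \<notin> range h" for k using that by auto
  then have "(\<forall>k\<in>range h. h -` {k} \<in> sets borel) \<longleftrightarrow> (\<forall>k. h -` {k} \<in> sets borel)"
    by (metis sets.empty_sets)
  then show ?thesis by (simp add: simple_function_def)
qed

lemma simple_function_vimage_borel:
  fixes h :: "'w::topological_space \<Rightarrow> 'k"
  shows "simple_function borel h \<Longrightarrow> h -` {k} \<in> sets borel"
  unfolding simple_function_borel_iff by blast

text \<open>The map \<open>h\<close> sends each point to a representative of its cell in a common partition, so that
  the simple functions \<open>f i \<circ> h\<close> yield simultaneous Riemann sums for all \<open>f i\<close>.\<close>

lemma exists_simple_oscillation:
  fixes f :: "'i \<Rightarrow> 'w::topological_space \<Rightarrow> real"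
  assumes I: "finite I" and meas: "\<And>i. i \<in> I \<Longrightarrow> f i \<in> borel_measurable borel"
    and bdd: "\<And>i. i \<in> I \<Longrightarrow> bounded (range (f i))" and "e > 0"
  obtains h :: "'w \<Rightarrow> 'w" where "simple_function borel h" "\<And>i w. i \<in> I \<Longrightarrow> \<bar>f i w - f i (h w)\<bar> \<le> e"
proof -
  \<comment> \<open>Rounding every \<open>f i w / e\<close> down gives a code with finitely many
    values; points with equal codes have all \<open>f i\<close> within \<open>e\<close> of each
    other.\<close>
  define F where "F w = (\<lambda>i\<in>I. \<lfloor>f i w / e\<rfloor>)" for w
  \<comment> \<open>The choice depends on \<open>w\<close> only through \<open>F w\<close>, so
    \<open>h\<close> is constant on each cell and its value there belongs to the cell.\<close>
  define h where "h w = (SOME w'. F w' = F w)" for w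
  have Fh: "F (h w) = F w" for w
    unfolding h_def by (rule someI[of _ w]) simp
  have h_eq: "h w = h w' \<longleftrightarrow> F w = F w'" for w w'
    using Fh by (metis h_def)
  have "\<exists>B. \<forall>w. \<bar>f i w\<bar> \<le> B" if "i \<in> I" for i
    using bdd[OF that] by (auto simp: bounded_iff)
  then obtain B where B: "\<And>i w. i \<in> I \<Longrightarrow> \<bar>f i w\<bar> \<le> B i" by metis
  have "F w \<in> (\<Pi>\<^sub>E i\<in>I. {\<lfloor>- B i / e\<rfloor>..\<lfloor>B i / e\<rfloor>})" for w
  proof (rule PiE_I)
    fix i assume "i \<in> I"
    then have "- B i \<le> f i w" "f i w \<le> B i" using B[of i w] by auto
    then have "- B i / e \<le> f i w / e" "f i w / e \<le> B i / e"
      using \<open>e > 0\<close> by (simp_all only: divide_right_mono less_imp_le)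
    then show "F w i \<in> {\<lfloor>- B i / e\<rfloor>..\<lfloor>B i / e\<rfloor>}"
      using \<open>i \<in> I\<close> by (auto simp: F_def intro!: floor_mono)
  qed (simp add: F_def)
  then have finF: "finite (range F)"
    using I by (intro finite_subset[of "range F" "\<Pi>\<^sub>E i\<in>I. {\<lfloor>- B i / e\<rfloor>..\<lfloor>B i / e\<rfloor>}"] finite_PiE) auto
  have "range h \<subseteq> (\<lambda>k. SOME w'. F w' = k) ` range F" by (auto simp: h_def)
  then have fin: "finite (range h)" using finF finite_surj by blast
  have "h -` {k} \<in> sets borel" for k
  proof (cases "k \<in> range h")
    case True
    then obtain w0 where "k = h w0" by blast
    then have "h -` {k} = {w. F w = F w0}" using h_eq by auto
    also have "\<dots> = {w. \<forall>i\<in>I. \<lfloor>f i w / e\<rfloor> = \<lfloor>f i w0 / e\<rfloor>}"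
      by (auto simp: F_def fun_eq_iff restrict_def)
    also have "\<dots> = {w \<in> space borel. \<forall>i\<in>I. \<lfloor>f i w / e\<rfloor> = \<lfloor>f i w0 / e\<rfloor>}" by simp
    also have "\<dots> \<in> sets borel"
    proof (rule sets.sets_Collect_finite_All[OF _ I])
      fix i assume "i \<in> I"
      have "{w \<in> space borel. \<lfloor>f i w / e\<rfloor> = \<lfloor>f i w0 / e\<rfloor>}
          = {w \<in> space borel. of_int \<lfloor>f i w0 / e\<rfloor> \<le> f i w / e \<and> f i w / e < of_int \<lfloor>f i w0 / e\<rfloor> + 1}"
        by (auto simp: floor_eq_iff)
      also have "\<dots> \<in> sets borel" using meas[OF \<open>i \<in> I\<close>] by measurable
      finally show "{w \<in> space borel. \<lfloor>f i w / e\<rfloor> = \<lfloor>f i w0 / e\<rfloor>} \<in> sets borel" .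
    qed
    finally show ?thesis .
  next
    case False
    then have "h -` {k} = {}" by auto
    then show ?thesis by simp
  qed
  then have "simple_function borel h" using fin by (simp add: simple_function_borel_iff)
  moreover have "\<bar>f i w - f i (h w)\<bar> \<le> e" if "i \<in> I" for i w
  proof -
    have "F (h w) i = F w i" by (simp add: Fh)
    then have "\<lfloor>f i (h w) / e\<rfloor> = \<lfloor>f i w / e\<rfloor>" using that by (simp add: F_def)
    then have "\<bar>f i w / e - f i (h w) / e\<bar> \<le> 1" by linarith
    then have "\<bar>(f i w - f i (h w)) / e\<bar> \<le> 1" by (simp add: diff_divide_distrib)
    then show ?thesis using \<open>e > 0\<close> by (simp add: abs_divide)
  qed
  ultimately show thesis by (rule that)
qed

lemma exists_simple_oscillation_single:
  fixes f :: "'w::topological_space \<Rightarrow> real"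
  assumes "f \<in> borel_measurable borel" "bounded (range f)" "e > 0"
  shows "\<exists>h :: 'w \<Rightarrow> 'w. simple_function borel h \<and> (\<forall>w. \<bar>f w - f (h w)\<bar> \<le> e)"
proof -
  obtain h :: "'w \<Rightarrow> 'w" where "simple_function borel h"
    "\<And>i w. i \<in> {()} \<Longrightarrow> \<bar>(\<lambda>_. f) i w - (\<lambda>_. f) i (h w)\<bar> \<le> e"
    by (rule exists_simple_oscillation[of "{()}" "\<lambda>_. f" e]) (use assms in auto)
  then show ?thesis by auto
qed

lemma simple_function_comp_borel:
  fixes h :: "'w::topological_space \<Rightarrow> 'k" and g :: "'k \<Rightarrow> 'l"
  shows "simple_function borel h \<Longrightarrow> simple_function borel (\<lambda>w. g (h w))"
  using simple_function_compose[of borel h g] by (simp add: comp_def)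

section \<open>Integrals of simple functions and uniqueness of the integral\<close>

context normed_nspace
begin

text \<open>Summation runs over the fibres of \<open>h\<close> even where \<open>g\<close>
  identifies some of them. This permits a common refinement of two simple functions and one
  partition for several integrands.\<close>

lemma simple_vint_compose:
  fixes \<mu> :: "'w::topological_space set \<Rightarrow> 'b" and h :: "'w \<Rightarrow> 'k"
  assumes \<mu>: "\<mu> \<in> carr (vmeas E)" and h: "simple_function borel h"
  shows "simple_vint \<mu> (\<lambda>w. g (h w)) = (\<Sum>k\<in>range h. g k *\<^sub>R \<mu> (h -` {k}))"
proof -
  have fin: "finite (range h)" and b: "h -` {k} \<in> sets borel" for k
    using h by (auto simp: simple_function_borel_iff)
  have "\<mu> ((\<lambda>w. g (h w)) -` {y}) = (\<Sum>k | k \<in> range h \<and> g k = y. \<mu> (h -` {k}))" for y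
  proof -
    have "(\<lambda>w. g (h w)) -` {y} = (\<Union>k\<in>{k \<in> range h. g k = y}. h -` {k})" by auto
    then show ?thesis
      using fin b vmeas_finite_additive[OF \<mu>, of "{k \<in> range h. g k = y}" "\<lambda>k. h -` {k}"]
      by (auto simp: disjoint_family_on_def)
  qed
  then have "simple_vint \<mu> (\<lambda>w. g (h w))
      = (\<Sum>y\<in>g ` range h. \<Sum>k | k \<in> range h \<and> g k = y. g k *\<^sub>R \<mu> (h -` {k}))"
    unfolding simple_vint_def by (auto simp: scaleR_sum_right image_image intro!: sum.cong)
  also have "\<dots> = (\<Sum>k\<in>range h. g k *\<^sub>R \<mu> (h -` {k}))"
    by (rule sum.group) (use fin in auto)
  finally show ?thesis .
qed

lemma simple_vint_mem:
  fixes \<mu> :: "'w::topological_space set \<Rightarrow> 'b"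
  assumes \<mu>: "\<mu> \<in> carr (vmeas E)" and s: "simple_function borel s"
  shows "simple_vint \<mu> s \<in> carr E"
  unfolding simple_vint_def using s
  by (intro sum_mem scaleR_mem vmeas_memD(1)[OF \<mu>]) (simp add: simple_function_borel_iff)

lemma sum_nrm_fibres_le:
  fixes \<mu> :: "'w::topological_space set \<Rightarrow> 'b"
  assumes \<mu>: "\<mu> \<in> carr (vmeas E)" and h: "simple_function borel h"
  shows "(\<Sum>k\<in>range h. nrm E (\<mu> (h -` {k}))) \<le> nrm (vmeas E) \<mu>"
  using h by (intro sum_nrm_le[OF \<mu>]) (auto simp: simple_function_borel_iff disjoint_family_on_def)

lemma nrm_simple_vint_diff_le:
  fixes \<mu> :: "'w::topological_space set \<Rightarrow> 'b"
  assumes \<mu>: "\<mu> \<in> carr (vmeas E)" and s: "simple_function borel s" "simple_function borel t"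
    and le: "\<And>w. \<bar>s w - t w\<bar> \<le> e"
  shows "nrm E (simple_vint \<mu> s - simple_vint \<mu> t) \<le> e * nrm (vmeas E) \<mu>"
proof -
  \<comment> \<open>The pair is a common refinement: both integrals become sums over the same
    cells.\<close>
  let ?h = "\<lambda>w. (s w, t w)"
  have h: "simple_function borel ?h" using s by (rule simple_function_Pair)
  have m: "\<mu> (?h -` {k}) \<in> carr E" for k
    by (intro vmeas_memD(1)[OF \<mu>] simple_function_vimage_borel h)
  have "e \<ge> 0" using le[of undefined] by linarith
  have "simple_vint \<mu> s - simple_vint \<mu> t = (\<Sum>k\<in>range ?h. (fst k - snd k) *\<^sub>R \<mu> (?h -` {k}))"
    using simple_vint_compose[OF \<mu> h, of fst] simple_vint_compose[OF \<mu> h, of snd]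
    by (simp add: sum_subtractf scaleR_left_diff_distrib)
  also have "nrm E \<dots> \<le> (\<Sum>k\<in>range ?h. nrm E ((fst k - snd k) *\<^sub>R \<mu> (?h -` {k})))"
    by (intro nrm_sum scaleR_mem m)
  also have "\<dots> \<le> (\<Sum>k\<in>range ?h. e * nrm E (\<mu> (?h -` {k})))"
  proof (rule sum_mono)
    fix k assume "k \<in> range ?h"
    then have "\<bar>fst k - snd k\<bar> \<le> e" using le by auto
    then show "nrm E ((fst k - snd k) *\<^sub>R \<mu> (?h -` {k})) \<le> e * nrm E (\<mu> (?h -` {k}))"
      unfolding nrm_scaleR[OF m] by (rule mult_right_mono[OF _ nrm_nonneg[OF m]])
  qed
  also have "\<dots> \<le> e * nrm (vmeas E) \<mu>"
    unfolding sum_distrib_left[symmetric] using sum_nrm_fibres_le[OF \<mu> h] \<open>e \<ge> 0\<close>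
    by (rule mult_left_mono)
  finally show ?thesis .
qed

text \<open>\<open>has_vint\<close> supplies a single approximating sequence; comparison with it
  shows that every uniformly close simple function has an integral close to
  \<open>I\<close>.\<close>

lemma has_vint_approx:
  fixes \<mu> :: "'w::topological_space set \<Rightarrow> 'b"
  assumes \<mu>: "\<mu> \<in> carr (vmeas E)" and I: "has_vint E \<mu> f I"
    and s: "simple_function borel s" and le: "\<And>w. \<bar>f w - s w\<bar> \<le> e"
  shows "nrm E (simple_vint \<mu> s - I) \<le> e * nrm (vmeas E) \<mu>"
proof (rule field_le_epsilon)
  fix d :: real assume "d > 0"
  obtain t where t: "\<And>n. simple_function borel (t n)" "uniform_limit UNIV t f sequentially"
      "(\<lambda>n. nrm E (simple_vint \<mu> (t n) - I)) \<longlonglongrightarrow> 0" and mI: "I \<in> carr E"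
    using I unfolding has_vint_def by blast
  \<comment> \<open>The \<open>+ 1\<close> covers a measure of norm 0. Half of \<open>d\<close> pays
    for replacing \<open>f\<close> by \<open>t n\<close>, the other half for the distance of the
    integral of \<open>t n\<close> to \<open>I\<close>.\<close>
  define r where "r = d / (2 * (nrm (vmeas E) \<mu> + 1))"
  have "r > 0" using \<open>d > 0\<close> nrm_vmeas_nonneg[of \<mu>] by (simp add: r_def)
  have "\<forall>\<^sub>F n in sequentially. \<forall>w\<in>UNIV. dist (t n w) (f w) < r"
    by (rule uniform_limitD[OF t(2) \<open>r > 0\<close>])
  moreover have "\<forall>\<^sub>F n in sequentially. nrm E (simple_vint \<mu> (t n) - I) < d / 2"
    using order_tendstoD(2)[OF t(3), of "d/2"] \<open>d > 0\<close> by simp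
  ultimately have "\<forall>\<^sub>F n in sequentially. (\<forall>w\<in>UNIV. dist (t n w) (f w) < r)
      \<and> nrm E (simple_vint \<mu> (t n) - I) < d / 2" by (rule eventually_conj)
  then obtain n where n: "\<And>w. \<bar>t n w - f w\<bar> < r" "nrm E (simple_vint \<mu> (t n) - I) < d / 2"
    unfolding eventually_sequentially dist_real_def by blast
  have "\<bar>s w - t n w\<bar> \<le> e + r" for w using n(1)[of w] le[of w] by linarith
  from nrm_simple_vint_diff_le[OF \<mu> s t(1) this]
  have "nrm E (simple_vint \<mu> s - simple_vint \<mu> (t n)) \<le> (e + r) * nrm (vmeas E) \<mu>" .
  moreover have "r * nrm (vmeas E) \<mu> \<le> d / 2"
  proof -
    have "r * nrm (vmeas E) \<mu> \<le> r * (nrm (vmeas E) \<mu> + 1)" using \<open>r > 0\<close> by simp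
    also have "\<dots> = d / 2" using nrm_vmeas_nonneg[of \<mu>] by (simp add: r_def field_simps)
    finally show ?thesis .
  qed
  ultimately show "nrm E (simple_vint \<mu> s - I) \<le> e * nrm (vmeas E) \<mu> + d"
    using nrm_diff_triangle[OF simple_vint_mem[OF \<mu> s] simple_vint_mem[OF \<mu> t(1)] mI, of n] n(2)
    by (simp add: distrib_right)
qed

text \<open>By \<open>has_vint_approx\<close>, a sequence defining \<open>J\<close> converges to
  \<open>I\<close> as well. This gives meaning to the \<open>THE\<close> in
  \<open>vint\<close>.\<close>

lemma has_vint_unique:
  fixes \<mu> :: "'w::topological_space set \<Rightarrow> 'b"
  assumes \<mu>: "\<mu> \<in> carr (vmeas E)" and I: "has_vint E \<mu> f I" and J: "has_vint E \<mu> f J"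
  shows "I = J"
proof -
  obtain t where t: "\<And>n. simple_function borel (t n)" "uniform_limit UNIV t f sequentially"
      "(\<lambda>n. nrm E (simple_vint \<mu> (t n) - J)) \<longlonglongrightarrow> 0" and mJ: "J \<in> carr E"
    using J unfolding has_vint_def by blast
  have mI: "I \<in> carr E" using I by (simp add: has_vint_def)
  have "(\<lambda>n. nrm E (simple_vint \<mu> (t n) - I)) \<longlonglongrightarrow> 0"
  proof (rule LIMSEQ_I)
    fix d :: real assume "d > 0"
    define r where "r = d / (2 * (nrm (vmeas E) \<mu> + 1))"
    have "r > 0" using \<open>d > 0\<close> nrm_vmeas_nonneg[of \<mu>] by (simp add: r_def)
    have rd: "r * nrm (vmeas E) \<mu> < d"
    proof -
      have "r * nrm (vmeas E) \<mu> \<le> r * (nrm (vmeas E) \<mu> + 1)" using \<open>r > 0\<close> by simp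
      also have "\<dots> = d / 2" using nrm_vmeas_nonneg[of \<mu>] by (simp add: r_def field_simps)
      finally show ?thesis using \<open>d > 0\<close> by simp
    qed
    have "\<forall>\<^sub>F n in sequentially. \<forall>w\<in>UNIV. dist (t n w) (f w) < r"
      by (rule uniform_limitD[OF t(2) \<open>r > 0\<close>])
    then obtain n0 where n0: "\<And>n w. n \<ge> n0 \<Longrightarrow> \<bar>t n w - f w\<bar> < r"
      unfolding eventually_sequentially dist_real_def by blast
    have "norm (nrm E (simple_vint \<mu> (t n) - I) - 0) < d" if "n \<ge> n0" for n
    proof -
      have "\<bar>f w - t n w\<bar> \<le> r" for w using n0[OF that, of w] by linarith
      from has_vint_approx[OF \<mu> I t(1) this] rd
      have "nrm E (simple_vint \<mu> (t n) - I) < d" by linarith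
      then show ?thesis using nrm_nonneg[OF diff_mem[OF simple_vint_mem[OF \<mu> t(1)] mI]] by simp
    qed
    then show "\<exists>n0. \<forall>n\<ge>n0. norm (nrm E (simple_vint \<mu> (t n) - I) - 0) < d" by blast
  qed
  from nrm_limit_unique[where X = "\<lambda>n. simple_vint \<mu> (t n)", OF mI mJ simple_vint_mem[OF \<mu> t(1)] this t(3)]
  show ?thesis .
qed

lemma has_vint_imp_vint:
  fixes \<mu> :: "'w::topological_space set \<Rightarrow> 'b"
  assumes "\<mu> \<in> carr (vmeas E)" "has_vint E \<mu> f I"
  shows "vint E \<mu> f = I"
  unfolding vint_def using assms has_vint_unique by blast

text \<open>Identifies an integral through Riemann sums, \<open>h\<close> sending each point to the
  sample point of its cell; the constant \<open>C\<close> must be the same for all partitions.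
  Linearity in the measure and the value on point masses follow from it.\<close>

lemma vint_eqI:
  fixes \<mu> :: "'w::topological_space set \<Rightarrow> 'b"
  assumes \<mu>: "\<mu> \<in> carr (vmeas E)" and f: "f \<in> borel_measurable borel" "bounded (range f)"
    and J: "J \<in> carr E"
    and approx: "\<And>h e. simple_function borel h \<Longrightarrow> 0 < e \<Longrightarrow> (\<And>w. \<bar>f w - f (h w)\<bar> \<le> e) \<Longrightarrow>
      nrm E ((\<Sum>k\<in>range h. f k *\<^sub>R \<mu> (h -` {k})) - J) \<le> e * C"
  shows "vint E \<mu> f = J"
proof (rule has_vint_imp_vint[OF \<mu>])
  have "\<exists>h :: 'w \<Rightarrow> 'w. simple_function borel h \<and> (\<forall>w. \<bar>f w - f (h w)\<bar> \<le> (1/2) ^ n)" for n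
    by (rule exists_simple_oscillation_single[OF f]) simp
  then obtain h :: "nat \<Rightarrow> 'w \<Rightarrow> 'w" where h: "\<And>n. simple_function borel (h n)"
    "\<And>n w. \<bar>f w - f (h n w)\<bar> \<le> (1/2) ^ n" by metis
  define s where "s n w = f (h n w)" for n w
  have s: "simple_function borel (s n)" for n
    unfolding s_def by (rule simple_function_comp_borel[OF h(1)])
  have sv: "simple_vint \<mu> (s n) = (\<Sum>k\<in>range (h n). f k *\<^sub>R \<mu> (h n -` {k}))" for n
    unfolding s_def by (rule simple_vint_compose[OF \<mu> h(1)])
  have pw: "(\<lambda>n. (1/2) ^ n :: real) \<longlonglongrightarrow> 0" by (rule LIMSEQ_realpow_zero) auto
  have "uniform_limit UNIV s f sequentially"
  proof (rule uniform_limitI)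
    fix r :: real assume "r > 0"
    show "\<forall>\<^sub>F n in sequentially. \<forall>w\<in>UNIV. dist (s n w) (f w) < r"
      using order_tendstoD(2)[OF pw \<open>r > 0\<close>]
    proof eventually_elim
      case (elim n)
      have "dist (s n w) (f w) < r" for w
        using h(2)[of w n] elim by (simp add: dist_real_def s_def abs_minus_commute)
      then show ?case by blast
    qed
  qed
  moreover have "(\<lambda>n. nrm E (simple_vint \<mu> (s n) - J)) \<longlonglongrightarrow> 0"
  proof (rule tendsto_sandwich[OF _ _ tendsto_const])
    show "\<forall>\<^sub>F n in sequentially. 0 \<le> nrm E (simple_vint \<mu> (s n) - J)"
      by (intro always_eventually allI nrm_nonneg diff_mem simple_vint_mem[OF \<mu> s] J)
    show "\<forall>\<^sub>F n in sequentially. nrm E (simple_vint \<mu> (s n) - J) \<le> (1/2) ^ n * C"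
      unfolding sv by (intro always_eventually allI approx h) simp
    show "(\<lambda>n. (1/2) ^ n * C) \<longlonglongrightarrow> 0" using tendsto_mult_left_zero[OF pw] .
  qed
  ultimately show "has_vint E \<mu> f J"
    unfolding has_vint_def using J s by blast
qed

end

section \<open>Existence and linearity of the integral\<close>

context complete_nspace
begin

lemma has_vint_vint:
  fixes \<mu> :: "'w::topological_space set \<Rightarrow> 'b"
  assumes \<mu>: "\<mu> \<in> carr (vmeas E)" and f: "f \<in> borel_measurable borel" "bounded (range f)"
  shows "has_vint E \<mu> f (vint E \<mu> f)"
proof -
  \<comment> \<open>Chosen so that successive integrals, whose integrands differ by at most
    \<open>2 * r n\<close>, are within \<open>(1/2) ^ n\<close>, the rate that
    \<open>fast_Cauchy\<close> asks for.\<close>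
  define r where "r n = (1/2) ^ n / (2 * (nrm (vmeas E) \<mu> + 1))" for n
  have p: "2 * (nrm (vmeas E) \<mu> + 1) > 0" using nrm_vmeas_nonneg[of \<mu>] by simp
  have r0: "r n > 0" for n using p by (simp add: r_def)
  have "\<exists>h :: 'w \<Rightarrow> 'w. simple_function borel h \<and> (\<forall>w. \<bar>f w - f (h w)\<bar> \<le> r n)" for n
    by (rule exists_simple_oscillation_single[OF f r0])
  then obtain h :: "nat \<Rightarrow> 'w \<Rightarrow> 'w" where h: "\<And>n. simple_function borel (h n)"
    "\<And>n w. \<bar>f w - f (h n w)\<bar> \<le> r n" by metis
  define s where "s n w = f (h n w)" for n w
  have s: "simple_function borel (s n)" for n
    unfolding s_def by (rule simple_function_comp_borel[OF h(1)])
  have pw: "(\<lambda>n. (1/2) ^ n :: real) \<longlonglongrightarrow> 0" by (rule LIMSEQ_realpow_zero) auto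
  have rlim: "r \<longlonglongrightarrow> 0"
    unfolding r_def using tendsto_divide_zero[OF pw] by simp
  have "nrm E (simple_vint \<mu> (s (Suc n)) - simple_vint \<mu> (s n)) \<le> (1/2) ^ n" for n
  proof -
    have "r (Suc n) \<le> r n" unfolding r_def by (rule divide_right_mono) (use p in auto)
    then have "\<bar>s (Suc n) w - s n w\<bar> \<le> 2 * r n" for w
      using h(2)[of w n] h(2)[of w "Suc n"] by (simp add: s_def)
    from nrm_simple_vint_diff_le[OF \<mu> s s this]
    have "nrm E (simple_vint \<mu> (s (Suc n)) - simple_vint \<mu> (s n)) \<le> 2 * r n * nrm (vmeas E) \<mu>" .
    also have "\<dots> \<le> 2 * r n * (nrm (vmeas E) \<mu> + 1)" using r0[of n] by simp
    also have "\<dots> = r n * (2 * (nrm (vmeas E) \<mu> + 1))" by (simp add: algebra_simps)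
    also have "\<dots> = (1/2) ^ n" unfolding r_def using p by (metis less_irrefl nonzero_eq_divide_eq)
    finally show ?thesis .
  qed
  then obtain I where I: "I \<in> carr E" "(\<lambda>n. nrm E (simple_vint \<mu> (s n) - I)) \<longlonglongrightarrow> 0"
    using fast_Cauchy[of "\<lambda>n. simple_vint \<mu> (s n)"] simple_vint_mem[OF \<mu> s] by blast
  have "uniform_limit UNIV s f sequentially"
  proof (rule uniform_limitI)
    fix d :: real assume "d > 0"
    show "\<forall>\<^sub>F n in sequentially. \<forall>w\<in>UNIV. dist (s n w) (f w) < d"
      using order_tendstoD(2)[OF rlim \<open>d > 0\<close>]
    proof eventually_elim
      case (elim n)
      have "dist (s n w) (f w) < d" for w
        using h(2)[of w n] elim by (simp add: dist_real_def s_def abs_minus_commute)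
      then show ?case by blast
    qed
  qed
  then have "has_vint E \<mu> f I" unfolding has_vint_def using I s by blast
  then show ?thesis using has_vint_imp_vint[OF \<mu>] by metis
qed

lemma vint_mem:
  fixes \<mu> :: "'w::topological_space set \<Rightarrow> 'b"
  assumes "\<mu> \<in> carr (vmeas E)" "f \<in> borel_measurable borel" "bounded (range f)"
  shows "vint E \<mu> f \<in> carr E"
  using has_vint_vint[OF assms] by (simp add: has_vint_def)

lemma vint_approx:
  fixes \<mu> :: "'w::topological_space set \<Rightarrow> 'b"
  assumes \<mu>: "\<mu> \<in> carr (vmeas E)" and f: "f \<in> borel_measurable borel" "bounded (range f)"
    and h: "simple_function borel h" "\<And>w. \<bar>f w - f (h w)\<bar> \<le> e"
  shows "nrm E ((\<Sum>k\<in>range h. f k *\<^sub>R \<mu> (h -` {k})) - vint E \<mu> f) \<le> e * nrm (vmeas E) \<mu>"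
  using has_vint_approx[OF \<mu> has_vint_vint[OF \<mu> f] simple_function_comp_borel[OF h(1)] h(2)]
  by (simp add: simple_vint_compose[OF \<mu> h(1)])

lemma vint_add:
  fixes \<mu> \<nu> :: "'w::t2_space set \<Rightarrow> 'b"
  assumes \<mu>: "\<mu> \<in> carr (vmeas E)" and \<nu>: "\<nu> \<in> carr (vmeas E)"
    and f: "f \<in> borel_measurable borel" "bounded (range f)"
  shows "vint E (\<mu> + \<nu>) f = vint E \<mu> f + vint E \<nu> f"
proof (rule vint_eqI[OF vmeas_add[OF \<mu> \<nu>] f add_mem[OF vint_mem[OF \<mu> f] vint_mem[OF \<nu> f]]])
  fix h :: "'w \<Rightarrow> 'w" and e :: real
  assume h: "simple_function borel h" "\<And>w. \<bar>f w - f (h w)\<bar> \<le> e"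
  let ?S = "\<lambda>\<mu>. \<Sum>k\<in>range h. f k *\<^sub>R \<mu> (h -` {k})"
  have m: "?S \<mu> \<in> carr E" "?S \<nu> \<in> carr E"
    using h(1) by (auto intro!: sum_mem scaleR_mem vmeas_memD(1)[OF \<mu>] vmeas_memD(1)[OF \<nu>]
        simp: simple_function_borel_iff)
  have "?S (\<mu> + \<nu>) - (vint E \<mu> f + vint E \<nu> f) = (?S \<mu> - vint E \<mu> f) + (?S \<nu> - vint E \<nu> f)"
    by (simp add: scaleR_add_right sum.distrib)
  also have "nrm E \<dots> \<le> e * nrm (vmeas E) \<mu> + e * nrm (vmeas E) \<nu>"
    by (rule order_trans[OF nrm_triangle add_mono[OF vint_approx[OF \<mu> f h] vint_approx[OF \<nu> f h]]])
      (intro diff_mem m vint_mem \<mu> \<nu> f)+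
  finally show "nrm E (?S (\<mu> + \<nu>) - (vint E \<mu> f + vint E \<nu> f))
      \<le> e * (nrm (vmeas E) \<mu> + nrm (vmeas E) \<nu>)" by (simp add: distrib_left)
qed

lemma vint_scaleR:
  fixes \<mu> :: "'w::t2_space set \<Rightarrow> 'b"
  assumes \<mu>: "\<mu> \<in> carr (vmeas E)" and f: "f \<in> borel_measurable borel" "bounded (range f)"
  shows "vint E (c *\<^sub>R \<mu>) f = c *\<^sub>R vint E \<mu> f"
proof (rule vint_eqI[OF vmeas_scaleR[OF \<mu>] f scaleR_mem[OF vint_mem[OF \<mu> f]]])
  fix h :: "'w \<Rightarrow> 'w" and e :: real
  assume h: "simple_function borel h" "\<And>w. \<bar>f w - f (h w)\<bar> \<le> e"
  let ?S = "\<lambda>\<mu>. \<Sum>k\<in>range h. f k *\<^sub>R \<mu> (h -` {k})"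
  have m: "?S \<mu> \<in> carr E"
    using h(1) by (auto intro!: sum_mem scaleR_mem vmeas_memD(1)[OF \<mu>] simp: simple_function_borel_iff)
  have "?S (c *\<^sub>R \<mu>) - c *\<^sub>R vint E \<mu> f = c *\<^sub>R (?S \<mu> - vint E \<mu> f)"
    by (simp add: scaleR_sum_right scaleR_right_diff_distrib mult.commute)
  also have "nrm E \<dots> = \<bar>c\<bar> * nrm E (?S \<mu> - vint E \<mu> f)"
    by (intro nrm_scaleR diff_mem m vint_mem \<mu> f)
  also have "\<dots> \<le> \<bar>c\<bar> * (e * nrm (vmeas E) \<mu>)"
    by (intro mult_left_mono vint_approx[OF \<mu> f h]) simp
  finally show "nrm E (?S (c *\<^sub>R \<mu>) - c *\<^sub>R vint E \<mu> f) \<le> e * (\<bar>c\<bar> * nrm (vmeas E) \<mu>)"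
    by (simp add: mult_ac)
qed

lemma vint_point_mass:
  fixes w :: "'w::t2_space"
  assumes x: "x \<in> carr E" and f: "f \<in> borel_measurable borel" "bounded (range f)"
  shows "vint E (point_mass w x) f = f w *\<^sub>R x"
proof (rule vint_eqI[OF point_mass_vmeas(1)[OF x] f scaleR_mem[OF x]])
  fix h :: "'w \<Rightarrow> 'w" and e :: real
  assume h: "simple_function borel h" "\<And>w. \<bar>f w - f (h w)\<bar> \<le> e"
  have fin: "finite (range h)" and b: "h -` {k} \<in> sets borel" for k
    using h(1) by (auto simp: simple_function_borel_iff)
  have "(\<Sum>k\<in>range h. f k *\<^sub>R point_mass w x (h -` {k})) = (\<Sum>k\<in>range h. if k = h w then f k *\<^sub>R x else 0)"
    using b by (intro sum.cong) (auto simp: point_mass_def)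
  also have "\<dots> = f (h w) *\<^sub>R x" using fin by (simp add: sum.delta')
  finally have "(\<Sum>k\<in>range h. f k *\<^sub>R point_mass w x (h -` {k})) - f w *\<^sub>R x = (f (h w) - f w) *\<^sub>R x"
    by (simp add: scaleR_left_diff_distrib)
  then show "nrm E ((\<Sum>k\<in>range h. f k *\<^sub>R point_mass w x (h -` {k})) - f w *\<^sub>R x) \<le> e * nrm E x"
    using nrm_scaleR[OF x, of "f (h w) - f w"] h(2)[of w] nrm_nonneg[OF x]
    by (simp add: abs_minus_commute mult_right_mono)
qed

text \<open>The zero function is simple and within \<open>c\<close> of \<open>f\<close>, so the
  bound is an instance of \<open>has_vint_approx\<close>.\<close>

lemma nrm_vint_le:
  fixes \<mu> :: "'w::t2_space set \<Rightarrow> 'b"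
  assumes \<mu>: "\<mu> \<in> carr (vmeas E)" and f: "f \<in> borel_measurable borel" "\<And>w. \<bar>f w\<bar> \<le> c"
  shows "nrm E (vint E \<mu> f) \<le> c * nrm (vmeas E) \<mu>"
proof -
  have b: "bounded (range f)" using f(2) by (auto simp: bounded_iff)
  have s: "simple_function (borel :: 'w measure) (\<lambda>_. 0 :: real)" by simp
  have sv: "simple_vint \<mu> (\<lambda>_. 0) = 0" by (simp add: simple_vint_def)
  have "nrm E (simple_vint \<mu> (\<lambda>_. 0) - vint E \<mu> f) \<le> c * nrm (vmeas E) \<mu>"
    using f(2) by (intro has_vint_approx[OF \<mu> has_vint_vint[OF \<mu> f(1) b] s]) simp
  then show ?thesis using nrm_minus[OF vint_mem[OF \<mu> f(1) b]] by (simp add: sv)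
qed

end

section \<open>Multiples of a convex set and Riemann sums\<close>

text \<open>A convex set containing 0 is star-shaped about 0. Membership in the image of
  \<open>K\<close> under scaling by \<open>t\<close> stands for "gauge at most \<open>t\<close>" and
  makes sense for \<open>t = 0\<close> too.\<close>

lemma scaled_mono:
  fixes K :: "'a::real_vector set"
  assumes "convex K" "0 \<in> K" "0 \<le> s" "s \<le> t" "x \<in> (\<lambda>k. s *\<^sub>R k) ` K"
  shows "x \<in> (\<lambda>k. t *\<^sub>R k) ` K"
proof -
  obtain k where k: "k \<in> K" "x = s *\<^sub>R k" using assms(5) by blast
  show ?thesis
  proof (cases "t = 0")
    case False
    then have "(s / t) *\<^sub>R k + (1 - s / t) *\<^sub>R 0 \<in> K"
      using assms k by (intro convexD) (auto simp: field_simps)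
    moreover have "x = t *\<^sub>R ((s / t) *\<^sub>R k)" using False by (simp add: k)
    ultimately show ?thesis using k by (intro image_eqI[of _ _ "(s / t) *\<^sub>R k"]) auto
  qed (use assms k in auto)
qed

text \<open>Subadditivity of the gauge: after division by the total \<open>?C\<close> the sum is a
  convex combination of elements of \<open>K\<close>. If the total is 0, every summand is 0.\<close>

lemma scaled_sum:
  fixes K :: "'a::real_vector set"
  assumes "convex K" "0 \<in> K"
    and "\<And>i. i \<in> S \<Longrightarrow> 0 \<le> c i" "\<And>i. i \<in> S \<Longrightarrow> x i \<in> (\<lambda>k. c i *\<^sub>R k) ` K"
  shows "(\<Sum>i\<in>S. x i) \<in> (\<lambda>k. (\<Sum>i\<in>S. c i) *\<^sub>R k) ` K"
proof (cases "finite S")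
  case True
  let ?C = "\<Sum>i\<in>S. c i"
  have "\<forall>i\<in>S. \<exists>k. k \<in> K \<and> x i = c i *\<^sub>R k" using assms(4) by blast
  from bchoice[OF this] obtain k where k: "\<And>i. i \<in> S \<Longrightarrow> k i \<in> K \<and> x i = c i *\<^sub>R k i" by blast
  have x: "(\<Sum>i\<in>S. x i) = (\<Sum>i\<in>S. c i *\<^sub>R k i)" using k by (intro sum.cong) auto
  show ?thesis
  proof (cases "?C = 0")
    case C: True
    then have "c i = 0" if "i \<in> S" for i
      using that True assms(3) by (simp add: sum_nonneg_eq_0_iff)
    then have "(\<Sum>i\<in>S. x i) = ?C *\<^sub>R 0" unfolding x by simp
    then show ?thesis using assms(2) by blast
  next
    case False
    have "(\<Sum>i\<in>S. (c i / ?C) *\<^sub>R k i) \<in> K"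
      using True assms(1) False assms(3) k
      by (intro convex_sum) (auto simp: sum_divide_distrib[symmetric] sum_nonneg)
    moreover have "(\<Sum>i\<in>S. x i) = ?C *\<^sub>R (\<Sum>i\<in>S. (c i / ?C) *\<^sub>R k i)"
      unfolding x using False by (simp add: scaleR_sum_right)
    ultimately show ?thesis by blast
  qed
qed (use assms(2) in auto)

lemma tendsto_fun:
  fixes X :: "'n \<Rightarrow> 'i \<Rightarrow> 'a::topological_space"
  assumes "\<And>i. ((\<lambda>n. X n i) \<longlongrightarrow> l i) F"
  shows "(X \<longlongrightarrow> l) F"
  using assms limitin_componentwise[of "\<lambda>_. euclidean" UNIV X l F]
  by (simp add: euclidean_product_topology)

lemma compact_imp_closed_fun:
  fixes K :: "('i \<Rightarrow> 'a::metric_space) set"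
  assumes "compact K"
  shows "closed K"
proof -
  have "Hausdorff_space (product_topology (\<lambda>_::'i. euclidean :: 'a topology) UNIV)"
    by (simp add: Hausdorff_space_product_topology)
  then show ?thesis
    using assms compactin_imp_closedin[of euclidean K] by (simp add: euclidean_product_topology)
qed

text \<open>Space and functionals are abstract because the lemma is applied over \<Theta> with
  values in the Banach space and over \<Omega> with values in measures and in \<B>. By
  \<open>gen\<close>, a cell of a Riemann sum contributes an element of \<open>K\<close> scaled by
  the norm of its measure; these norms add up to at most the variation, and the scaled set is
  closed.\<close>

lemma (in complete_nspace) vint_in_scaled:
  fixes \<mu> :: "'w::t2_space set \<Rightarrow> 'b" and f :: "'i \<Rightarrow> 'w \<Rightarrow> real" and l :: "'i \<Rightarrow> 'b \<Rightarrow> real"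
  assumes \<mu>: "\<mu> \<in> carr (vmeas E)" and I: "finite I"
    and f: "\<And>i. i \<in> I \<Longrightarrow> f i \<in> borel_measurable borel" "\<And>i. i \<in> I \<Longrightarrow> bounded (range (f i))"
    and l_add: "\<And>i x y. i \<in> I \<Longrightarrow> x \<in> carr E \<Longrightarrow> y \<in> carr E \<Longrightarrow> l i (x + y) = l i x + l i y"
    and l_scaleR: "\<And>i c x. i \<in> I \<Longrightarrow> x \<in> carr E \<Longrightarrow> l i (c *\<^sub>R x) = c * l i x"
    and l_bdd: "\<And>i x. i \<in> I \<Longrightarrow> x \<in> carr E \<Longrightarrow> \<bar>l i x\<bar> \<le> C i * nrm E x"
    and K: "convex K" "0 \<in> K" "compact K"
    and gen: "\<And>w x. x \<in> carr E \<Longrightarrow>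
      (\<lambda>i. if i \<in> I then f i w * l i x else 0) \<in> (\<lambda>k. nrm E x *\<^sub>R k) ` K"
  shows "(\<lambda>i. if i \<in> I then l i (vint E \<mu> (f i)) else 0) \<in> (\<lambda>k. nrm (vmeas E) \<mu> *\<^sub>R k) ` K"
proof -
  let ?a = "nrm (vmeas E) \<mu>"
  have "\<exists>h :: 'w \<Rightarrow> 'w. simple_function borel h \<and> (\<forall>i\<in>I. \<forall>w. \<bar>f i w - f i (h w)\<bar> \<le> (1/2) ^ n)" for n
  proof -
    obtain h :: "'w \<Rightarrow> 'w" where "simple_function borel h"
      "\<And>i w. i \<in> I \<Longrightarrow> \<bar>f i w - f i (h w)\<bar> \<le> (1/2) ^ n"
      by (rule exists_simple_oscillation[OF I f, where e = "(1/2) ^ n"]) auto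
    then show ?thesis by blast
  qed
  then obtain h :: "nat \<Rightarrow> 'w \<Rightarrow> 'w" where h: "\<And>n. simple_function borel (h n)"
    "\<And>n i w. i \<in> I \<Longrightarrow> \<bar>f i w - f i (h n w)\<bar> \<le> (1/2) ^ n" by metis
  let ?m = "\<lambda>n k. \<mu> (h n -` {k})"
  have m: "?m n k \<in> carr E" for n k
    by (intro vmeas_memD(1)[OF \<mu>] simple_function_vimage_borel h)
  have l_zero: "l i 0 = 0" if "i \<in> I" for i using l_scaleR[OF that zero_mem, of 0] by simp
  have l_sum: "l i (\<Sum>k\<in>S. x k) = (\<Sum>k\<in>S. l i (x k))"
    if "i \<in> I" "\<And>k. k \<in> S \<Longrightarrow> x k \<in> carr E" for i and S :: "'w set" and x
    using that(2) by (induction S rule: infinite_finite_induct)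
      (auto simp: l_zero[OF that(1)] l_add[OF that(1)] sum_mem)
  have l_diff: "l i (x - y) = l i x - l i y" if "i \<in> I" "x \<in> carr E" "y \<in> carr E" for i x y
    using l_add[OF that(1,2) minus_mem[OF that(3)]] l_scaleR[OF that(1,3), of "-1"] by simp
  \<comment> \<open>One partition must serve all \<open>i\<close>: the cell contributions are
    vectors indexed by \<open>I\<close>, so the coordinates cannot be refined separately.\<close>
  define R where "R n = (\<Sum>k\<in>range (h n). (\<lambda>i. if i \<in> I then f i k * l i (?m n k) else 0))" for n
  have R_apply: "R n i = (if i \<in> I then \<Sum>k\<in>range (h n). f i k * l i (?m n k) else 0)" for n i
    unfolding R_def by (simp add: sum_fun_apply)
  have "R n \<in> (\<lambda>k. (\<Sum>k\<in>range (h n). nrm E (?m n k)) *\<^sub>R k) ` K" for n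
    unfolding R_def by (rule scaled_sum[OF K(1,2)]) (auto intro!: nrm_nonneg gen m)
  then have R: "R n \<in> (\<lambda>k. ?a *\<^sub>R k) ` K" for n
    by (rule scaled_mono[OF K(1,2) _ sum_nrm_fibres_le[OF \<mu> h(1)], rotated])
      (intro sum_nonneg nrm_nonneg m)
  have "(\<lambda>n. R n i) \<longlonglongrightarrow> (if i \<in> I then l i (vint E \<mu> (f i)) else 0)" for i
  proof (cases "i \<in> I")
    case True
    have vm: "vint E \<mu> (f i) \<in> carr E" by (intro vint_mem \<mu> f True)
    have sm: "(\<Sum>k\<in>range (h n). f i k *\<^sub>R ?m n k) \<in> carr E" for n
      by (intro sum_mem scaleR_mem m)
    have eq: "R n i - l i (vint E \<mu> (f i)) = l i ((\<Sum>k\<in>range (h n). f i k *\<^sub>R ?m n k) - vint E \<mu> (f i))" for n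
      using True m by (simp add: R_apply l_diff[OF True sm vm] l_sum l_scaleR scaleR_mem)
    have C0: "0 \<le> \<bar>C i\<bar>" by simp
    have "norm (R n i - l i (vint E \<mu> (f i))) \<le> (1/2) ^ n * (\<bar>C i\<bar> * ?a)" for n
    proof -
      let ?d = "(\<Sum>k\<in>range (h n). f i k *\<^sub>R ?m n k) - vint E \<mu> (f i)"
      have d: "?d \<in> carr E" by (intro diff_mem sm vm)
      have "\<bar>l i ?d\<bar> \<le> C i * nrm E ?d" by (rule l_bdd[OF True d])
      also have "\<dots> \<le> \<bar>C i\<bar> * nrm E ?d" by (intro mult_right_mono nrm_nonneg d) simp
      also have "\<dots> \<le> \<bar>C i\<bar> * ((1/2) ^ n * ?a)"
        by (intro mult_left_mono vint_approx[OF \<mu> f] True h) simp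
      finally show ?thesis by (simp only: eq real_norm_def mult_ac)
    qed
    moreover have "(\<lambda>n. (1/2) ^ n * (\<bar>C i\<bar> * ?a)) \<longlonglongrightarrow> 0"
      by (rule tendsto_mult_left_zero[OF LIMSEQ_realpow_zero]) auto
    ultimately have "(\<lambda>n. R n i - l i (vint E \<mu> (f i))) \<longlonglongrightarrow> 0"
      by (rule Lim_null_comparison[OF always_eventually[OF allI]])
    then show ?thesis using True by (simp add: LIM_zero_iff)
  qed (simp add: R_apply)
  then have lim: "R \<longlonglongrightarrow> (\<lambda>i. if i \<in> I then l i (vint E \<mu> (f i)) else 0)"
    by (rule tendsto_fun)
  have "continuous_on K (\<lambda>k. ?a *\<^sub>R k)"
  proof (rule continuous_on_coordinatewise_then_product)
    fix i
    have "continuous_on K (\<lambda>k. k i)"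
      by (rule continuous_on_subset[OF continuous_on_product_coordinates]) simp
    then show "continuous_on K (\<lambda>k. (?a *\<^sub>R k) i)" by (simp add: continuous_on_mult_left)
  qed
  then have "closed ((\<lambda>k. ?a *\<^sub>R k) ` K)"
    using K(3) by (intro compact_imp_closed_fun compact_continuous_image)
  from Lim_in_closed_set[OF this always_eventually[OF allI[OF R]] sequentially_bot lim]
  show ?thesis .
qed

section \<open>The reproducing kernel Banach space as a quotient\<close>

text \<open>The quotient of \<open>E\<close> by the kernel of \<open>Q\<close>, realized on the
  image of \<open>Q\<close> and not on cosets, so that elements of \<B> remain functions.\<close>

definition quotient_nspace :: "'b nspace \<Rightarrow> ('b \<Rightarrow> 'c) \<Rightarrow> 'c nspace" where
  "quotient_nspace E Q = \<lparr>carr = Q ` carr E, nrm = (\<lambda>u. Inf {nrm E e | e. e \<in> carr E \<and> u = Q e})\<rparr>"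

context normed_nspace
begin

lemma quotient_nrm_le:
  assumes "e \<in> carr E"
  shows "nrm (quotient_nspace E Q) (Q e) \<le> nrm E e"
  unfolding quotient_nspace_def nspace.select_convs
  by (rule cInf_lower) (use assms in \<open>auto simp: bdd_below_def intro: nrm_nonneg\<close>)

lemma quotient_nrm_less:
  assumes "u \<in> carr (quotient_nspace E Q)" "d > 0"
  obtains e where "e \<in> carr E" "u = Q e" "nrm E e < nrm (quotient_nspace E Q) u + d"
proof -
  let ?S = "{nrm E e | e. e \<in> carr E \<and> u = Q e}"
  have "?S \<noteq> {}" using assms(1) by (auto simp: quotient_nspace_def)
  moreover have "Inf ?S < Inf ?S + d" using assms(2) by simp
  ultimately obtain r where "r \<in> ?S" "r < Inf ?S + d" by (meson cInf_lessD)
  then show thesis using that by (auto simp: quotient_nspace_def)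
qed

lemma quotient_nrm_nonneg:
  assumes "u \<in> carr (quotient_nspace E Q)"
  shows "0 \<le> nrm (quotient_nspace E Q) u"
proof (rule field_le_epsilon)
  fix d :: real assume "d > 0"
  then obtain e where "e \<in> carr E" "nrm E e < nrm (quotient_nspace E Q) u + d"
    using quotient_nrm_less[OF assms] by blast
  then show "0 \<le> nrm (quotient_nspace E Q) u + d" using nrm_nonneg[of e] by linarith
qed

lemma quotient_carr: "carr (quotient_nspace E Q) = Q ` carr E"
  by (simp add: quotient_nspace_def)

text \<open>The reverse inequality comes from applying this one to \<open>inverse c\<close>, so only
  one infimum estimate has to be done.\<close>

lemma quotient_nrm_scaleR_le:
  fixes Q :: "'b \<Rightarrow> 'c::real_vector"
  assumes Q: "\<And>c x. x \<in> carr E \<Longrightarrow> Q (c *\<^sub>R x) = c *\<^sub>R Q x"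
    and u: "u \<in> carr (quotient_nspace E Q)"
  shows "nrm (quotient_nspace E Q) (c *\<^sub>R u) \<le> \<bar>c\<bar> * nrm (quotient_nspace E Q) u"
proof (rule field_le_epsilon)
  fix d :: real assume "d > 0"
  then have "d / (\<bar>c\<bar> + 1) > 0" by simp
  with u obtain e where e: "e \<in> carr E" "u = Q e"
    "nrm E e < nrm (quotient_nspace E Q) u + d / (\<bar>c\<bar> + 1)"
    by (rule quotient_nrm_less)
  have "nrm (quotient_nspace E Q) (c *\<^sub>R u) \<le> nrm E (c *\<^sub>R e)"
    using quotient_nrm_le[OF scaleR_mem[OF e(1)], of Q c] Q[OF e(1)] e(2) by simp
  also have "\<dots> = \<bar>c\<bar> * nrm E e" by (rule nrm_scaleR[OF e(1)])
  also have "\<dots> \<le> \<bar>c\<bar> * (nrm (quotient_nspace E Q) u + d / (\<bar>c\<bar> + 1))"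
    using e(3) by (intro mult_left_mono) auto
  also have "\<dots> \<le> \<bar>c\<bar> * nrm (quotient_nspace E Q) u + d"
  proof -
    have "\<bar>c\<bar> * (d / (\<bar>c\<bar> + 1)) \<le> (\<bar>c\<bar> + 1) * (d / (\<bar>c\<bar> + 1))"
      using \<open>d / (\<bar>c\<bar> + 1) > 0\<close> by (intro mult_right_mono) auto
    also have "\<dots> = d" by simp
    finally show ?thesis by (simp add: distrib_left)
  qed
  finally show "nrm (quotient_nspace E Q) (c *\<^sub>R u) \<le> \<bar>c\<bar> * nrm (quotient_nspace E Q) u + d" .
qed

end

text \<open>For a linear \<open>Q\<close> the hypothesis \<open>definite\<close> says that the
  kernel is closed. Fast Cauchy sequences are lifted: small preimages of the increments have partial
  sums that converge in \<open>E\<close>, and \<open>Q\<close> does not increase norms.\<close>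

lemma (in complete_nspace) complete_quotient_nspace:
  fixes Q :: "'b \<Rightarrow> 'c::real_vector"
  assumes Q_add: "\<And>x y. x \<in> carr E \<Longrightarrow> y \<in> carr E \<Longrightarrow> Q (x + y) = Q x + Q y"
    and Q_scaleR: "\<And>c x. x \<in> carr E \<Longrightarrow> Q (c *\<^sub>R x) = c *\<^sub>R Q x"
    and definite: "\<And>u. (\<And>d. d > 0 \<Longrightarrow> \<exists>e\<in>carr E. u = Q e \<and> nrm E e < d) \<Longrightarrow> u = 0"
  shows "complete_nspace (quotient_nspace E Q)"
proof
  let ?q = "nrm (quotient_nspace E Q)"
  let ?C = "carr (quotient_nspace E Q)"
  have Q0: "Q 0 = 0" using Q_scaleR[OF zero_mem, of 0] by simp
  have Q_diff: "Q (x - y) = Q x - Q y" if "x \<in> carr E" "y \<in> carr E" for x y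
    using Q_add[OF that(1) minus_mem[OF that(2)]] Q_scaleR[OF that(2), of "-1"] by simp
  show zero: "0 \<in> ?C" unfolding quotient_carr using Q0 zero_mem by (metis imageI)
  show sc: "c *\<^sub>R u \<in> ?C" if "u \<in> ?C" for c u
    using that Q_scaleR scaleR_mem unfolding quotient_carr by (metis (no_types, lifting) imageE imageI)
  show "u + v \<in> ?C" if "u \<in> ?C" "v \<in> ?C" for u v
  proof -
    obtain x y where "x \<in> carr E" "y \<in> carr E" "u = Q x" "v = Q y"
      using \<open>u \<in> ?C\<close> \<open>v \<in> ?C\<close> unfolding quotient_carr by blast
    then have "u + v = Q (x + y)" "x + y \<in> carr E" using Q_add add_mem by auto
    then show ?thesis unfolding quotient_carr by (rule image_eqI)
  qed
  show "?q (u + v) \<le> ?q u + ?q v" if u: "u \<in> ?C" and v: "v \<in> ?C" for u v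
  proof (rule field_le_epsilon)
    fix d :: real assume "d > 0"
    then have d: "d / 2 > 0" by simp
    obtain x where x: "x \<in> carr E" "u = Q x" "nrm E x < ?q u + d/2" by (rule quotient_nrm_less[OF u d])
    obtain y where y: "y \<in> carr E" "v = Q y" "nrm E y < ?q v + d/2" by (rule quotient_nrm_less[OF v d])
    have "?q (u + v) \<le> nrm E (x + y)"
      using quotient_nrm_le[OF add_mem[OF x(1) y(1)], of Q] Q_add[OF x(1) y(1)] x(2) y(2) by simp
    then show "?q (u + v) \<le> ?q u + ?q v + d"
      using nrm_triangle[OF x(1) y(1)] x(3) y(3) by simp
  qed
  show "?q (c *\<^sub>R u) = \<bar>c\<bar> * ?q u" if u: "u \<in> ?C" for c u
  proof (rule antisym)
    show "?q (c *\<^sub>R u) \<le> \<bar>c\<bar> * ?q u" by (rule quotient_nrm_scaleR_le[OF Q_scaleR u])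
    show "\<bar>c\<bar> * ?q u \<le> ?q (c *\<^sub>R u)"
    proof (cases "c = 0")
      case False
      have "?q (inverse c *\<^sub>R (c *\<^sub>R u)) \<le> \<bar>inverse c\<bar> * ?q (c *\<^sub>R u)"
        by (rule quotient_nrm_scaleR_le[OF Q_scaleR sc[OF u]])
      then have "?q u \<le> ?q (c *\<^sub>R u) / \<bar>c\<bar>"
        using False by (simp add: abs_inverse divide_inverse mult.commute)
      then show ?thesis using False by (simp add: field_simps)
    qed (use quotient_nrm_nonneg[OF zero] in simp)
  qed
  show "u = 0" if u: "u \<in> ?C" "?q u = 0" for u
  proof (rule definite)
    fix d :: real assume d: "d > 0"
    show "\<exists>e\<in>carr E. u = Q e \<and> nrm E e < d"
      by (rule quotient_nrm_less[OF u(1) d]) (use u(2) in auto)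
  qed
  fix X assume X: "\<And>n. X n \<in> ?C" and fast: "\<And>n. ?q (X (Suc n) - X n) \<le> (1/2) ^ n"
  \<comment> \<open>Starting at index 1 leaves room: the increment after \<open>Suc n\<close> has
    norm at most \<open>(1/2) ^ Suc n\<close>, and its preimage may exceed this by another
    \<open>(1/2) ^ Suc n\<close>.\<close>
  have "\<exists>e. e \<in> carr E \<and> X (Suc (Suc n)) - X (Suc n) = Q e \<and> nrm E e \<le> (1/2) ^ n" for n
  proof -
    obtain x y where "x \<in> carr E" "y \<in> carr E" "X (Suc (Suc n)) = Q x" "X (Suc n) = Q y"
      using X[of "Suc (Suc n)"] X[of "Suc n"] unfolding quotient_carr by blast
    then have "X (Suc (Suc n)) - X (Suc n) \<in> ?C"
      using Q_diff diff_mem unfolding quotient_carr by (metis imageI)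
    moreover have "(1/2::real) ^ Suc n > 0" by simp
    ultimately obtain e where "e \<in> carr E" "X (Suc (Suc n)) - X (Suc n) = Q e"
      "nrm E e < ?q (X (Suc (Suc n)) - X (Suc n)) + (1/2) ^ Suc n"
      by (rule quotient_nrm_less)
    moreover from this have "nrm E e \<le> (1/2) ^ n" using fast[of "Suc n"] by simp
    ultimately show ?thesis by blast
  qed
  then obtain e where e: "\<And>n. e n \<in> carr E" "\<And>n. X (Suc (Suc n)) - X (Suc n) = Q (e n)"
    "\<And>n. nrm E (e n) \<le> (1/2) ^ n" by metis
  obtain y where y: "y \<in> carr E" "X 1 = Q y" using X[of 1] unfolding quotient_carr by blast
  define S where "S n = y + (\<Sum>i<n. e i)" for n
  have S: "S n \<in> carr E" for n unfolding S_def by (intro add_mem y sum_mem e)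
  have QS: "Q (S n) = X (Suc n)" for n
  proof (induction n)
    case (Suc n)
    have "S (Suc n) = S n + e n" by (simp add: S_def add.assoc)
    then show ?case using Q_add[OF S e(1), of n n] Suc e(2)[of n, symmetric] by simp
  qed (simp add: S_def y(2)[symmetric])
  have "nrm E (S (Suc n) - S n) \<le> (1/2) ^ n" for n using e(3) by (simp add: S_def)
  then obtain l where l: "l \<in> carr E" "(\<lambda>n. nrm E (S n - l)) \<longlonglongrightarrow> 0"
    using fast_Cauchy[of S] S by blast
  have "(\<lambda>n. ?q (X (Suc n) - Q l)) \<longlonglongrightarrow> 0"
  proof (rule tendsto_sandwich[OF _ _ tendsto_const l(2)])
    have eq: "X (Suc n) - Q l = Q (S n - l)" for n using Q_diff[OF S l(1)] QS by simp
    show "\<forall>\<^sub>F n in sequentially. 0 \<le> ?q (X (Suc n) - Q l)"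
      unfolding eq by (intro always_eventually allI quotient_nrm_nonneg)
        (simp add: quotient_carr diff_mem S l)
    show "\<forall>\<^sub>F n in sequentially. ?q (X (Suc n) - Q l) \<le> nrm E (S n - l)"
      unfolding eq by (intro always_eventually allI quotient_nrm_le diff_mem S l)
  qed
  then have "(\<lambda>n. ?q (X n - Q l)) \<longlonglongrightarrow> 0" by (rule LIMSEQ_imp_Suc)
  moreover have "Q l \<in> ?C" using l(1) by (simp add: quotient_carr)
  ultimately show "\<exists>l\<in>?C. (\<lambda>n. ?q (X n - l)) \<longlonglongrightarrow> 0" by blast
qed

lemma rkbs_eq_quotient: "rkbs \<psi> = quotient_nspace (vmeas banach_nspace) (int_op banach_nspace \<psi>)"
  by (simp add: rkbs_def quotient_nspace_def Setcompr_eq_image)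

lemma complete_nspace_vmeas_banach:
  "complete_nspace (vmeas banach_nspace :: ('t::t2_space set \<Rightarrow> 'v::banach) nspace)"
  by (rule complete_nspace.complete_nspace_vmeas[OF complete_nspace_banach])

lemma norm_vint_banach_le:
  fixes \<nu> :: "'t::t2_space set \<Rightarrow> 'v::banach"
  assumes "\<nu> \<in> carr (vmeas banach_nspace)" "f \<in> borel_measurable borel" "\<And>t. \<bar>f t\<bar> \<le> c"
  shows "norm (vint banach_nspace \<nu> f) \<le> c * nrm (vmeas banach_nspace) \<nu>"
  using complete_nspace.nrm_vint_le[OF complete_nspace_banach assms] by simp

section \<open>The function space of a bounded integrand\<close>

text \<open>Integration sees only the sections in the second argument. Both kernels
  \<open>\<phi>\<close> and \<open>\<psi>\<close> are instances.\<close>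

locale bounded_integrand =
  fixes \<psi> :: "'x \<times> 't::t2_space \<Rightarrow> real"
  assumes meas: "(\<lambda>t. \<psi> (x, t)) \<in> borel_measurable borel"
    and bdd: "bounded (range (\<lambda>t. \<psi> (x, t)))"
begin

lemma int_op_add:
  assumes "complete_nspace E" "\<mu> \<in> carr (vmeas E)" "\<nu> \<in> carr (vmeas E)"
  shows "int_op E \<psi> (\<mu> + \<nu>) = int_op E \<psi> \<mu> + int_op E \<psi> \<nu>"
  using complete_nspace.vint_add[OF assms meas bdd] by (simp add: int_op_def fun_eq_iff)

lemma int_op_scaleR:
  assumes "complete_nspace E" "\<mu> \<in> carr (vmeas E)"
  shows "int_op E \<psi> (c *\<^sub>R \<mu>) = c *\<^sub>R int_op E \<psi> \<mu>"
  using complete_nspace.vint_scaleR[OF assms meas bdd] by (simp add: int_op_def fun_eq_iff)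

lemma int_op_zero:
  assumes "complete_nspace E"
  shows "int_op E \<psi> 0 = 0"
proof -
  interpret complete_nspace E by (rule assms)
  show ?thesis using int_op_scaleR[OF assms vmeas_zero, of 0] by simp
qed

lemma int_op_sum:
  assumes E: "complete_nspace E" and m: "\<And>i. i \<in> S \<Longrightarrow> \<mu> i \<in> carr (vmeas E)"
  shows "int_op E \<psi> (\<Sum>i\<in>S. \<mu> i) = (\<Sum>i\<in>S. int_op E \<psi> (\<mu> i))"
  using m
proof (induction S rule: infinite_finite_induct)
  case (insert i S)
  interpret M: complete_nspace "vmeas E :: ('t set \<Rightarrow> 'a) nspace"
    by (rule complete_nspace.complete_nspace_vmeas[OF E])
  have "int_op E \<psi> (\<mu> i + (\<Sum>i\<in>S. \<mu> i)) = int_op E \<psi> (\<mu> i) + int_op E \<psi> (\<Sum>i\<in>S. \<mu> i)"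
    using insert.prems by (intro int_op_add[OF E] M.sum_mem) auto
  moreover have "int_op E \<psi> (\<Sum>i\<in>S. \<mu> i) = (\<Sum>i\<in>S. int_op E \<psi> (\<mu> i))"
    using insert.prems by (intro insert.IH) auto
  ultimately show ?case by (simp only: sum.insert[OF insert.hyps(1,2)])
qed (simp_all add: int_op_zero[OF E])

lemma int_op_point_mass:
  assumes "complete_nspace E" "e \<in> carr E"
  shows "int_op E \<psi> (point_mass t e) x = \<psi> (x, t) *\<^sub>R e"
  using complete_nspace.vint_point_mass[OF assms meas bdd] by (simp add: int_op_def)

text \<open>The source of bounded point evaluation on \<B>: \<open>C\<close> depends on
  \<open>x\<close> alone. It gives the closed kernel below and later the bounds on the measurement
  functionals.\<close>

lemma norm_int_op_le:
  obtains C where "\<And>\<nu> :: 't set \<Rightarrow> 'v::banach. \<nu> \<in> carr (vmeas banach_nspace) \<Longrightarrow>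
    norm (int_op banach_nspace \<psi> \<nu> x) \<le> C * nrm (vmeas banach_nspace) \<nu>"
proof -
  obtain C where C: "\<And>t. \<bar>\<psi> (x, t)\<bar> \<le> C" using bdd[of x] by (auto simp: bounded_iff)
  show thesis
    unfolding int_op_def by (rule that, unfold int_op_def) (rule norm_vint_banach_le[OF _ meas C])
qed

text \<open>If \<open>u\<close> comes from measures of arbitrarily small norm, boundedness of
  evaluation at \<open>x\<close> forces \<open>u x = 0\<close>; this is closedness of the
  kernel.\<close>

lemma complete_nspace_rkbs: "complete_nspace (rkbs \<psi> :: ('x \<Rightarrow> 'v::banach) nspace)"
  unfolding rkbs_eq_quotient
proof (rule complete_nspace.complete_quotient_nspace[OF complete_nspace_vmeas_banach])
  fix u :: "'x \<Rightarrow> 'v"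
  assume small: "\<And>d. d > 0 \<Longrightarrow> \<exists>\<nu>\<in>carr (vmeas banach_nspace).
      u = int_op banach_nspace \<psi> \<nu> \<and> nrm (vmeas banach_nspace) \<nu> < d"
  show "u = 0"
  proof
    fix x
    obtain C where C: "\<And>\<nu> :: 't set \<Rightarrow> 'v. \<nu> \<in> carr (vmeas banach_nspace) \<Longrightarrow>
        norm (int_op banach_nspace \<psi> \<nu> x) \<le> C * nrm (vmeas banach_nspace) \<nu>"
      using norm_int_op_le[of x] by blast
    have "norm (u x) \<le> 0"
    proof (rule field_le_epsilon)
      fix d :: real assume d: "d > 0"
      then have "d / (\<bar>C\<bar> + 1) > 0" by simp
      from small[OF this] obtain \<nu> where \<nu>: "\<nu> \<in> carr (vmeas banach_nspace)"
        "u = int_op banach_nspace \<psi> \<nu>" "nrm (vmeas banach_nspace) \<nu> < d / (\<bar>C\<bar> + 1)" by blast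
      have n0: "0 \<le> nrm (vmeas banach_nspace) \<nu>"
        by (rule normed_nspace.nrm_vmeas_nonneg[OF complete_nspace.axioms(1)[OF complete_nspace_banach]])
      have "norm (u x) \<le> C * nrm (vmeas banach_nspace) \<nu>" using C[OF \<nu>(1)] \<nu>(2) by simp
      also have "\<dots> \<le> (\<bar>C\<bar> + 1) * nrm (vmeas banach_nspace) \<nu>" using n0 by (intro mult_right_mono) auto
      also have "\<dots> \<le> (\<bar>C\<bar> + 1) * (d / (\<bar>C\<bar> + 1))" using \<nu>(3) by (intro mult_left_mono) auto
      also have "\<dots> = d" by simp
      finally show "norm (u x) \<le> 0 + d" by simp
    qed
    then show "u x = 0 x" by simp
  qed
qed (auto intro: int_op_add[OF complete_nspace_banach] int_op_scaleR[OF complete_nspace_banach])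

lemma rkbs_carr: "carr (rkbs \<psi>) = int_op banach_nspace \<psi> ` carr (vmeas banach_nspace)"
  by (simp add: rkbs_def Setcompr_eq_image)

lemma rkbs_nrm_le:
  fixes \<nu> :: "'t set \<Rightarrow> 'v::banach"
  assumes "\<nu> \<in> carr (vmeas banach_nspace)"
  shows "nrm (rkbs \<psi>) (int_op banach_nspace \<psi> \<nu>) \<le> nrm (vmeas banach_nspace) \<nu>"
  unfolding rkbs_eq_quotient
  by (rule normed_nspace.quotient_nrm_le[OF complete_nspace.axioms(1)[OF complete_nspace_vmeas_banach] assms])

lemma rkbs_nrm_less:
  fixes u :: "'x \<Rightarrow> 'v::banach"
  assumes "u \<in> carr (rkbs \<psi>)" "d > 0"
  obtains \<nu> where "\<nu> \<in> carr (vmeas banach_nspace)" "u = int_op banach_nspace \<psi> \<nu>"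
    "nrm (vmeas banach_nspace) \<nu> < nrm (rkbs \<psi>) u + d"
  using normed_nspace.quotient_nrm_less[OF complete_nspace.axioms(1)[OF complete_nspace_vmeas_banach]] assms
  unfolding rkbs_eq_quotient by metis

end

section \<open>Conic combinations and regularized minimization in finitely many coordinates\<close>

text \<open>A linear dependency \<open>u\<close> lets the weights move to \<open>c + r * u\<close>
  without changing the combination. Weights are not tied to a fixed total, so the process stops only
  at a linearly independent set, whose size is bounded by the dimension itself.\<close>

lemma conic_caratheodory:
  fixes S :: "'a::real_vector set"
  assumes "finite S" "\<And>x. x \<in> S \<Longrightarrow> 0 \<le> c x"
  obtains S' c' where "S' \<subseteq> S" "independent S'" "\<And>x. x \<in> S' \<Longrightarrow> 0 \<le> c' x"
    "sum c' S' \<le> sum c S" "(\<Sum>x\<in>S'. c' x *\<^sub>R x) = (\<Sum>x\<in>S. c x *\<^sub>R x)"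
  using assms
proof (induction S arbitrary: c thesis rule: finite_psubset_induct)
  case (psubset S)
  show ?case
  proof (cases "independent S")
    case True
    then show ?thesis using psubset.prems by blast
  next
    case False
    then obtain u0 v1 where u0: "(\<Sum>v\<in>S. u0 v *\<^sub>R v) = 0" "v1 \<in> S" "u0 v1 \<noteq> 0"
      using dependent_finite[OF psubset.hyps] by blast
    \<comment> \<open>The sign is chosen so that moving along \<open>u\<close> cannot increase the
      total weight.\<close>
    define u where "u = (if sum u0 S \<le> 0 then u0 else (\<lambda>v. - u0 v))"
    have u: "(\<Sum>v\<in>S. u v *\<^sub>R v) = 0" "u v1 \<noteq> 0" "sum u S \<le> 0"
      using u0 by (auto simp: u_def sum_negf)
    have "\<exists>v\<in>S. u v < 0"
    proof (rule ccontr)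
      assume "\<not> ?thesis"
      then have nn: "\<And>v. v \<in> S \<Longrightarrow> 0 \<le> u v" by force
      then have "sum u S = 0" using u(3) sum_nonneg[of S u] by force
      then have "u v1 = 0" using nn u0(2) psubset.hyps by (simp add: sum_nonneg_eq_0_iff)
      then show False using u(2) by simp
    qed
    then have N: "finite {v \<in> S. u v < 0}" "{v \<in> S. u v < 0} \<noteq> {}" using psubset.hyps by auto
    \<comment> \<open>Ratio test: the largest step that keeps all weights nonnegative makes the
      weight of \<open>v0\<close> vanish.\<close>
    define v0 where "v0 = arg_min_on (\<lambda>v. c v / - u v) {v \<in> S. u v < 0}"
    have v0: "v0 \<in> S" "u v0 < 0"
      using arg_min_if_finite(1)[OF N, of "\<lambda>v. c v / - u v"] by (auto simp: v0_def)
    have min: "c v0 / - u v0 \<le> c v / - u v" if "v \<in> S" "u v < 0" for v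
      unfolding v0_def using N that by (intro arg_min_least) auto
    txt \<open>Moving along the dependency \<open>u\<close>, whose total weight is nonpositive, does not raise the cost.\<close>
    define r where "r = c v0 / - u v0"
    have r: "0 \<le> r" using v0 psubset.prems(2)[of v0] by (simp add: r_def divide_nonneg_neg)
    define c1 where "c1 v = c v + r * u v" for v
    have c1: "0 \<le> c1 v" if "v \<in> S" for v
    proof (cases "u v < 0")
      case True
      then have "0 < - u v" by simp
      then have "r * - u v \<le> c v"
        using min[OF that True] pos_le_divide_eq[of "- u v" r "c v"] by (simp only: r_def)
      then show ?thesis by (simp add: c1_def)
    qed (use r psubset.prems(2)[OF that] in \<open>simp add: c1_def\<close>)
    have c1v0: "c1 v0 = 0" using v0 by (simp add: c1_def r_def)
    have s1: "sum c1 (S - {v0}) = sum c1 S"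
      using sum.remove[OF psubset.hyps v0(1), of c1] c1v0 by simp
    have s2: "(\<Sum>v\<in>S - {v0}. c1 v *\<^sub>R v) = (\<Sum>v\<in>S. c1 v *\<^sub>R v)"
      using sum.remove[OF psubset.hyps v0(1), of "\<lambda>v. c1 v *\<^sub>R v"] c1v0 by simp
    have "sum c1 S = sum c S + r * sum u S" by (simp add: c1_def sum.distrib sum_distrib_left)
    also have "\<dots> \<le> sum c S" using r u(3) by (simp add: mult_nonneg_nonpos)
    finally have s3: "sum c1 S \<le> sum c S" .
    have "(\<Sum>v\<in>S. c1 v *\<^sub>R v) = (\<Sum>v\<in>S. c v *\<^sub>R v) + r *\<^sub>R (\<Sum>v\<in>S. u v *\<^sub>R v)"
      by (simp add: c1_def sum.distrib scaleR_left_distrib scaleR_sum_right)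
    then have s4: "(\<Sum>v\<in>S. c1 v *\<^sub>R v) = (\<Sum>v\<in>S. c v *\<^sub>R v)" using u(1) by simp
    have "S - {v0} \<subset> S" using v0(1) by blast
    then obtain S' c' where S': "S' \<subseteq> S - {v0}" "independent S'" "\<And>x. x \<in> S' \<Longrightarrow> 0 \<le> c' x"
      "sum c' S' \<le> sum c1 (S - {v0})" "(\<Sum>x\<in>S'. c' x *\<^sub>R x) = (\<Sum>v\<in>S - {v0}. c1 v *\<^sub>R v)"
      using psubset.IH[of "S - {v0}" c1] c1 by blast
    show ?thesis
      by (rule psubset.prems(1)[of S' c']) (use S' s1 s2 s3 s4 in auto)
  qed
qed

lemma supported_expansion:
  fixes u :: "'i \<Rightarrow> real"
  assumes "finite I" "\<And>i. i \<notin> I \<Longrightarrow> u i = 0"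
  shows "u = (\<Sum>i\<in>I. u i *\<^sub>R (\<lambda>j. if j = i then 1 else 0))"
proof
  fix j
  have "(\<Sum>i\<in>I. u i *\<^sub>R (\<lambda>j. if j = i then 1 else 0)) j = (\<Sum>i\<in>I. if i = j then u i else 0)"
    unfolding sum_fun_apply by (intro sum.cong) auto
  also have "\<dots> = u j" using assms by (simp add: sum.delta)
  finally show "u j = (\<Sum>i\<in>I. u i *\<^sub>R (\<lambda>j. if j = i then 1 else 0)) j" by simp
qed

text \<open>The space of all functions on \<open>'i\<close> may be infinite-dimensional, but those
  supported in \<open>I\<close> are spanned by the indicators of the points of
  \<open>I\<close>.\<close>

lemma independent_supported:
  fixes S :: "('i \<Rightarrow> real) set"
  assumes I: "finite I" and S: "independent S" "S \<subseteq> {u. \<forall>i\<in>- I. u i = 0}"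
  shows "finite S \<and> card S \<le> card I"
proof -
  let ?T = "(\<lambda>i j. if j = i then 1 else 0 :: real) ` I"
  have "u \<in> span ?T" if "u \<in> S" for u
  proof -
    have "u i = 0" if "i \<notin> I" for i using that \<open>u \<in> S\<close> S(2) by auto
    then have "u = (\<Sum>i\<in>I. u i *\<^sub>R (\<lambda>j. if j = i then 1 else 0))"
      by (rule supported_expansion[OF I])
    moreover have "x \<in> span ?T" if "x = (\<Sum>i\<in>I. u i *\<^sub>R (\<lambda>j. if j = i then 1 else 0))" for x
      unfolding that by (intro span_sum span_scale span_base imageI)
    ultimately show ?thesis by blast
  qed
  then have "finite S \<and> card S \<le> card ?T"
    using I S(1) by (intro independent_span_bound) auto
  then show ?thesis using card_image_le[OF I] le_trans by blast
qed

text \<open>Padding with weight 0 and the element \<open>0 \<in> D\<close> fixes the number of terms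
  at \<open>card I\<close>, as needed for compactness of the hull and for the final form of the
  solutions.\<close>

lemma scaled_hull_representation:
  fixes D :: "('i \<Rightarrow> real) set"
  assumes I: "finite I" and D: "D \<subseteq> {u. \<forall>i\<in>- I. u i = 0}" "0 \<in> D"
    and "0 \<le> t" and x: "x \<in> (\<lambda>k. t *\<^sub>R k) ` (convex hull D)"
  obtains c d where "\<And>m. 0 \<le> c m" "\<And>m. d m \<in> D" "(\<Sum>m<card I. c m) \<le> t"
    "x = (\<Sum>m<card I. c m *\<^sub>R d m)"
proof -
  obtain S a where S: "finite S" "S \<subseteq> D" "\<And>s. s \<in> S \<Longrightarrow> 0 \<le> a s" "sum a S = 1"
    "x = t *\<^sub>R (\<Sum>s\<in>S. a s *\<^sub>R s)"
    using x unfolding convex_hull_explicit by blast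
  have nn: "\<And>s. s \<in> S \<Longrightarrow> 0 \<le> t * a s" using S(3) \<open>0 \<le> t\<close> by simp
  obtain S' c' where S': "S' \<subseteq> S" "independent S'" "\<And>s. s \<in> S' \<Longrightarrow> 0 \<le> c' s"
    "sum c' S' \<le> (\<Sum>s\<in>S. t * a s)" "(\<Sum>s\<in>S'. c' s *\<^sub>R s) = (\<Sum>s\<in>S. (t * a s) *\<^sub>R s)"
    by (rule conic_caratheodory[where c = "\<lambda>s. t * a s", OF S(1) nn]) (assumption, rule that)
  have fin: "finite S'" "card S' \<le> card I"
    using independent_supported[OF I S'(2) order_trans[OF order_trans[OF S'(1) S(2)] D(1)]] by simp_all
  obtain e where e: "bij_betw e {..<card S'} S'"
    using ex_bij_betw_nat_finite[OF fin(1)] by (auto simp: atLeast0LessThan)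
  have eS: "e m \<in> S'" if "m < card S'" for m using e that by (auto simp: bij_betw_def)
  define c where "c m = (if m < card S' then c' (e m) else 0)" for m
  define d where "d m = (if m < card S' then e m else 0)" for m
  show thesis
  proof (rule that[of c d])
    show "0 \<le> c m" for m using S'(3)[OF eS] by (simp add: c_def)
    show "d m \<in> D" for m using D(2) eS S'(1) S(2) by (auto simp: d_def)
    have "(\<Sum>m<card I. c m) = (\<Sum>m<card S'. c m)"
      using fin by (intro sum.mono_neutral_right) (auto simp: c_def)
    also have "\<dots> = (\<Sum>m<card S'. c' (e m))" by (simp add: c_def)
    also have "\<dots> = sum c' S'" by (rule sum.reindex_bij_betw[OF e])
    also have "\<dots> \<le> t" using S'(4) S(4) by (simp add: sum_distrib_left[symmetric])
    finally show "(\<Sum>m<card I. c m) \<le> t" .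
    have "(\<Sum>m<card I. c m *\<^sub>R d m) = (\<Sum>m<card S'. c m *\<^sub>R d m)"
      using fin by (intro sum.mono_neutral_right) (auto simp: c_def)
    also have "\<dots> = (\<Sum>m<card S'. c' (e m) *\<^sub>R e m)" by (simp add: c_def d_def)
    also have "\<dots> = (\<Sum>s\<in>S'. c' s *\<^sub>R s)" by (rule sum.reindex_bij_betw[OF e])
    also have "\<dots> = x" using S'(5) S(5) by (simp add: scaleR_sum_right)
    finally show "x = (\<Sum>m<card I. c m *\<^sub>R d m)" by simp
  qed
qed

section \<open>Compactness in the product topology\<close>

lemma compact_product:
  fixes S :: "'i \<Rightarrow> 'a::topological_space set"
  assumes "\<And>i. compact (S i)"
  shows "compact {f. \<forall>i. f i \<in> S i}"
proof -
  have "compactin (product_topology (\<lambda>_. euclidean) UNIV) (\<Pi>\<^sub>E i\<in>UNIV. S i)"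
    using assms by (subst compactin_PiE) auto
  moreover have "(\<Pi>\<^sub>E i\<in>UNIV. S i) = {f. \<forall>i. f i \<in> S i}" by auto
  ultimately show ?thesis by (simp add: euclidean_product_topology)
qed

lemma continuous_on_apply:
  fixes f :: "'a::topological_space \<Rightarrow> 'i \<Rightarrow> 'b::topological_space"
  shows "continuous_on S f \<Longrightarrow> continuous_on S (\<lambda>x. f x i)"
  by (rule continuous_on_product_then_coordinatewise)

text \<open>A fixed number of terms suffices, so the hull is a continuous image of a compact set of
  weights and points. The total weight may be any number up to 1, since
  \<open>0 \<in> D\<close>.\<close>

lemma compact_convex_hull_supported:
  fixes D :: "('i \<Rightarrow> real) set"
  assumes I: "finite I" and D: "D \<subseteq> {u. \<forall>i\<in>- I. u i = 0}" "0 \<in> D" "compact D"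
  shows "compact (convex hull D)"
proof -
  let ?n = "card I"
  define P where "P = ({c :: nat \<Rightarrow> real. \<forall>m. c m \<in> {0..1}} \<inter> {c. (\<Sum>m<?n. c m) \<le> 1}) \<times> {d :: nat \<Rightarrow> 'i \<Rightarrow> real. \<forall>m. d m \<in> D}"
  define F where "F = (\<lambda>(c :: nat \<Rightarrow> real, d). \<Sum>m<?n. c m *\<^sub>R (d m :: 'i \<Rightarrow> real))"
  have "closed {c :: nat \<Rightarrow> real. (\<Sum>m<?n. c m) \<le> 1}"
    by (intro closed_Collect_le continuous_intros continuous_on_product_coordinates)
  then have "compact P"
    unfolding P_def by (intro compact_Times compact_Int_closed compact_product D(3)) auto
  moreover have "continuous_on P F"
  proof (rule continuous_on_coordinatewise_then_product)
    fix i
    have eq: "F x i = (\<Sum>m<?n. fst x m * snd x m i)" for x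
      by (simp add: F_def sum_fun_apply split_beta)
    show "continuous_on P (\<lambda>x. F x i)"
      unfolding eq by (intro continuous_on_sum continuous_on_mult
          continuous_on_apply[OF continuous_on_fst[OF continuous_on_id]]
          continuous_on_apply[OF continuous_on_apply[OF continuous_on_snd[OF continuous_on_id]]])
  qed
  moreover have "F ` P = convex hull D"
  proof (intro equalityI subsetI)
    fix x assume "x \<in> F ` P"
    then obtain c d where "(c, d) \<in> P" "x = F (c, d)" by auto
    then have c: "\<And>m. 0 \<le> c m" "(\<Sum>m<?n. c m) \<le> 1" "\<And>m. d m \<in> D"
      "x = (\<Sum>m<?n. c m *\<^sub>R d m)" by (simp_all add: P_def F_def)
    have H: "convex (convex hull D)" "0 \<in> convex hull D"
      using D(2) by (auto intro: hull_inc)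
    have "x \<in> (\<lambda>k. (\<Sum>m<?n. c m) *\<^sub>R k) ` (convex hull D)"
      unfolding c(4) by (rule scaled_sum[OF H c(1)]) (use c(3) in \<open>auto intro: hull_inc\<close>)
    then have "x \<in> (\<lambda>k. 1 *\<^sub>R k) ` (convex hull D)"
      by (rule scaled_mono[OF H sum_nonneg[OF c(1)] c(2)])
    then show "x \<in> convex hull D" by simp
  next
    fix x assume "x \<in> convex hull D"
    then have "x \<in> (\<lambda>k. 1 *\<^sub>R k) ` (convex hull D)" by simp
    with I D(1,2) zero_le_one obtain c d where c: "\<And>m. 0 \<le> c m" "\<And>m. d m \<in> D" "(\<Sum>m<?n. c m) \<le> 1"
      "x = (\<Sum>m<?n. c m *\<^sub>R d m)" by (rule scaled_hull_representation) blast
    \<comment> \<open>Weights beyond \<open>card I\<close> do not enter the sum, but membership in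
      \<open>P\<close> asks that they lie in \<open>{0..1}\<close> as well.\<close>
    define c' where "c' m = (if m < ?n then c m else 0)" for m
    have "c' m \<le> 1" for m
      using c(1,3) member_le_sum[of m "{..<?n}" c] by (force simp: c'_def)
    then have "(c', d) \<in> P" using c by (auto simp: P_def c'_def)
    moreover have "x = F (c', d)" using c(4) by (simp add: F_def c'_def)
    ultimately show "x \<in> F ` P" by blast
  qed
  ultimately show ?thesis using compact_continuous_image by metis
qed

section \<open>Lower semicontinuity\<close>

lemma lower_semicontinuous_open:
  assumes "lower_semicontinuous g"
  shows "open {x. a < g x}"
proof (subst open_subopen, intro ballI)
  fix x assume "x \<in> {x. a < g x}"
  then have "\<forall>\<^sub>F y in nhds x. a < g y" using assms by (simp add: lower_semicontinuous_def)
  then show "\<exists>T. open T \<and> x \<in> T \<and> T \<subseteq> {x. a < g x}"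
    unfolding eventually_nhds by blast
qed

text \<open>If no minimum existed, the open sets where \<open>g\<close> exceeds \<open>g y\<close>,
  for \<open>y \<in> S\<close>, would cover \<open>S\<close>; a finite subcover misses the point of
  least value among its \<open>y\<close>.\<close>

lemma lower_semicontinuous_attains_inf:
  assumes g: "lower_semicontinuous g" and S: "compact S" "S \<noteq> {}"
  shows "\<exists>x\<in>S. \<forall>y\<in>S. g x \<le> g y"
proof (rule ccontr)
  assume no: "\<not> ?thesis"
  have op: "open T" if "T \<in> (\<lambda>y. {x. g y < g x}) ` S" for T
    using that lower_semicontinuous_open[OF g] by blast
  have cov: "S \<subseteq> \<Union>((\<lambda>y. {x. g y < g x}) ` S)" using no by (force simp: not_le)
  obtain T where T: "T \<subseteq> (\<lambda>y. {x. g y < g x}) ` S" "finite T" "S \<subseteq> \<Union>T"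
    by (rule compactE[OF S(1) cov op])
  obtain Y where Y: "Y \<subseteq> S" "finite Y" "T = (\<lambda>y. {x. g y < g x}) ` Y"
    using finite_subset_image[OF T(2,1)] by blast
  have "Y \<noteq> {}" using S(2) T(3) Y(3) by auto
  then have min: "Min (g ` Y) \<in> g ` Y" using Y(2) by (intro Min_in) auto
  then obtain y where y: "y \<in> Y" "g y = Min (g ` Y)" by fastforce
  then have "y \<in> \<Union>T" using T(3) Y(1) by blast
  then obtain z where z: "z \<in> Y" "g z < g y" unfolding Y(3) by blast
  have "Min (g ` Y) \<le> g z" using z(1) Y(2) by (intro Min_le finite_imageI imageI)
  then show False using z(2) y(2) by linarith
qed

lemma lower_semicontinuous_compose:
  assumes "lower_semicontinuous g" "continuous_on UNIV q"
  shows "lower_semicontinuous (\<lambda>x. g (q x))"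
  unfolding lower_semicontinuous_def
proof (intro allI impI)
  fix x c assume "c < g (q x)"
  then have "\<forall>\<^sub>F y in nhds (q x). c < g y" using assms(1) by (simp add: lower_semicontinuous_def)
  then obtain S where S: "open S" "q x \<in> S" "\<And>y. y \<in> S \<Longrightarrow> c < g y"
    unfolding eventually_nhds by blast
  have "open (q -` S)" using assms(2) S(1) by (simp add: open_vimage)
  then show "\<forall>\<^sub>F y in nhds x. c < g (q y)"
    unfolding eventually_nhds using S(2,3) by (intro exI[of _ "q -` S"]) auto
qed

lemma lower_semicontinuous_add:
  assumes f: "lower_semicontinuous f" and g: "lower_semicontinuous g"
  shows "lower_semicontinuous (\<lambda>x. f x + g x)"
  unfolding lower_semicontinuous_def
proof (intro allI impI)
  fix x c assume c: "c < f x + g x"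
  define r where "r = (f x + g x - c) / 2"
  have "f x - r < f x" "g x - r < g x" using c by (auto simp: r_def)
  then have "\<forall>\<^sub>F y in nhds x. f x - r < f y" "\<forall>\<^sub>F y in nhds x. g x - r < g y"
    using f g unfolding lower_semicontinuous_def by blast+
  then show "\<forall>\<^sub>F y in nhds x. c < f y + g y"
    by eventually_elim (simp add: r_def field_simps)
qed

lemma lower_semicontinuous_const: "lower_semicontinuous (\<lambda>x. c)"
  by (simp add: lower_semicontinuous_def)

lemma lower_semicontinuous_sum:
  assumes "\<And>i. i \<in> S \<Longrightarrow> lower_semicontinuous (f i)"
  shows "lower_semicontinuous (\<lambda>x. \<Sum>i\<in>S. f i x)"
  using assms
  by (induction S rule: infinite_finite_induct)
    (simp_all add: lower_semicontinuous_const lower_semicontinuous_add)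

lemma lower_semicontinuous_cmult:
  assumes "lower_semicontinuous f" "c > 0"
  shows "lower_semicontinuous (\<lambda>x. c * f x)"
  unfolding lower_semicontinuous_def
proof (intro allI impI)
  fix x a assume "a < c * f x"
  then have "a / c < f x" using assms(2) by (simp add: field_simps)
  then have "\<forall>\<^sub>F y in nhds x. a / c < f y" using assms(1) by (simp add: lower_semicontinuous_def)
  then show "\<forall>\<^sub>F y in nhds x. a < c * f y" by eventually_elim (use assms(2) in \<open>simp add: field_simps\<close>)
qed

lemma lower_semicontinuous_continuous:
  fixes f :: "'a::topological_space \<Rightarrow> real"
  assumes "continuous_on UNIV f"
  shows "lower_semicontinuous f"
proof -
  have "lower_semicontinuous (\<lambda>x::real. x)"
    unfolding lower_semicontinuous_def
    by (metis eventually_nhds greaterThan_iff open_greaterThan)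
  from lower_semicontinuous_compose[OF this assms] show ?thesis .
qed

text \<open>For \<open>lam = 0\<close> the objective does not control the scaling factor of the hull; this bound
  restores compactness of the search space in that case.\<close>

lemma exists_bounded_gauge:
  fixes D :: "('i \<Rightarrow> real) set"
  assumes I: "finite I" and D: "D \<subseteq> {u. \<forall>i\<in>- I. u i = 0}" "0 \<in> D"
    and sym: "\<And>u. u \<in> D \<Longrightarrow> - u \<in> D"
  shows "\<exists>C\<ge>0. \<forall>u\<in>span D. (\<forall>i\<in>I. \<bar>u i\<bar> \<le> R) \<longrightarrow> u \<in> (\<lambda>k. C *\<^sub>R k) ` (convex hull D)"
proof -
  \<comment> \<open>The basis is taken from \<open>D\<close> itself, so that expansions in it are
    combinations of elements of \<open>D\<close> up to sign.\<close>
  obtain B where B: "B \<subseteq> D" "independent B" "D \<subseteq> span B" by (rule maximal_independent_subset)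
  have fin: "finite B" using independent_supported[OF I B(2) order_trans[OF B(1) D(1)]] by simp
  have "\<exists>g. linear g \<and> (\<forall>b'\<in>B. g b' = (if b' = b then 1 else 0 :: real))" for b
    by (rule linear_independent_extend[OF B(2)])
  then obtain g where g: "\<And>b. linear (g b)" "\<And>b b'. b' \<in> B \<Longrightarrow> g b b' = (if b' = b then 1 else 0 :: real)"
    by metis
  let ?e = "\<lambda>i j. if j = i then 1 else 0 :: real"
  \<comment> \<open>\<open>g b\<close> is the coordinate along \<open>b\<close>, extended linearly
    to all functions; expanding \<open>u\<close> in the indicators of \<open>I\<close> bounds it by
    its values on these.\<close>
  define C where "C = (\<Sum>b\<in>B. \<Sum>i\<in>I. \<bar>R\<bar> * \<bar>g b (?e i)\<bar>)"
  have H: "convex (convex hull D)" "0 \<in> convex hull D"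
    using D(2) by (auto intro: hull_inc)
  show ?thesis
  proof (intro exI[of _ C] conjI ballI impI)
    show "0 \<le> C" unfolding C_def by (intro sum_nonneg mult_nonneg_nonneg) auto
    fix u assume u: "u \<in> span D" "\<forall>i\<in>I. \<bar>u i\<bar> \<le> R"
    have uB: "u \<in> span B" using u(1) B(3) span_minimal[OF _ subspace_span] by blast
    have "u = (\<Sum>b\<in>B. g b u *\<^sub>R b)"
      using uB
    proof (induction rule: span_induct_alt)
      case base
      then show ?case
        by (intro sum.neutral[symmetric] ballI) (simp only: linear_0[OF g(1)] scaleR_zero_left)
    next
      case (step c x y)
      have "(\<Sum>b\<in>B. g b (c *\<^sub>R x + y) *\<^sub>R b) = (\<Sum>b\<in>B. (if b = x then c *\<^sub>R b else 0) + g b y *\<^sub>R b)"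
        using step(1) by (intro sum.cong)
          (auto simp: linear_add[OF g(1)] linear_scale[OF g(1)] g(2) scaleR_left_distrib)
      also have "\<dots> = c *\<^sub>R x + (\<Sum>b\<in>B. g b y *\<^sub>R b)"
        unfolding sum.distrib using step(1) fin by (simp only: sum.delta if_True)
      also have "\<dots> = c *\<^sub>R x + y" by (simp only: step(2)[symmetric])
      finally show ?case by (rule HOL.sym)
    qed
    also have "\<dots> \<in> (\<lambda>k. (\<Sum>b\<in>B. \<bar>g b u\<bar>) *\<^sub>R k) ` (convex hull D)"
    proof (rule scaled_sum[OF H])
      fix b assume "b \<in> B"
      \<comment> \<open>Symmetry of \<open>D\<close> absorbs the sign; a coordinate 0 gives the
        element 0.\<close>
      then have mem: "sgn (g b u) *\<^sub>R b \<in> convex hull D"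
        using B(1) sym by (auto simp: sgn_if D(2) intro!: hull_inc)
      have eq: "g b u *\<^sub>R b = \<bar>g b u\<bar> *\<^sub>R (sgn (g b u) *\<^sub>R b)"
        by (simp only: scaleR_scaleR abs_mult_sgn)
      show "g b u *\<^sub>R b \<in> (\<lambda>k. \<bar>g b u\<bar> *\<^sub>R k) ` (convex hull D)" by (rule image_eqI[where f = "\<lambda>k. \<bar>g b u\<bar> *\<^sub>R k", OF eq mem])
    qed simp
    finally have mem: "u \<in> (\<lambda>k. (\<Sum>b\<in>B. \<bar>g b u\<bar>) *\<^sub>R k) ` (convex hull D)" .
    have sup: "u i = 0" if "i \<notin> I" for i
      using u(1) by (induction rule: span_induct_alt) (use D(1) that in auto)
    have "\<bar>g b u\<bar> \<le> (\<Sum>i\<in>I. \<bar>R\<bar> * \<bar>g b (?e i)\<bar>)" for b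
    proof -
      have "g b u = g b (\<Sum>i\<in>I. u i *\<^sub>R ?e i)"
        by (rule arg_cong[OF supported_expansion[OF I sup]])
      also have "\<dots> = (\<Sum>i\<in>I. u i * g b (?e i))"
        by (simp add: linear_sum[OF g(1)] linear_scale[OF g(1)])
      finally have "g b u = (\<Sum>i\<in>I. u i * g b (?e i))" .
      then have "\<bar>g b u\<bar> \<le> (\<Sum>i\<in>I. \<bar>u i * g b (?e i)\<bar>)" by (simp only: sum_abs)
      also have "\<dots> \<le> (\<Sum>i\<in>I. \<bar>R\<bar> * \<bar>g b (?e i)\<bar>)"
        unfolding abs_mult using u(2) by (intro sum_mono mult_right_mono) force+
      finally show ?thesis .
    qed
    then have "(\<Sum>b\<in>B. \<bar>g b u\<bar>) \<le> C" unfolding C_def by (intro sum_mono)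
    from scaled_mono[OF H sum_nonneg this mem]
    show "u \<in> (\<lambda>k. C *\<^sub>R k) ` (convex hull D)" by simp
  qed
qed

text \<open>The variables are the factor \<open>t\<close> and the hull element \<open>k\<close> in
  place of their product: the penalty is then linear in \<open>t\<close>, and the objective is lower
  semicontinuous on a compact set once \<open>t\<close> is bounded.\<close>

lemma exists_regularized_minimizer:
  fixes D :: "('i \<Rightarrow> real) set" and J :: "('i \<Rightarrow> real) \<Rightarrow> real"
  assumes I: "finite I" and D: "D \<subseteq> {u. \<forall>i\<in>- I. u i = 0}" "0 \<in> D" "compact D"
    and sym: "\<And>u. u \<in> D \<Longrightarrow> - u \<in> D"
    and J: "lower_semicontinuous J" "\<forall>u. J u \<le> J 0 \<longrightarrow> (\<forall>i\<in>I. \<bar>u i\<bar> \<le> R)"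
    and lam: "0 \<le> lam"
  obtains t k where "0 \<le> t" "k \<in> convex hull D"
    "\<And>t' k'. 0 \<le> t' \<Longrightarrow> k' \<in> convex hull D \<Longrightarrow> J (t *\<^sub>R k) + lam * t \<le> J (t' *\<^sub>R k') + lam * t'"
proof -
  let ?H = "convex hull D"
  have H: "convex ?H" "0 \<in> ?H" using D(2) by (auto intro: hull_inc)
  have "\<exists>C\<ge>0. \<forall>u\<in>span D. (\<forall>i\<in>I. \<bar>u i\<bar> \<le> R) \<longrightarrow> u \<in> (\<lambda>k. C *\<^sub>R k) ` ?H"
    by (rule exists_bounded_gauge[OF I D(1,2) sym])
  then obtain C where C: "0 \<le> C" "\<forall>u\<in>span D. (\<forall>i\<in>I. \<bar>u i\<bar> \<le> R) \<longrightarrow> u \<in> (\<lambda>k. C *\<^sub>R k) ` ?H"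
    by (elim exE conjE)
  define G where "G = (\<lambda>x. J (fst x *\<^sub>R snd x) + lam * fst x)"
  have "lower_semicontinuous G"
    unfolding G_def
  proof (intro lower_semicontinuous_add lower_semicontinuous_compose[OF J(1)]
      lower_semicontinuous_continuous continuous_on_coordinatewise_then_product)
    show "continuous_on UNIV (\<lambda>x::real \<times> ('i \<Rightarrow> real). (fst x *\<^sub>R snd x) i)" for i
      unfolding scaleR_fun_apply
      by (intro continuous_on_scaleR continuous_on_fst[OF continuous_on_id]
          continuous_on_apply[OF continuous_on_snd[OF continuous_on_id]])
    show "continuous_on UNIV (\<lambda>x::real \<times> ('i \<Rightarrow> real). lam * fst x)"
      by (intro continuous_intros)
  qed
  moreover have "compact ({0..C} \<times> ?H)"
    by (intro compact_Times compact_Icc compact_convex_hull_supported[OF I D])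
  moreover have ne: "(0, 0) \<in> {0..C} \<times> ?H" using H C(1) by simp
  ultimately obtain x where x: "x \<in> {0..C} \<times> ?H" "\<And>y. y \<in> {0..C} \<times> ?H \<Longrightarrow> G x \<le> G y"
    using lower_semicontinuous_attains_inf[of G "{0..C} \<times> ?H"] by blast
  show thesis
  proof (rule that[of "fst x" "snd x"])
    show "0 \<le> fst x" "snd x \<in> ?H" using x(1) by auto
    fix t' :: real and k' assume t': "0 \<le> t'" and k': "k' \<in> ?H"
    have "G x \<le> J (t' *\<^sub>R k') + lam * t'"
    \<comment> \<open>For \<open>t' > C\<close>, either the loss exceeds that at 0, or the point is
      bounded on \<open>I\<close> and can be written with the smaller factor
      \<open>C\<close>.\<close>
    proof (cases "t' \<le> C \<or> J (t' *\<^sub>R k') > J 0")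
      case True
      then show ?thesis
      proof
        assume "t' \<le> C"
        then show ?thesis using x(2)[of "(t', k')"] t' k' by (simp add: G_def)
      next
        assume "J (t' *\<^sub>R k') > J 0"
        moreover have "0 \<le> lam * t'" using lam t' by simp
        moreover have "G x \<le> J 0" using x(2)[OF ne] by (simp add: G_def)
        ultimately show ?thesis by linarith
      qed
    next
      case False
      have "k' \<in> span D" using k' convex_hull_subset_span by blast
      moreover have "J (t' *\<^sub>R k') \<le> J 0" using False by simp
      ultimately have "t' *\<^sub>R k' \<in> (\<lambda>k. C *\<^sub>R k) ` ?H"
        by (intro C(2)[rule_format] span_scale J(2)[rule_format])
      then obtain k where k: "k \<in> ?H" "t' *\<^sub>R k' = C *\<^sub>R k" by blast
      have "G x \<le> J (C *\<^sub>R k) + lam * C" using x(2)[of "(C, k)"] k(1) C(1) by (simp add: G_def)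
      also have "\<dots> \<le> J (t' *\<^sub>R k') + lam * t'" using False lam by (simp add: k(2) mult_left_mono)
      finally show ?thesis .
    qed
    then show "J (fst x *\<^sub>R snd x) + lam * fst x \<le> J (t' *\<^sub>R k') + lam * t'" by (simp add: G_def)
  qed
qed

section \<open>Compactness and coercivity\<close>

lemma C0_section_vanishes:
  assumes "f \<in> C0" "e > 0"
  shows "\<exists>K. compact K \<and> (\<forall>w. w \<notin> K \<longrightarrow> \<bar>f (z, w)\<bar> < e)"
proof -
  obtain K where K: "compact K" "\<And>x. x \<notin> K \<Longrightarrow> \<bar>f x\<bar> < e"
    using assms unfolding C0_def by blast
  have "compact (snd ` K)"
    using K(1) by (intro compact_continuous_image continuous_on_snd continuous_on_id)
  moreover have "\<bar>f (z, w)\<bar> < e" if "w \<notin> snd ` K" for w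
    using that by (intro K(2)) force
  ultimately show ?thesis by blast
qed

lemma C0_section_continuous:
  assumes "f \<in> C0"
  shows "continuous_on UNIV (\<lambda>w. f (z, w))"
proof -
  have "continuous_on UNIV f" using assms by (simp add: C0_def)
  then show ?thesis
    by (rule continuous_on_compose2) (auto intro: continuous_on_Pair continuous_on_const continuous_on_id)
qed

lemma C0_bounded_integrand:
  fixes f :: "'x::topological_space \<times> 't::t2_space \<Rightarrow> real"
  assumes "f \<in> C0"
  shows "bounded_integrand f"
proof
  fix x
  show "(\<lambda>t. f (x, t)) \<in> borel_measurable borel"
    by (intro borel_measurable_continuous_onI C0_section_continuous assms)
  obtain K where K: "compact K" "\<And>t. t \<notin> K \<Longrightarrow> \<bar>f (x, t)\<bar> < 1"
    using C0_section_vanishes[OF assms zero_less_one, of x] by auto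
  have "compact ((\<lambda>t. f (x, t)) ` K)"
    by (rule compact_continuous_image[OF continuous_on_subset[OF C0_section_continuous[OF assms] subset_UNIV] K(1)])
  then obtain b where b: "\<And>t. t \<in> K \<Longrightarrow> \<bar>f (x, t)\<bar> \<le> b"
    using compact_imp_bounded by (fastforce simp: bounded_iff)
  have "\<bar>f (x, t)\<bar> \<le> max b 1" for t
    using b[of t] K(2)[of t] by (cases "t \<in> K") auto
  then show "bounded (range (\<lambda>t. f (x, t)))" by (auto simp: bounded_iff)
qed

section \<open>Continuous maps with a limit at infinity\<close>

text \<open>The model is the image of a one-point compactification: a member of the cover that
  contains \<open>b\<close> catches everything outside a compact set.\<close>

lemma compact_insert_range:
  assumes g: "continuous_on UNIV g"
    and lim: "\<And>U. open U \<Longrightarrow> b \<in> U \<Longrightarrow> \<exists>K. compact K \<and> (\<forall>w. w \<notin> K \<longrightarrow> g w \<in> U)"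
  shows "compact (insert b (range g))"
proof (rule compactI)
  fix T assume op: "\<forall>t\<in>T. open t" and cov: "insert b (range g) \<subseteq> \<Union>T"
  then obtain U where U: "U \<in> T" "b \<in> U" by blast
  have "open U" using op U(1) by simp
  from lim[OF this U(2)] obtain K where K: "compact K" "\<forall>w. w \<notin> K \<longrightarrow> g w \<in> U"
    by (elim exE conjE)
  have cK: "compact (g ` K)"
    by (rule compact_continuous_image[OF continuous_on_subset[OF g subset_UNIV] K(1)])
  have covK: "g ` K \<subseteq> \<Union>T" using cov by blast
  obtain T' where T': "T' \<subseteq> T" "finite T'" "g ` K \<subseteq> \<Union>T'"
    by (rule compactE[OF cK covK]) (use op in auto)
  have "insert b (range g) \<subseteq> \<Union>(insert U T')"
    using K(2) T'(3) U(2) by blast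
  then show "\<exists>T'\<subseteq>T. finite T' \<and> insert b (range g) \<subseteq> \<Union>T'"
    using T' U(1) by (intro exI[of _ "insert U T'"]) auto
qed

text \<open>A basic neighbourhood of 0 in the product topology constrains single coordinates, and
  those outside \<open>I\<close> are identically 0, so finitely many compact sets suffice.\<close>

lemma compact_insert_zero_range:
  fixes g :: "'w::topological_space \<Rightarrow> 'i \<Rightarrow> real"
  assumes I: "finite I" and zero: "\<And>w i. i \<notin> I \<Longrightarrow> g w i = 0"
    and cont: "\<And>i. i \<in> I \<Longrightarrow> continuous_on UNIV (\<lambda>w. g w i)"
    and van: "\<And>i e. i \<in> I \<Longrightarrow> e > 0 \<Longrightarrow> \<exists>K. compact K \<and> (\<forall>w. w \<notin> K \<longrightarrow> \<bar>g w i\<bar> < e)"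
  shows "compact (insert 0 (range g))"
proof (rule compact_insert_range)
  have "continuous_on UNIV (\<lambda>w. g w i)" for i
    using cont zero by (cases "i \<in> I") (simp_all add: continuous_on_const)
  then show "continuous_on UNIV g" by (rule continuous_on_coordinatewise_then_product)
  fix U :: "('i \<Rightarrow> real) set" assume "open U" "0 \<in> U"
  then obtain X where X: "0 \<in> Pi\<^sub>E UNIV X" "\<And>i. open (X i)" "Pi\<^sub>E UNIV X \<subseteq> U"
    using product_topology_open_contains_basis[of "\<lambda>_. euclidean" UNIV U 0]
    by (auto simp: euclidean_product_topology)
  have zX: "0 \<in> X i" for i using X(1) by (auto simp: PiE_iff)
  have "\<exists>K. compact K \<and> (\<forall>w. w \<notin> K \<longrightarrow> g w i \<in> X i)" if i: "i \<in> I" for i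
  proof -
    obtain e where e: "e > 0" "\<And>y. dist y 0 < e \<Longrightarrow> y \<in> X i"
      using X(2)[of i, unfolded open_dist, rule_format, OF zX[of i]] by (elim exE conjE) simp
    from van[OF i e(1)] obtain K where K: "compact K" "\<forall>w. w \<notin> K \<longrightarrow> \<bar>g w i\<bar> < e"
      by (elim exE conjE)
    have "\<forall>w. w \<notin> K \<longrightarrow> g w i \<in> X i" using K(2) e(2) by (simp add: dist_real_def)
    with K(1) show ?thesis by (intro exI conjI)
  qed
  then have "\<forall>i\<in>I. \<exists>K. compact K \<and> (\<forall>w. w \<notin> K \<longrightarrow> g w i \<in> X i)" by (rule ballI)
  from bchoice[OF this] obtain K
    where K: "\<forall>i\<in>I. compact (K i) \<and> (\<forall>w. w \<notin> K i \<longrightarrow> g w i \<in> X i)" by (elim exE)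
  show "\<exists>K. compact K \<and> (\<forall>w. w \<notin> K \<longrightarrow> g w \<in> U)"
  proof (intro exI conjI allI impI)
    show "compact (\<Union>i\<in>I. K i)" using I K by (intro compact_UN) auto
    fix w assume w: "w \<notin> (\<Union>i\<in>I. K i)"
    have "g w i \<in> X i" for i using w K zero zX by (cases "i \<in> I") auto
    then show "g w \<in> U" using X(3) by blast
  qed
qed

section \<open>Weak-* compactness of the unit ball\<close>

lemma dual_pair_bounded_linear_left:
  assumes "dual_pair p"
  shows "bounded_linear (\<lambda>g. p g v)"
proof -
  have "bounded_bilinear p" using assms by (simp add: dual_pair_def)
  then show ?thesis by (rule bounded_bilinear.bounded_linear_left)
qed

text \<open>The right-hand side is a product of compact intervals cut down by closed conditions. The
  isometry gives the bounds, and surjectivity provides the vector that represents a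
  functional.\<close>

lemma canonical_predual_unit_ball:
  fixes p :: "'g::banach \<Rightarrow> 'f::banach \<Rightarrow> real"
  assumes p: "dual_pair p" "canonical_predual p"
  shows "(\<lambda>v g. p g v) ` {v. norm v \<le> 1} =
    {f. (\<forall>g. f g \<in> {- norm g..norm g}) \<and> (\<forall>g h. f (g + h) = f g + f h) \<and> (\<forall>c g. f (c *\<^sub>R g) = c * f g)}"
    (is "?L = ?R")
proof (intro equalityI subsetI)
  fix f assume "f \<in> ?L"
  then obtain v where v: "norm v \<le> 1" "f = (\<lambda>g. p g v)" by auto
  have bl: "bounded_linear f" using dual_pair_bounded_linear_left[OF p(1)] v(2) by simp
  have "\<bar>f g\<bar> \<le> norm g" for g
  proof -
    have "\<bar>f g\<bar> = norm (blinfun_apply (Blinfun f) g)" using bl by (simp add: bounded_linear_Blinfun_apply)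
    also have "\<dots> \<le> norm (Blinfun f) * norm g" by (rule norm_blinfun)
    also have "\<dots> = norm v * norm g" using p(2) v(2) by (simp add: canonical_predual_def)
    also have "\<dots> \<le> 1 * norm g" using v(1) by (intro mult_right_mono) auto
    finally show ?thesis by simp
  qed
  then show "f \<in> ?R"
    using linear_add[OF bounded_linear.linear[OF bl]] linear_scale[OF bounded_linear.linear[OF bl]]
    by (auto simp: abs_le_iff minus_le_iff)
next
  fix f assume f: "f \<in> ?R"
  have le: "\<bar>f g\<bar> \<le> norm g" for g using f by (auto simp: abs_le_iff minus_le_iff)
  have bl: "bounded_linear f"
    by (rule bounded_linear_intro[where K = 1]) (use f le in auto)
  obtain v where v: "Blinfun f = Blinfun (\<lambda>g. p g v)"
    using p(2) unfolding canonical_predual_def surj_def by blast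
  have "f = (\<lambda>g. p g v)"
    using arg_cong[OF v, of blinfun_apply] bl dual_pair_bounded_linear_left[OF p(1)]
    by (simp add: bounded_linear_Blinfun_apply)
  moreover have "norm v \<le> 1"
  proof -
    have "norm v = norm (Blinfun f)" using p(2) v by (simp add: canonical_predual_def)
    also have "\<dots> \<le> 1"
      by (rule norm_blinfun_bound) (use le bl in \<open>simp_all add: bounded_linear_Blinfun_apply\<close>)
    finally show ?thesis .
  qed
  ultimately show "f \<in> ?L" by blast
qed

text \<open>Banach-Alaoglu: Tychonoff's theorem and the closed linearity conditions, followed by the
  continuous projection to the coordinates \<open>gs j\<close>.\<close>

lemma compact_pairing_unit_ball:
  fixes p :: "'g::banach \<Rightarrow> 'f::banach \<Rightarrow> real" and gs :: "'d \<Rightarrow> 'g"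
  assumes p: "dual_pair p" "canonical_predual p"
  shows "compact ((\<lambda>v j. p (gs j) v) ` {v. norm v \<le> 1})"
proof -
  let ?S = "{f :: 'g \<Rightarrow> real. \<forall>g. f g \<in> {- norm g..norm g}}"
  let ?A = "{f :: 'g \<Rightarrow> real. \<forall>g h. f (g + h) = f g + f h}"
  let ?B = "{f :: 'g \<Rightarrow> real. \<forall>c g. f (c *\<^sub>R g) = c * f g}"
  have "closed ?A"
    by (intro closed_Collect_all closed_Collect_eq continuous_on_add continuous_on_product_coordinates)
  moreover have "closed ?B"
    by (intro closed_Collect_all closed_Collect_eq continuous_on_mult_left continuous_on_product_coordinates)
  moreover have "compact ?S" by (rule compact_product) simp
  ultimately have "compact (?S \<inter> (?A \<inter> ?B))" by (intro compact_Int_closed closed_Int)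
  moreover have "?S \<inter> (?A \<inter> ?B) = (\<lambda>v g. p g v) ` {v. norm v \<le> 1}"
    unfolding canonical_predual_unit_ball[OF p] by blast
  ultimately have c: "compact ((\<lambda>v g. p g v) ` {v. norm v \<le> 1})" by simp
  have "continuous_on S (\<lambda>f :: 'g \<Rightarrow> real. \<lambda>j. f (gs j))" for S
    by (rule continuous_on_coordinatewise_then_product)
      (rule continuous_on_subset[OF continuous_on_product_coordinates subset_UNIV])
  from compact_continuous_image[OF this c]
  have "compact ((\<lambda>f j. f (gs j)) ` (\<lambda>v g. p g v) ` {v. norm v \<le> 1})" .
  then show ?thesis by (simp add: image_image)
qed

text \<open>Meant for values in \<B>, whose norm is an infimum: the points
  \<open>x / (s + (1/2) ^ n)\<close> lie in \<open>K\<close> and converge to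
  \<open>x / s\<close>.\<close>

lemma scaled_limit:
  fixes K :: "('i \<Rightarrow> real) set"
  assumes K: "compact K" and s: "s > 0"
    and x: "\<And>d. d > 0 \<Longrightarrow> x \<in> (\<lambda>k. (s + d) *\<^sub>R k) ` K"
  shows "x \<in> (\<lambda>k. s *\<^sub>R k) ` K"
proof -
  have d0: "(1/2::real) ^ n > 0" for n by simp
  have "\<exists>k. k \<in> K \<and> x = (s + (1/2) ^ n) *\<^sub>R k" for n using x[OF d0, of n] by blast
  then obtain k where k: "\<And>n. k n \<in> K" "\<And>n. x = (s + (1/2) ^ n) *\<^sub>R k n" by metis
  have pos: "s + (1/2) ^ n > 0" for n using s d0[of n] by (rule add_pos_pos)
  have lim: "k \<longlonglongrightarrow> (\<lambda>i. x i / s)"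
  proof (rule tendsto_fun)
    fix i
    have "k n i = x i / (s + (1/2) ^ n)" for n
      using pos[of n] arg_cong[OF k(2)[of n], of "\<lambda>f. f i"] by (simp add: field_simps)
    moreover have "(\<lambda>n. x i / (s + (1/2) ^ n)) \<longlonglongrightarrow> x i / (s + 0)"
      using s by (intro tendsto_divide tendsto_add tendsto_const LIMSEQ_realpow_zero) auto
    ultimately show "(\<lambda>n. k n i) \<longlonglongrightarrow> x i / s" by simp
  qed
  have "(\<lambda>i. x i / s) \<in> K"
    by (rule Lim_in_closed_set[OF compact_imp_closed_fun[OF K]
        always_eventually[OF allI[OF k(1)]] sequentially_bot lim])
  moreover have "x = s *\<^sub>R (\<lambda>i. x i / s)" using s by (simp add: fun_eq_iff)
  ultimately show ?thesis by blast
qed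

section \<open>The averaged loss\<close>

lemma coercive_lsc_bounded_below:
  fixes f :: "'a::euclidean_space \<Rightarrow> real"
  assumes "coercive f" "lower_semicontinuous f"
  obtains b where "\<And>x. b \<le> f x"
proof -
  have "\<forall>\<^sub>F x in at_infinity. f 0 \<le> f x"
    using assms(1) unfolding coercive_def filterlim_at_top by blast
  then obtain r where r: "\<And>x. r \<le> norm x \<Longrightarrow> f 0 \<le> f x"
    unfolding eventually_at_infinity by blast
  have "cball (0::'a) \<bar>r\<bar> \<noteq> {}" by simp
  then obtain x0 where x0: "x0 \<in> cball 0 \<bar>r\<bar>" "\<And>x. x \<in> cball 0 \<bar>r\<bar> \<Longrightarrow> f x0 \<le> f x"
    using lower_semicontinuous_attains_inf[OF assms(2) compact_cball] by meson
  show thesis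
  proof (rule that[of "min (f 0) (f x0)"])
    fix x show "min (f 0) (f x0) \<le> f x"
      using r[of x] x0(2)[of x] by (cases "norm x \<le> \<bar>r\<bar>") (auto simp: min_le_iff_disj)
  qed
qed

text \<open>The data term as a function of the measured numbers alone, common to both
  problems.\<close>

definition avg_loss :: "(real ^ 'd \<Rightarrow> real ^ 'd \<Rightarrow> real) \<Rightarrow> nat \<Rightarrow> (nat \<Rightarrow> real ^ 'd) \<Rightarrow>
    (nat \<times> 'd::finite \<Rightarrow> real) \<Rightarrow> real" where
  "avg_loss L N ys u = 1 / real N * (\<Sum>n=1..N. L (\<chi> j. u (n, j)) (ys n))"

lemma avg_loss_lsc:
  fixes L :: "real ^ 'd::finite \<Rightarrow> real ^ 'd \<Rightarrow> real"
  assumes "N \<ge> 1" "\<And>y. lower_semicontinuous (\<lambda>u. L u y)"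
  shows "lower_semicontinuous (avg_loss L N ys)"
proof -
  have "continuous_on UNIV (\<lambda>u :: nat \<times> 'd \<Rightarrow> real. \<chi> j. u (n, j))" for n
    by (intro continuous_on_vec_lambda continuous_on_product_coordinates)
  from lower_semicontinuous_compose[OF assms(2) this]
  have "lower_semicontinuous (\<lambda>u :: nat \<times> 'd \<Rightarrow> real. L (\<chi> j. u (n, j)) (ys n))" for n .
  then show ?thesis
    unfolding avg_loss_def using assms(1)
    by (intro lower_semicontinuous_cmult lower_semicontinuous_sum) auto
qed

text \<open>A bound on the average bounds each summand once the others are bounded below, and
  coercivity of that summand then bounds its argument.\<close>

lemma avg_loss_coercive:
  fixes L :: "real ^ 'd::finite \<Rightarrow> real ^ 'd \<Rightarrow> real"
  assumes N: "N \<ge> 1" and lsc: "\<And>y. lower_semicontinuous (\<lambda>u. L u y)" and coe: "\<And>y. coercive (\<lambda>u. L u y)"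
  obtains R where "\<And>u n j. n \<in> {1..N} \<Longrightarrow> avg_loss L N ys u \<le> avg_loss L N ys 0 \<Longrightarrow> \<bar>u (n, j)\<bar> \<le> R"
proof -
  have "\<exists>b. \<forall>x. b \<le> L x y" for y
    using coercive_lsc_bounded_below[OF coe lsc] by metis
  then obtain b where b: "\<And>x y. b y \<le> L x y" by metis
  \<comment> \<open>What remains for the \<open>n\<close>-th summand when the others are replaced by
    their lower bounds; the \<open>+ 1\<close> below makes the contradiction strict.\<close>
  define c where "c n = real N * avg_loss L N ys 0 - (\<Sum>m\<in>{1..N} - {n}. b (ys m))" for n
  have "\<exists>r. \<forall>x. r \<le> norm x \<longrightarrow> c n + 1 \<le> L x (ys n)" for n
    using coe[of "ys n"] unfolding coercive_def filterlim_at_top eventually_at_infinity by blast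
  then obtain r where r: "\<And>n x. r n \<le> norm x \<Longrightarrow> c n + 1 \<le> L x (ys n)" by metis
  show thesis
  proof (rule that[of "\<Sum>n=1..N. \<bar>r n\<bar>"])
    fix u :: "nat \<times> 'd \<Rightarrow> real" and n j
    assume n: "n \<in> {1..N}" and le: "avg_loss L N ys u \<le> avg_loss L N ys 0"
    let ?x = "\<lambda>m. \<chi> j. u (m, j)"
    have "(\<Sum>m=1..N. L (?x m) (ys m)) = real N * avg_loss L N ys u"
      using N by (simp add: avg_loss_def)
    also have "\<dots> \<le> real N * avg_loss L N ys 0" using le by (intro mult_left_mono) auto
    finally have "L (?x n) (ys n) + (\<Sum>m\<in>{1..N} - {n}. L (?x m) (ys m)) \<le> real N * avg_loss L N ys 0"
      using n by (simp add: sum.remove)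
    moreover have "(\<Sum>m\<in>{1..N} - {n}. b (ys m)) \<le> (\<Sum>m\<in>{1..N} - {n}. L (?x m) (ys m))"
      by (intro sum_mono b)
    ultimately have "L (?x n) (ys n) \<le> c n" unfolding c_def by linarith
    then have "norm (?x n) < r n" using r[of n "?x n"] by force
    moreover have "\<bar>u (n, j)\<bar> \<le> norm (?x n)" using component_le_norm_cart[of "?x n" j] by simp
    moreover have "\<bar>r n\<bar> \<le> (\<Sum>n=1..N. \<bar>r n\<bar>)" using n by (intro member_le_sum) auto
    ultimately show "\<bar>u (n, j)\<bar> \<le> (\<Sum>n=1..N. \<bar>r n\<bar>)" by linarith
  qed
qed

section \<open>The representer theorem\<close>

text \<open>The loss, the labels and \<open>lam\<close> are absent: which data vectors a measure of
  given norm can produce does not depend on them.\<close>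

locale rkbs_regression =
  fixes \<phi> :: "'z::t2_space \<times> 'w::t2_space \<Rightarrow> real"
    and \<psi> :: "'x::t2_space \<times> 't::t2_space \<Rightarrow> real"
    and pair :: "'vd::banach \<Rightarrow> 'v::banach \<Rightarrow> real"
    and vd :: "'d::finite \<Rightarrow> 'vd" and xs :: "'d \<Rightarrow> 'x"
    and N :: nat and zs :: "nat \<Rightarrow> 'z"
  assumes phi: "\<phi> \<in> C0" and psi: "\<psi> \<in> C0"
    and dual: "dual_pair pair" and predual: "canonical_predual pair"
begin

sublocale phi: bounded_integrand \<phi> by (rule C0_bounded_integrand[OF phi])
sublocale psi: bounded_integrand \<psi> by (rule C0_bounded_integrand[OF psi])

abbreviation "V \<equiv> banach_nspace :: 'v nspace"
abbreviation "MV \<equiv> vmeas V :: ('t set \<Rightarrow> 'v) nspace"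
abbreviation "B \<equiv> rkbs \<psi> :: ('x \<Rightarrow> 'v) nspace"
abbreviation "AX \<equiv> int_op V \<psi>"
abbreviation "I \<equiv> {1..N} \<times> (UNIV :: 'd set)"

sublocale V: complete_nspace V by (rule complete_nspace_banach)
sublocale MV: complete_nspace MV by (rule complete_nspace_vmeas_banach)
sublocale B: complete_nspace B by (rule psi.complete_nspace_rkbs)

text \<open>Since \<open>N\<close> is not a type, vectors of \<open>\<real>\<^sup>N\<^sup>d\<close> are encoded as functions vanishing off
  \<open>I = {1..N} \<times> UNIV\<close>.\<close>

definition atom :: "'w \<Rightarrow> 't \<Rightarrow> 'v \<Rightarrow> nat \<times> 'd \<Rightarrow> real" where
  "atom w \<theta> v = (\<lambda>i. if i \<in> I then \<phi> (zs (fst i), w) * \<psi> (xs (snd i), \<theta>) * pair (vd (snd i)) v else 0)"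

definition atoms :: "(nat \<times> 'd \<Rightarrow> real) set" where
  "atoms = {atom w \<theta> v | w \<theta> v. norm v \<le> 1}"

lemma bounded_linear_pair: "bounded_linear (pair g)"
proof -
  have "bounded_bilinear pair" using dual by (simp add: dual_pair_def)
  then show ?thesis by (rule bounded_bilinear.bounded_linear_right)
qed

lemmas pair_add = linear_add[OF bounded_linear.linear[OF bounded_linear_pair]]
lemmas pair_scaleR = linear_scale[OF bounded_linear.linear[OF bounded_linear_pair]]
lemmas pair_zero = linear_0[OF bounded_linear.linear[OF bounded_linear_pair]]
lemmas pair_sum = linear_sum[OF bounded_linear.linear[OF bounded_linear_pair]]

lemma pair_bound: obtains C where "0 \<le> C" "\<And>v. \<bar>pair g v\<bar> \<le> C * norm v"
  using bounded_linear.nonneg_bounded[OF bounded_linear_pair[of g]]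
  by (auto simp: mult.commute)

lemma atom_scaleR: "atom w \<theta> (c *\<^sub>R v) = c *\<^sub>R atom w \<theta> v"
  by (rule ext) (simp add: atom_def pair_scaleR)

lemma finite_I: "finite I" by simp

lemma card_I: "card I = N * CARD('d)" by simp

lemma atoms_supported: "atoms \<subseteq> {u. \<forall>i\<in>- I. u i = 0}"
  by (auto simp: atoms_def atom_def)

lemma zero_in_atoms: "0 \<in> atoms"
proof -
  have "0 = atom undefined undefined 0" by (rule ext) (simp add: atom_def pair_zero)
  then show ?thesis unfolding atoms_def using norm_zero zero_le_one by (metis (mono_tags, lifting) mem_Collect_eq)
qed

lemma uminus_in_atoms: "u \<in> atoms \<Longrightarrow> - u \<in> atoms"
proof -
  assume "u \<in> atoms"
  then obtain w \<theta> v where u: "u = atom w \<theta> v" "norm v \<le> 1" unfolding atoms_def by blast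
  have "- u = atom w \<theta> (- v)"
    using atom_scaleR[of w \<theta> "-1" v] u(1) by simp
  moreover have "norm (- v) \<le> 1" using u(2) by simp
  ultimately show ?thesis unfolding atoms_def by blast
qed

text \<open>An atom is a product of a \<open>\<phi>\<close> factor, a \<open>\<psi>\<close> factor
  and a pairing factor; each ranges over a compact set once 0 is added to the first two as limit at
  infinity.\<close>

lemma compact_atoms: "compact atoms"
proof -
  define P where "P = insert 0 (range (\<lambda>w n. if n \<in> {1..N} then \<phi> (zs n, w) else 0))"
  define Q where "Q = insert 0 (range (\<lambda>\<theta> j. \<psi> (xs j, \<theta>)))"
  define S where "S = (\<lambda>v j. pair (vd j) v) ` {v. norm v \<le> 1}"
  define F :: "(nat \<Rightarrow> real) \<times> ('d \<Rightarrow> real) \<times> ('d \<Rightarrow> real) \<Rightarrow> nat \<times> 'd \<Rightarrow> real"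
    where "F x = (\<lambda>i. fst x (fst i) * fst (snd x) (snd i) * snd (snd x) (snd i))" for x
  have "compact P"
    unfolding P_def
  proof (rule compact_insert_zero_range[of "{1..N}"])
    fix n :: nat and e :: real assume n: "n \<in> {1..N}"
    show "continuous_on UNIV (\<lambda>w. if n \<in> {1..N} then \<phi> (zs n, w) else 0)"
      using n C0_section_continuous[OF phi] by simp
    assume "e > 0"
    from C0_section_vanishes[OF phi this, of "zs n"]
    show "\<exists>K. compact K \<and> (\<forall>w. w \<notin> K \<longrightarrow> \<bar>if n \<in> {1..N} then \<phi> (zs n, w) else 0\<bar> < e)"
      using n by simp
  qed auto
  moreover have "compact Q"
    unfolding Q_def
  proof (rule compact_insert_zero_range[of UNIV])
    fix j :: 'd and e :: real
    show "continuous_on UNIV (\<lambda>\<theta>. \<psi> (xs j, \<theta>))" by (rule C0_section_continuous[OF psi])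
    assume "e > 0"
    from C0_section_vanishes[OF psi this]
    show "\<exists>K. compact K \<and> (\<forall>w. w \<notin> K \<longrightarrow> \<bar>\<psi> (xs j, w)\<bar> < e)" .
  qed simp_all
  moreover have "compact S"
    unfolding S_def by (rule compact_pairing_unit_ball[OF dual predual])
  ultimately have "compact (P \<times> Q \<times> S)" by (intro compact_Times)
  moreover have "continuous_on (P \<times> Q \<times> S) F"
  proof (rule continuous_on_coordinatewise_then_product)
    fix i
    show "continuous_on (P \<times> Q \<times> S) (\<lambda>x. F x i)"
      unfolding F_def
      by (intro continuous_on_mult continuous_on_apply[OF continuous_on_fst[OF continuous_on_id]]
          continuous_on_apply[OF continuous_on_fst[OF continuous_on_snd[OF continuous_on_id]]]
          continuous_on_apply[OF continuous_on_snd[OF continuous_on_snd[OF continuous_on_id]]])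
  qed
  ultimately have "compact (F ` (P \<times> Q \<times> S))" by (rule compact_continuous_image[rotated])
  moreover have "F ` (P \<times> Q \<times> S) = atoms"
  proof (intro equalityI subsetI)
    fix u assume "u \<in> F ` (P \<times> Q \<times> S)"
    then obtain a b c where u: "u = F (a, b, c)" and abc: "a \<in> P" "b \<in> Q" "c \<in> S" by auto
    obtain v where v: "norm v \<le> 1" "c = (\<lambda>j. pair (vd j) v)" using abc(3) unfolding S_def by auto
    show "u \<in> atoms"
    \<comment> \<open>The added limit points contribute only the zero vector, which is an atom
      already.\<close>
    proof (cases "a = 0 \<or> b = 0")
      case True
      then have "u = 0" unfolding u F_def by (intro ext) auto
      then show ?thesis using zero_in_atoms by simp
    next
      case False
      then obtain w \<theta> where "a = (\<lambda>n. if n \<in> {1..N} then \<phi> (zs n, w) else 0)" "b = (\<lambda>j. \<psi> (xs j, \<theta>))"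
        using abc(1,2) unfolding P_def Q_def by auto
      then have "u = atom w \<theta> v"
        unfolding u v(2) F_def atom_def by (intro ext) (auto simp: mem_Times_iff)
      then show ?thesis using v(1) unfolding atoms_def by blast
    qed
  next
    fix u assume "u \<in> atoms"
    then obtain w \<theta> v where u: "u = atom w \<theta> v" "norm v \<le> 1" unfolding atoms_def by blast
    let ?a = "\<lambda>n. if n \<in> {1..N} then \<phi> (zs n, w) else 0"
    have "u = F (?a, \<lambda>j. \<psi> (xs j, \<theta>), \<lambda>j. pair (vd j) v)"
      unfolding u(1) F_def atom_def by (intro ext) (auto simp: mem_Times_iff)
    moreover have "(?a, \<lambda>j. \<psi> (xs j, \<theta>), \<lambda>j. pair (vd j) v) \<in> P \<times> Q \<times> S"
      unfolding P_def Q_def S_def using u(2) by auto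
    ultimately show "u \<in> F ` (P \<times> Q \<times> S)" by (rule image_eqI)
  qed
  ultimately show ?thesis by simp
qed

abbreviation "K \<equiv> convex hull atoms"

lemma K: "convex K" "0 \<in> K" "compact K"
  by (auto intro: hull_inc zero_in_atoms
      compact_convex_hull_supported[OF finite_I atoms_supported zero_in_atoms compact_atoms])

lemma atom_in_scaled: "atom w \<theta> v \<in> (\<lambda>k. norm v *\<^sub>R k) ` K"
proof (cases "v = 0")
  case True
  then have "atom w \<theta> v = norm v *\<^sub>R 0" using atom_scaleR[of w \<theta> 0 0] by simp
  then show ?thesis using K(2) by (rule image_eqI)
next
  case False
  then have "atom w \<theta> v = norm v *\<^sub>R atom w \<theta> (v /\<^sub>R norm v)"
    by (simp only: atom_scaleR[symmetric]) simp
  moreover have "atom w \<theta> (v /\<^sub>R norm v) \<in> atoms" unfolding atoms_def using False by force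
  ultimately show ?thesis using hull_inc[of _ atoms convex] by blast
qed

section \<open>Data vectors of arbitrary measures\<close>

text \<open>Integration over \<Theta> with \<open>w\<close> fixed, the factor \<open>\<phi>\<close>
  being part of the functional. The result is what a single point of \<Omega> contributes to the
  outer integral.\<close>

lemma inner_in_scaled:
  assumes \<nu>: "\<nu> \<in> carr MV"
  shows "(\<lambda>i. if i \<in> I then \<phi> (zs (fst i), w) * pair (vd (snd i)) (AX \<nu> (xs (snd i))) else 0)
    \<in> (\<lambda>k. nrm MV \<nu> *\<^sub>R k) ` K"
proof -
  have "\<exists>C. \<forall>v. \<bar>pair (vd j) v\<bar> \<le> C * norm v" for j using pair_bound by metis
  then obtain C where C: "\<And>j v. \<bar>pair (vd j) v\<bar> \<le> C j * norm v" by metis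
  have "(\<lambda>i. if i \<in> I then (\<lambda>i v. \<phi> (zs (fst i), w) * pair (vd (snd i)) v) i
        (vint V \<nu> ((\<lambda>i t. \<psi> (xs (snd i), t)) i)) else 0) \<in> (\<lambda>k. nrm MV \<nu> *\<^sub>R k) ` K"
  proof (rule V.vint_in_scaled[OF \<nu> finite_I psi.meas psi.bdd _ _ _ K])
    show "\<bar>\<phi> (zs (fst i), w) * pair (vd (snd i)) v\<bar> \<le> (\<lambda>i. \<bar>\<phi> (zs (fst i), w)\<bar> * C (snd i)) i * nrm V v"
      for i :: "nat \<times> 'd" and v
      using C[of "snd i" v] by (simp add: abs_mult mult.assoc mult_left_mono)
    show "(\<lambda>i. if i \<in> I then \<psi> (xs (snd i), t) * (\<phi> (zs (fst i), w) * pair (vd (snd i)) v) else 0)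
        \<in> (\<lambda>k. nrm V v *\<^sub>R k) ` K" for t v
    proof -
      have "(\<lambda>i. if i \<in> I then \<psi> (xs (snd i), t) * (\<phi> (zs (fst i), w) * pair (vd (snd i)) v) else 0) = atom w t v"
        unfolding atom_def by (intro ext) (simp add: mult_ac)
      then show ?thesis using atom_in_scaled[of w t v] by simp
    qed
  qed (simp_all add: pair_add pair_scaleR distrib_left)
  then show ?thesis unfolding int_op_def .
qed

text \<open>Integration over \<Omega> with measures as values; \<open>inner_in_scaled\<close>
  supplies the hypothesis on single cells.\<close>

lemma weight_in_scaled:
  assumes \<mu>: "\<mu> \<in> carr (vmeas MV)"
  shows "(\<lambda>i. if i \<in> I then pair (vd (snd i)) (AX (int_op MV \<phi> \<mu> (zs (fst i))) (xs (snd i))) else 0)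
    \<in> (\<lambda>k. nrm (vmeas MV) \<mu> *\<^sub>R k) ` K"
proof -
  have "\<exists>C. \<forall>\<nu>\<in>carr MV. \<bar>pair (vd j) (AX \<nu> (xs j))\<bar> \<le> C * nrm MV \<nu>" for j
  proof -
    obtain C where C: "0 \<le> C" "\<And>v. \<bar>pair (vd j) v\<bar> \<le> C * norm v" by (rule pair_bound[of "vd j"]) blast
    obtain C' where C': "\<And>\<nu> :: 't set \<Rightarrow> 'v. \<nu> \<in> carr MV \<Longrightarrow> norm (AX \<nu> (xs j)) \<le> C' * nrm MV \<nu>"
      using psi.norm_int_op_le by metis
    have "\<bar>pair (vd j) (AX \<nu> (xs j))\<bar> \<le> (C * C') * nrm MV \<nu>" if "\<nu> \<in> carr MV" for \<nu>
      using C(2)[of "AX \<nu> (xs j)"] mult_left_mono[OF C'[OF that] C(1)] by (simp add: mult.assoc)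
    then show ?thesis by blast
  qed
  then obtain C where C: "\<And>j \<nu>. \<nu> \<in> carr MV \<Longrightarrow> \<bar>pair (vd j) (AX \<nu> (xs j))\<bar> \<le> C j * nrm MV \<nu>"
    by metis
  have "(\<lambda>i. if i \<in> I then (\<lambda>i \<nu>. pair (vd (snd i)) (AX \<nu> (xs (snd i)))) i
        (vint MV \<mu> ((\<lambda>i w. \<phi> (zs (fst i), w)) i)) else 0) \<in> (\<lambda>k. nrm (vmeas MV) \<mu> *\<^sub>R k) ` K"
  proof (rule MV.vint_in_scaled[OF \<mu> finite_I phi.meas phi.bdd _ _ _ K])
    show "\<bar>pair (vd (snd i)) (AX \<nu> (xs (snd i)))\<bar> \<le> (\<lambda>i. C (snd i)) i * nrm MV \<nu>"
      if "\<nu> \<in> carr MV" for i :: "nat \<times> 'd" and \<nu> using C[OF that] by simp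
    show "pair (vd (snd i)) (AX (x + y) (xs (snd i)))
        = pair (vd (snd i)) (AX x (xs (snd i))) + pair (vd (snd i)) (AX y (xs (snd i)))"
      if "x \<in> carr MV" "y \<in> carr MV" for i :: "nat \<times> 'd" and x y
      unfolding psi.int_op_add[OF V.complete_nspace_axioms that] by (simp add: pair_add)
    show "pair (vd (snd i)) (AX (c *\<^sub>R x) (xs (snd i))) = c * pair (vd (snd i)) (AX x (xs (snd i)))"
      if "x \<in> carr MV" for i :: "nat \<times> 'd" and c x
      unfolding psi.int_op_scaleR[OF V.complete_nspace_axioms that] by (simp add: pair_scaleR)
  qed (rule inner_in_scaled)
  then show ?thesis unfolding int_op_def .
qed

text \<open>An element of \<B> is known only through representing measures of norm slightly above
  its own. Hence \<open>inner_in_scaled\<close> gives the factors \<open>nrm B u + d\<close>, and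
  \<open>scaled_limit\<close> removes \<open>d\<close>.\<close>

lemma function_in_scaled:
  assumes \<mu>: "\<mu> \<in> carr (vmeas B)"
  shows "(\<lambda>i. if i \<in> I then pair (vd (snd i)) (int_op B \<phi> \<mu> (zs (fst i)) (xs (snd i))) else 0)
    \<in> (\<lambda>k. nrm (vmeas B) \<mu> *\<^sub>R k) ` K"
proof -
  have "\<exists>C. \<forall>u\<in>carr B. \<bar>pair (vd j) (u (xs j))\<bar> \<le> C * nrm B u" for j
  proof -
    obtain C where C: "0 \<le> C" "\<And>v. \<bar>pair (vd j) v\<bar> \<le> C * norm v" by (rule pair_bound[of "vd j"]) blast
    obtain C' where C': "\<And>\<nu> :: 't set \<Rightarrow> 'v. \<nu> \<in> carr MV \<Longrightarrow> norm (AX \<nu> (xs j)) \<le> C' * nrm MV \<nu>"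
      using psi.norm_int_op_le by metis
    have "\<bar>pair (vd j) (u (xs j))\<bar> \<le> (C * \<bar>C'\<bar>) * nrm B u" if u: "u \<in> carr B" for u
    proof (rule field_le_epsilon)
      fix d :: real assume "d > 0"
      define r where "r = d / (C * \<bar>C'\<bar> + 1)"
      have p: "C * \<bar>C'\<bar> + 1 > 0" using C(1) by (simp add: add_nonneg_pos)
      then have r: "r > 0" using \<open>d > 0\<close> by (simp add: r_def)
      obtain \<nu> where \<nu>: "\<nu> \<in> carr MV" "u = AX \<nu>" "nrm MV \<nu> < nrm B u + r"
        by (rule psi.rkbs_nrm_less[OF u r])
      have "\<bar>pair (vd j) (u (xs j))\<bar> \<le> C * (C' * nrm MV \<nu>)"
        using C(2)[of "AX \<nu> (xs j)"] mult_left_mono[OF C'[OF \<nu>(1)] C(1)] \<nu>(2) by simp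
      also have "\<dots> \<le> C * (\<bar>C'\<bar> * (nrm B u + r))"
        using \<nu>(3) MV.nrm_nonneg[OF \<nu>(1)] C(1) by (intro mult_left_mono mult_mono) auto
      also have "\<dots> = (C * \<bar>C'\<bar>) * nrm B u + (C * \<bar>C'\<bar>) * r" by (simp add: algebra_simps)
      also have "(C * \<bar>C'\<bar>) * r \<le> (C * \<bar>C'\<bar> + 1) * r" using r by (intro mult_right_mono) auto
      also have "(C * \<bar>C'\<bar> + 1) * r = d" using p by (simp add: r_def)
      finally show "\<bar>pair (vd j) (u (xs j))\<bar> \<le> (C * \<bar>C'\<bar>) * nrm B u + d" by simp
    qed
    then show ?thesis by blast
  qed
  then obtain C where C: "\<And>j u. u \<in> carr B \<Longrightarrow> \<bar>pair (vd j) (u (xs j))\<bar> \<le> C j * nrm B u" by metis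
  have "(\<lambda>i. if i \<in> I then (\<lambda>i u. pair (vd (snd i)) (u (xs (snd i)))) i
        (vint B \<mu> ((\<lambda>i w. \<phi> (zs (fst i), w)) i)) else 0) \<in> (\<lambda>k. nrm (vmeas B) \<mu> *\<^sub>R k) ` K"
  proof (rule B.vint_in_scaled[OF \<mu> finite_I phi.meas phi.bdd _ _ _ K])
    show "\<bar>pair (vd (snd i)) (u (xs (snd i)))\<bar> \<le> (\<lambda>i. C (snd i)) i * nrm B u"
      if "u \<in> carr B" for i :: "nat \<times> 'd" and u using C[OF that] by simp
    show "(\<lambda>i. if i \<in> I then \<phi> (zs (fst i), w) * pair (vd (snd i)) (u (xs (snd i))) else 0)
        \<in> (\<lambda>k. nrm B u *\<^sub>R k) ` K" (is "?f \<in> _") if u: "u \<in> carr B" for w u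
    \<comment> \<open>\<open>scaled_limit\<close> needs a positive factor; norm 0 means
      \<open>u = 0\<close>.\<close>
    proof (cases "nrm B u = 0")
      case True
      then have "u = 0" by (rule B.nrm_definite[OF u])
      then have "?f = nrm B u *\<^sub>R 0" by (intro ext) (simp add: pair_zero)
      then show ?thesis using K(2) by (rule image_eqI)
    next
      case False
      then have "nrm B u > 0" using B.nrm_nonneg[OF u] by simp
      then show ?thesis
      proof (rule scaled_limit[OF K(3)])
        fix d :: real assume d: "d > 0"
        obtain \<nu> where \<nu>: "\<nu> \<in> carr MV" "u = AX \<nu>" "nrm MV \<nu> < nrm B u + d"
          by (rule psi.rkbs_nrm_less[OF u d])
        have "?f \<in> (\<lambda>k. nrm MV \<nu> *\<^sub>R k) ` K" unfolding \<nu>(2) by (rule inner_in_scaled[OF \<nu>(1)])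
        then show "?f \<in> (\<lambda>k. (nrm B u + d) *\<^sub>R k) ` K"
          by (rule scaled_mono[OF K(1,2) MV.nrm_nonneg[OF \<nu>(1)] less_imp_le[OF \<nu>(3)]])
      qed
    qed
  qed (simp_all add: pair_add pair_scaleR)
  then show ?thesis unfolding int_op_def .
qed

section \<open>Sums of point masses\<close>

context
  fixes S :: "nat set" and w :: "nat \<Rightarrow> 'w" and \<theta> :: "nat \<Rightarrow> 't" and v :: "nat \<Rightarrow> 'v"
begin

abbreviation "\<mu>M \<equiv> \<Sum>m\<in>S. point_mass (w m) (point_mass (\<theta> m) (v m))"
abbreviation "\<mu>B \<equiv> \<Sum>m\<in>S. point_mass (w m) (AX (point_mass (\<theta> m) (v m)))"

lemma inner_point_mass: "point_mass (\<theta> m) (v m) \<in> carr MV" "nrm MV (point_mass (\<theta> m) (v m)) \<le> norm (v m)"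
  using V.point_mass_vmeas[of "v m" "\<theta> m"] by simp_all

lemma AX_point_mass: "AX (point_mass (\<theta> m) (v m)) \<in> carr B" "nrm B (AX (point_mass (\<theta> m) (v m))) \<le> norm (v m)"
  using inner_point_mass psi.rkbs_nrm_le[OF inner_point_mass(1)] by (auto simp: psi.rkbs_carr intro: order_trans)

lemma weight_measure: "\<mu>M \<in> carr (vmeas MV)" "nrm (vmeas MV) \<mu>M \<le> (\<Sum>m\<in>S. norm (v m))"
proof -
  interpret M: complete_nspace "vmeas MV :: ('w set \<Rightarrow> 't set \<Rightarrow> 'v) nspace"
    by (rule MV.complete_nspace_vmeas)
  note pm = MV.point_mass_vmeas[OF inner_point_mass(1)]
  show "\<mu>M \<in> carr (vmeas MV)" by (intro M.sum_mem pm)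
  have "nrm (vmeas MV) \<mu>M \<le> (\<Sum>m\<in>S. nrm (vmeas MV) (point_mass (w m) (point_mass (\<theta> m) (v m))))"
    by (intro M.nrm_sum pm)
  also have "\<dots> \<le> (\<Sum>m\<in>S. norm (v m))"
    by (intro sum_mono order_trans[OF pm(2) inner_point_mass(2)])
  finally show "nrm (vmeas MV) \<mu>M \<le> (\<Sum>m\<in>S. norm (v m))" .
qed

lemma function_measure: "\<mu>B \<in> carr (vmeas B)" "nrm (vmeas B) \<mu>B \<le> (\<Sum>m\<in>S. norm (v m))"
proof -
  interpret M: complete_nspace "vmeas B :: ('w set \<Rightarrow> 'x \<Rightarrow> 'v) nspace"
    by (rule B.complete_nspace_vmeas)
  note pm = B.point_mass_vmeas[OF AX_point_mass(1)]
  show "\<mu>B \<in> carr (vmeas B)" by (intro M.sum_mem pm)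
  have "nrm (vmeas B) \<mu>B \<le> (\<Sum>m\<in>S. nrm (vmeas B) (point_mass (w m) (AX (point_mass (\<theta> m) (v m)))))"
    by (intro M.nrm_sum pm)
  also have "\<dots> \<le> (\<Sum>m\<in>S. norm (v m))"
    by (intro sum_mono order_trans[OF pm(2) AX_point_mass(2)])
  finally show "nrm (vmeas B) \<mu>B \<le> (\<Sum>m\<in>S. norm (v m))" .
qed

lemma AX_point_mass_eq: "AX (point_mass (\<theta> m) (v m)) x = \<psi> (x, \<theta> m) *\<^sub>R v m"
  using psi.int_op_point_mass[OF V.complete_nspace_axioms, of "v m"] by simp

lemma int_op_weight_measure:
  "AX (int_op MV \<phi> \<mu>M z) = (\<lambda>x. \<Sum>m\<in>S. (\<phi> (z, w m) * \<psi> (x, \<theta> m)) *\<^sub>R v m)"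
proof -
  have "int_op MV \<phi> \<mu>M = (\<Sum>m\<in>S. int_op MV \<phi> (point_mass (w m) (point_mass (\<theta> m) (v m))))"
    by (intro phi.int_op_sum[OF MV.complete_nspace_axioms] MV.point_mass_vmeas(1)[OF inner_point_mass(1)])
  then have "int_op MV \<phi> \<mu>M z = (\<Sum>m\<in>S. \<phi> (z, w m) *\<^sub>R point_mass (\<theta> m) (v m))"
    by (simp only: sum_fun_apply phi.int_op_point_mass[OF MV.complete_nspace_axioms inner_point_mass(1)])
  then have "AX (int_op MV \<phi> \<mu>M z) = AX (\<Sum>m\<in>S. \<phi> (z, w m) *\<^sub>R point_mass (\<theta> m) (v m))"
    by (rule arg_cong)
  also have "\<dots> = (\<Sum>m\<in>S. AX (\<phi> (z, w m) *\<^sub>R point_mass (\<theta> m) (v m)))"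
    by (intro psi.int_op_sum[OF V.complete_nspace_axioms] MV.scaleR_mem inner_point_mass(1))
  also have "\<dots> = (\<lambda>x. \<Sum>m\<in>S. (\<phi> (z, w m) * \<psi> (x, \<theta> m)) *\<^sub>R v m)"
    by (intro ext) (simp add: sum_fun_apply AX_point_mass_eq
        psi.int_op_scaleR[OF V.complete_nspace_axioms inner_point_mass(1)])
  finally show ?thesis .
qed

lemma int_op_function_measure:
  "int_op B \<phi> \<mu>B z = (\<lambda>x. \<Sum>m\<in>S. (\<phi> (z, w m) * \<psi> (x, \<theta> m)) *\<^sub>R v m)"
proof -
  have "int_op B \<phi> \<mu>B = (\<Sum>m\<in>S. int_op B \<phi> (point_mass (w m) (AX (point_mass (\<theta> m) (v m)))))"
    by (intro phi.int_op_sum[OF B.complete_nspace_axioms] B.point_mass_vmeas(1)[OF AX_point_mass(1)])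
  then have "int_op B \<phi> \<mu>B z = (\<Sum>m\<in>S. \<phi> (z, w m) *\<^sub>R AX (point_mass (\<theta> m) (v m)))"
    by (simp only: sum_fun_apply phi.int_op_point_mass[OF B.complete_nspace_axioms AX_point_mass(1)])
  also have "\<dots> = (\<lambda>x. \<Sum>m\<in>S. (\<phi> (z, w m) * \<psi> (x, \<theta> m)) *\<^sub>R v m)"
    by (intro ext) (simp add: sum_fun_apply AX_point_mass_eq)
  finally show ?thesis .
qed

text \<open>Ties the combination of atoms to the function that both measures produce, so that their
  loss is that of the finite-dimensional minimizer.\<close>

lemma sum_atoms_eq:
  "(\<Sum>m\<in>S. atom (w m) (\<theta> m) (v m)) = (\<lambda>i. if i \<in> I then
      pair (vd (snd i)) (\<Sum>m\<in>S. (\<phi> (zs (fst i), w m) * \<psi> (xs (snd i), \<theta> m)) *\<^sub>R v m) else 0)"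
  by (intro ext) (simp add: sum_fun_apply atom_def pair_sum pair_scaleR)

end

text \<open>Homogeneity of \<open>atom\<close> in its last argument absorbs the weights into the
  vectors, whose norms the weights then bound.\<close>

lemma scaled_atoms_representation:
  assumes "0 \<le> t" "u \<in> (\<lambda>k. t *\<^sub>R k) ` K"
  obtains w \<theta> v where "u = (\<Sum>m=1..N * CARD('d). atom (w m) (\<theta> m) (v m))"
    "(\<Sum>m=1..N * CARD('d). norm (v m)) \<le> t"
proof -
  obtain c d where c: "\<And>m. 0 \<le> c m" "\<And>m. d m \<in> atoms" "(\<Sum>m<card I. c m) \<le> t"
    "u = (\<Sum>m<card I. c m *\<^sub>R d m)"
    by (rule scaled_hull_representation[OF finite_I atoms_supported zero_in_atoms assms]) blast
  have "\<exists>w \<theta> v. d m = atom w \<theta> v \<and> norm v \<le> 1" for m using c(2)[of m] unfolding atoms_def by blast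
  then obtain w \<theta> v where d: "\<And>m. d m = atom (w m) (\<theta> m) (v m)" "\<And>m. norm (v m) \<le> 1" by metis
  \<comment> \<open>Indices move to a range that starts at 1, where the subtraction
    \<open>m - 1\<close> is never truncated.\<close>
  have shift: "(\<Sum>m<card I. f m) = (\<Sum>m=1..N * CARD('d). f (m - 1))" for f :: "nat \<Rightarrow> 'a::comm_monoid_add"
    unfolding card_I by (rule sum.reindex_bij_witness[of _ "\<lambda>m. m - 1" Suc]) auto
  show thesis
  proof (rule that[of "\<lambda>m. w (m - 1)" "\<lambda>m. \<theta> (m - 1)" "\<lambda>m. c (m - 1) *\<^sub>R v (m - 1)"])
    show "u = (\<Sum>m=1..N * CARD('d). atom (w (m - 1)) (\<theta> (m - 1)) (c (m - 1) *\<^sub>R v (m - 1)))"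
      unfolding c(4) shift d(1) atom_scaleR ..
    have "(\<Sum>m<card I. norm (c m *\<^sub>R v m)) \<le> (\<Sum>m<card I. c m)"
      using c(1) d(2) by (intro sum_mono) (simp add: mult_left_le)
    then show "(\<Sum>m=1..N * CARD('d). norm (c (m - 1) *\<^sub>R v (m - 1))) \<le> t"
      unfolding shift[of "\<lambda>m. norm (c m *\<^sub>R v m)"] using c(3) by linarith
  qed
qed

text \<open>The loss reads only coordinates in \<open>I\<close>, so setting the others to 0 puts the
  data into the encoded space without changing it.\<close>

lemma avg_loss_measurement:
  "1 / real N * (\<Sum>n=1..N. L (measurement pair vd xs (f (zs n))) (ys n))
    = avg_loss L N ys (\<lambda>i. if i \<in> I then pair (vd (snd i)) (f (zs (fst i)) (xs (snd i))) else 0)"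
  unfolding avg_loss_def measurement_def
  by (intro arg_cong[where f = "\<lambda>x. 1 / real N * x"] sum.cong refl arg_cong2[where f = L])
    (auto simp: vec_eq_iff)

end

theorem theorem5p2:
  fixes \<phi> :: "'z::t2_space \<times> 'w::t2_space \<Rightarrow> real"
    and \<psi> :: "'x::t2_space \<times> 't::t2_space \<Rightarrow> real"
    and pair :: "'vd::banach \<Rightarrow> 'v::banach \<Rightarrow> real"
    and vd :: "'d::finite \<Rightarrow> 'vd" and xs :: "'d \<Rightarrow> 'x"
    and N :: nat and zs :: "nat \<Rightarrow> 'z" and ys :: "nat \<Rightarrow> real ^ 'd"
    and L :: "real ^ 'd \<Rightarrow> real ^ 'd \<Rightarrow> real"
    and lam :: real
  defines "V \<equiv> banach_nspace :: 'v nspace"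
  defines "MV \<equiv> vmeas V :: ('t set \<Rightarrow> 'v) nspace"
  defines "B \<equiv> rkbs \<psi> :: ('x \<Rightarrow> 'v) nspace"
  defines "AX \<equiv> int_op V \<psi>"
  defines "M \<equiv> measurement pair vd xs"
  defines "obj_weight \<equiv> (\<lambda>\<mu> :: 'w set \<Rightarrow> 't set \<Rightarrow> 'v.
             1 / real N * (\<Sum>n=1..N. L (M (AX (int_op MV \<phi> \<mu> (zs n)))) (ys n))
             + lam * nrm (vmeas MV) \<mu>)"
  defines "obj_function \<equiv> (\<lambda>\<mu> :: 'w set \<Rightarrow> 'x \<Rightarrow> 'v.
             1 / real N * (\<Sum>n=1..N. L (M (int_op B \<phi> \<mu> (zs n))) (ys n))
             + lam * nrm (vmeas B) \<mu>)"
  assumes "locally_compact_space (euclidean :: 'z topology)"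
    and "locally_compact_space (euclidean :: 'w topology)"
    and "locally_compact_space (euclidean :: 'x topology)"
    and "locally_compact_space (euclidean :: 't topology)"
    and "\<phi> \<in> C0" and "\<psi> \<in> C0"
    and "dual_pair pair" and "canonical_predual pair"
    and "N \<ge> 1"
    and "\<And>y. convex_on UNIV (\<lambda>u. L u y)"
    and "\<And>y. coercive (\<lambda>u. L u y)"
    and "\<And>y. lower_semicontinuous (\<lambda>u. L u y)"
    and "lam \<ge> 0"
  shows "\<exists>(w :: nat \<Rightarrow> 'w) (\<theta> :: nat \<Rightarrow> 't) (v :: nat \<Rightarrow> 'v) \<mu>M \<mu>B.
     \<mu>M = (\<Sum>m=1..N * CARD('d). point_mass (w m) (point_mass (\<theta> m) (v m))) \<and>
     \<mu>B = (\<Sum>m=1..N * CARD('d). point_mass (w m) (AX (point_mass (\<theta> m) (v m)))) \<and>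
     is_arg_min obj_weight (\<lambda>\<mu>. \<mu> \<in> carr (vmeas MV)) \<mu>M \<and>
     is_arg_min obj_function (\<lambda>\<mu>. \<mu> \<in> carr (vmeas B)) \<mu>B \<and>
     (\<forall>z. AX (int_op MV \<phi> \<mu>M z)
            = (\<lambda>x. \<Sum>m=1..N * CARD('d). (\<phi> (z, w m) * \<psi> (x, \<theta> m)) *\<^sub>R v m) \<and>
          int_op B \<phi> \<mu>B z
            = (\<lambda>x. \<Sum>m=1..N * CARD('d). (\<phi> (z, w m) * \<psi> (x, \<theta> m)) *\<^sub>R v m))"
proof -
  interpret R: rkbs_regression \<phi> \<psi> pair vd xs N zs
    using assms by unfold_locales
  note defs = V_def MV_def B_def AX_def M_def
  let ?J = "avg_loss L N ys"
  let ?n = "N * CARD('d)"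
  obtain bd where "\<And>u n j. n \<in> {1..N} \<Longrightarrow> ?J u \<le> ?J 0 \<Longrightarrow> \<bar>u (n, j)\<bar> \<le> bd"
    by (rule avg_loss_coercive[where L = L and ys = ys, OF \<open>N \<ge> 1\<close> assms(19,18)]) blast
  then have bd': "\<forall>u. ?J u \<le> ?J 0 \<longrightarrow> (\<forall>i\<in>R.I. \<bar>u i\<bar> \<le> bd)"
    by (auto simp: mem_Times_iff)
  \<comment> \<open>The value attained here turns out to be the minimum of both problems.\<close>
  obtain t k where t: "0 \<le> t" and k: "k \<in> R.K"
    and opt: "\<And>t' k'. 0 \<le> t' \<Longrightarrow> k' \<in> R.K \<Longrightarrow> ?J (t *\<^sub>R k) + lam * t \<le> ?J (t' *\<^sub>R k') + lam * t'"
    by (rule exists_regularized_minimizer[OF R.finite_I R.atoms_supported R.zero_in_atoms R.compact_atoms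
          R.uminus_in_atoms avg_loss_lsc[where L = L and ys = ys, OF \<open>N \<ge> 1\<close> assms(19)] bd' \<open>lam \<ge> 0\<close>]) blast+
  obtain w \<theta> v where rep: "t *\<^sub>R k = (\<Sum>m=1..?n. R.atom (w m) (\<theta> m) (v m))"
    and cost: "(\<Sum>m=1..?n. norm (v m)) \<le> t"
    by (rule R.scaled_atoms_representation[OF t imageI[OF k]])
  define \<mu>M where "\<mu>M = (\<Sum>m=1..?n. point_mass (w m) (point_mass (\<theta> m) (v m)))"
  define \<mu>B where "\<mu>B = (\<Sum>m=1..?n. point_mass (w m) (AX (point_mass (\<theta> m) (v m))))"
  have wf: "AX (int_op MV \<phi> \<mu>M z) = (\<lambda>x. \<Sum>m=1..?n. (\<phi> (z, w m) * \<psi> (x, \<theta> m)) *\<^sub>R v m)" for z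
    unfolding \<mu>M_def defs by (rule R.int_op_weight_measure)
  have ff: "int_op B \<phi> \<mu>B z = (\<lambda>x. \<Sum>m=1..?n. (\<phi> (z, w m) * \<psi> (x, \<theta> m)) *\<^sub>R v m)" for z
    unfolding \<mu>B_def defs by (rule R.int_op_function_measure)
  have J_eq: "1 / real N * (\<Sum>n=1..N. L (M (\<lambda>x. \<Sum>m=1..?n. (\<phi> (zs n, w m) * \<psi> (x, \<theta> m)) *\<^sub>R v m)) (ys n))
      = ?J (t *\<^sub>R k)"
    unfolding rep R.sum_atoms_eq M_def
    by (rule R.avg_loss_measurement[where L = L and f = "\<lambda>z x. \<Sum>m=1..?n. (\<phi> (z, w m) * \<psi> (x, \<theta> m)) *\<^sub>R v m" and ys = ys])
  have mM: "\<mu>M \<in> carr (vmeas MV)" "nrm (vmeas MV) \<mu>M \<le> t"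
    using R.weight_measure[where S = "{1..?n}" and w = w and \<theta> = \<theta> and v = v] cost unfolding \<mu>M_def defs by (auto intro: order_trans)
  have mB: "\<mu>B \<in> carr (vmeas B)" "nrm (vmeas B) \<mu>B \<le> t"
    using R.function_measure[where S = "{1..?n}" and w = w and \<theta> = \<theta> and v = v] cost unfolding \<mu>B_def defs by (auto intro: order_trans)
  \<comment> \<open>The norm is at most the total weight, hence at most \<open>t\<close>, and
    \<open>lam \<ge> 0\<close> turns this into a bound on the objective.\<close>
  have oM: "obj_weight \<mu>M \<le> ?J (t *\<^sub>R k) + lam * t"
    unfolding obj_weight_def wf J_eq using mM(2) \<open>lam \<ge> 0\<close> by (simp add: mult_left_mono)
  have oB: "obj_function \<mu>B \<le> ?J (t *\<^sub>R k) + lam * t"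
    unfolding obj_function_def ff J_eq using mB(2) \<open>lam \<ge> 0\<close> by (simp add: mult_left_mono)
  \<comment> \<open>Every admissible measure yields a competitor in the finite-dimensional problem,
    with its norm as the scaling factor.\<close>
  have lM: "?J (t *\<^sub>R k) + lam * t \<le> obj_weight \<mu>" if \<mu>: "\<mu> \<in> carr (vmeas MV)" for \<mu>
  proof -
    let ?u = "\<lambda>i. if i \<in> R.I then pair (vd (snd i)) (AX (int_op MV \<phi> \<mu> (zs (fst i))) (xs (snd i))) else 0"
    have "?u \<in> (\<lambda>k. nrm (vmeas MV) \<mu> *\<^sub>R k) ` R.K"
      using R.weight_in_scaled[of \<mu>] \<mu> unfolding defs by blast
    then obtain k' where k': "k' \<in> R.K" "?u = nrm (vmeas MV) \<mu> *\<^sub>R k'" by (elim imageE)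
    have "0 \<le> nrm (vmeas MV) \<mu>" unfolding defs by (rule R.MV.nrm_vmeas_nonneg)
    from opt[OF this k'(1)]
    show ?thesis
      unfolding k'(2)[symmetric] obj_weight_def M_def
        R.avg_loss_measurement[where L = L and f = "\<lambda>z. AX (int_op MV \<phi> \<mu> z)" and ys = ys] .
  qed
  have lB: "?J (t *\<^sub>R k) + lam * t \<le> obj_function \<mu>" if \<mu>: "\<mu> \<in> carr (vmeas B)" for \<mu>
  proof -
    let ?u = "\<lambda>i. if i \<in> R.I then pair (vd (snd i)) (int_op B \<phi> \<mu> (zs (fst i)) (xs (snd i))) else 0"
    have "?u \<in> (\<lambda>k. nrm (vmeas B) \<mu> *\<^sub>R k) ` R.K"
      using R.function_in_scaled[of \<mu>] \<mu> unfolding defs by blast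
    then obtain k' where k': "k' \<in> R.K" "?u = nrm (vmeas B) \<mu> *\<^sub>R k'" by (elim imageE)
    have "0 \<le> nrm (vmeas B) \<mu>" unfolding defs by (rule R.B.nrm_vmeas_nonneg)
    from opt[OF this k'(1)]
    show ?thesis
      unfolding k'(2)[symmetric] obj_function_def M_def
        R.avg_loss_measurement[where L = L and f = "\<lambda>z. int_op B \<phi> \<mu> z" and ys = ys] .
  qed
  have "is_arg_min obj_weight (\<lambda>\<mu>. \<mu> \<in> carr (vmeas MV)) \<mu>M"
    unfolding is_arg_min_def using mM(1) oM lM by (meson leD order_trans)
  moreover have "is_arg_min obj_function (\<lambda>\<mu>. \<mu> \<in> carr (vmeas B)) \<mu>B"
    unfolding is_arg_min_def using mB(1) oB lB by (meson leD order_trans)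
  ultimately show ?thesis
    using wf ff \<mu>M_def \<mu>B_def by (intro exI[of _ w] exI[of _ \<theta>] exI[of _ v] exI[of _ \<mu>M] exI[of _ \<mu>B] conjI allI)
qed

end
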